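(* Let $C\subseteq\mathbb R^d$ be a $p$-convex set ($p\in\mathbb N$) with $|C|=1$, let $\mathbf c_n=(c_{n,1},\dots,c_{n,d})$ be vectors with $0<c_{n,\ell}\to\infty$ for each $\ell$, and let $D_n=(\mathbf c_nC)\cap\mathbb Z^d$. Let $(\xi_v)_{v\in\mathbb Z^d}$ be a stationary real-valued random field satisfying condition $\mathcal D(x_n;K_n)$ for some real sequence $(x_n)_{n\in\mathbb N}$, with associated vectors $\boldsymbol\gamma_n$ and constants $\alpha_n$. Let $(k_n)$ be a sequence of integers satisfying $k_n\to\infty$, $k_n\alpha_n\to0$ and $k_n^{1/d}\boldsymbol\gamma_n=o(\mathbf c_n)$ as $n\to\infty$, such that condition $\mathcal D^\ell(x_n;k_n;\theta)$ is satisfied for some $\theta\in(0,1]$. Let $(B_n^1)_{n\in\mathbb N},\dots,(B_n^G)_{n\in\mathbb N}$ be sequences of sets in $\mathbb Z^d$, each satisfying the geometric assumption, such that $B_n^g\subseteq D_n$ for all $n$ and $g$, and $B_n^1,\dots,B_n^G$ are pairwise disjoint. Assume furthermore that $\lim_{n\to\infty}|B_n^g|/|D_n|=b_g$ for each $g=1,\dots,G$, where $0\le b_g<\infty$. If for some $0<\tau<\infty$, $|D_n|\,\mathbb P(\xi_0>x_n)\to\tau$, then $$(L_n(B_n^1),\dots,L_n(B_n^G))\stackrel{\mathcal D}{\to}(L^1,\dots,L^G)\quad\text{and}\quad(\tilde L_n(B_n^1),\dots,\tilde L_n(B_n^G))\stackrel{\mathcal D}{\to}(L^1,\dots,L^G)$$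 in distribution as $n\to\infty$, where $L^1,\dots,L^G$ are independent random variables with each $L^g$ being Poisson distributed with parameter $b_g\theta\tau$. (Here $b_g=0$ means that $\mathbb P(L^g=0)=1$.)
   Context: Notation: $d\in\mathbb N$; $|\cdot|$ denotes the Euclidean norm of a point, Lebesgue measure of a full-dimensional subset of $\mathbb R^d$, and cardinality of a subset of $\mathbb Z^d$ (or of a finite set of points). For vectors $\mathbf r=(r_1,\dots,r_d)$ and $A\subseteq\mathbb R^d$, $\mathbf rA=\{(r_1a_1,\dots,r_da_d):a\in A\}$; products and quotients of vectors are coordinate-wise. $A\oplus B$ is the Minkowski sum, $B(1)$ the closed Euclidean unit ball. $\mathbf r_n=o(\mathbf c_n)$ means $r_{n,\ell}/c_{n,\ell}\to0$ for each $\ell$. $M_\xi(A)=\max_{v\in A}\xi_v$, with $M_\xi(\emptyset)=-\infty$. A convex body is a compact convex subset of $\mathbb R^d$ with non-empty interior; a set is $p$-convex if it is a union of $p$ convex bodies. Write $C_n=\mathbf c_nC$. Geometric assumption on a sequence $(B_n)$ of subsets of $\mathbb Z^d$: there are $q\in\mathbb N$ and $q$-convex sets $\overline B_n=\bigcup_{i=1}^q\overline B_{n,i}$ with $B_n=\overline B_n\cap\mathbb Z^d$ and $|\overline B_n|\to\infty$, and vectors $\mathbf b_n=(b_{n,1},\dots,b_{n,d})$ with $0<b_{n,\ell}<\infty$ such that (i) $b_{n,\ell}\to\infty$ for all $\ell$; (ii) $b_{n,1}\cdots b_{n,d}\sim|\overline B_n|$; (iii) for some $0<c<\infty$, $\overline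 B_n\subseteq\mathbf b_n[-c,c]^d$ for all $n$. (The number $q$ and vectors $\mathbf b_n$ may differ for different sequences.) Boxes: every sequence $(k_n)$ considered consists of positive integers with $k_n\to\infty$ and $k_n^{1/d}=o(c_{n,\ell})$ for all $\ell$. Put $t_{n,k_n}^\ell=\lfloor c_{n,\ell}/k_n^{1/d}\rfloor$, $\mathbf t_{n,k_n}=(t_{n,k_n}^1,\dots,t_{n,k_n}^d)$, and for $z\in\mathbb Z^d$, $I_z^{n,k_n}=\mathbf t_{n,k_n}(z+[0,1)^d)$, $J_z^{n,k_n}=I_z^{n,k_n}\cap\mathbb Z^d$, and $D_{n,k_n}^+=\bigcup\{J_z^{n,k_n}: I_z^{n,k_n}\cap C_n\ne\emptyset\}$. $K_n=\mathbb Z^d\cap\mathbf c_n[-c,c]^d$, where $0<c<\infty$ is a fixed constant (which can be chosen independently of $(k_n)$) such that $D_{n,k_n}^+\subseteq K_n$ for all $n$. Condition $\mathcal D(x_n;K_n)$: sets $A,B\subseteq\mathbb Z^d$ are $\boldsymbol\gamma$-separated if $B\subseteq(A\oplus\boldsymbol\gamma B(1))^c$. The condition holds for $(\xi_v)$ if there is an increasing sequence of $d$-dimensional vectors $\boldsymbol\gamma_n$ with $\boldsymbol\gamma_n=o(\mathbf c_n)$ and constants $\alpha_n\to0$ such that for all $n$ and all $\boldsymbol\gamma_n$-separated $A,B\subseteq K_n$, at least one of which is a box, $|\mathbb P(M_\xi(A\cup B)\le x_n)-\mathbb P(M_\xi(A)\le x_n)\mathbb P(M_\xi(B)\le x_n)|\le\alpha_n$.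 Order: $\preceq$ is an arbitrary fixed translation invariant total order on $\mathbb Z^d$, and $A_v^{n,k_n}=\{z\in(v+\mathbf t_{n,k_n}[-1,1]^d)\cap\mathbb Z^d: v\prec z\}$. Condition $\mathcal D^\ell(x_n;k_n;\theta)$: $\mathbb P(M_\xi(A_0^{n,k_n})\le x_n\mid\xi_0>x_n)\to\theta$ as $n\to\infty$. Cluster counting measures on $\mathbb Z^d$: for $A\subseteq\mathbb Z^d$, $L_n(A)=\sum_{z\in\mathbb Z^d}\mathbf 1_{A\cap D_n}(\mathbf t_{n,k_n}z)\mathbf 1_{\{M_\xi(J_z^{n,k_n})>x_n\}}$. Next let $Q_{n,k_n}^-=\{z\in\mathbb Z^d: z\,\mathbf t_{n,k_n}/\mathbf c_n\in C\}$, $\tilde D_{n,k_n}=\bigcup_{z\in Q_{n,k_n}^-}J_z^{n,k_n}$ and $\Phi_n=\{v/\mathbf c_n: v\in\tilde D_{n,k_n},\ \xi_v>x_n\}$. Two points $u,u'\in\Phi_n$ are in the same cluster if there is a sequence of distinct elements $u=u_0,u_1,\dots,u_R=u'$ of that cluster (i.e. of $\Phi_n$) with $|u_i-u_{i-1}|\le\sqrt d/k_n^{1/d}$ for all $i$. This divides $\Phi_n$ uniquely into $X_{n,k_n}$ disjoint clusters $\mathcal C_1^{n,k_n},\dots,\mathcal C_{X_{n,k_n}}^{n,k_n}$; the cluster point of $\mathcal C_i^{n,k_n}$ is $x_i^{n,k_n}=\arg\min_{x\in\mathcal C_i^{n,k_n}}\sum_{x'\in\mathcal C_i^{n,k_n}}|x-x'|^2$.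 For $A\subseteq\mathbb Z^d$, $\tilde L_n(A)=\sum_{i=1}^{X_{n,k_n}}\mathbf 1_{A\cap D_n}(\mathbf c_nx_i^{n,k_n})$ (equal to $0$ if $X_{n,k_n}=0$). *)

theory Defs
  imports "HOL-Probability.Probability"
begin

section \<open>Lattice points and coordinatewise operations\<close>

text \<open>
  The lattice $\mathbb{Z}^d$ is the type \<open>int ^ 'd\<close> with \<open>d = CARD('d)\<close>, embedded into
  \<open>real ^ 'd\<close> by \<open>rvec\<close>.  The library product and order on vectors are coordinatewise,
  so \<open>r * a\<close> is the coordinatewise product and \<open>(*) r ` A\<close> is the scaled set $\mathbf{r}A$.
\<close>

definition rvec :: "int ^ 'd \<Rightarrow> real ^ 'd" where
  "rvec v = (\<chi> i. real_of_int (v $ i))"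

definition vquot :: "real ^ 'd \<Rightarrow> real ^ 'd \<Rightarrow> real ^ 'd" where
  "vquot x y = (\<chi> i. x $ i / y $ i)"

definition lattice_points :: "(real ^ 'd) set \<Rightarrow> (int ^ 'd) set" where
  "lattice_points S = {v. rvec v \<in> S}"

definition vec_smallo :: "(nat \<Rightarrow> real ^ 'd) \<Rightarrow> (nat \<Rightarrow> real ^ 'd) \<Rightarrow> bool" where
  "vec_smallo r c \<longleftrightarrow> (\<forall>i. (\<lambda>n. r n $ i / c n $ i) \<longlonglongrightarrow> 0)"

definition sym_cube :: "real \<Rightarrow> (real ^ 'd) set" where
  "sym_cube s = {x. \<forall>i. - s \<le> x $ i \<and> x $ i \<le> s}"


section \<open>Geometric notions\<close>

definition convex_body :: "(real ^ 'd) set \<Rightarrow> bool" where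
  "convex_body S \<longleftrightarrow> compact S \<and> convex S \<and> interior S \<noteq> {}"

definition p_convex :: "nat \<Rightarrow> (real ^ 'd) set \<Rightarrow> bool" where
  "p_convex p S \<longleftrightarrow> (\<exists>K. (\<forall>i<p. convex_body (K i)) \<and> S = (\<Union>i<p. K i))"

definition geometric_assumption :: "(nat \<Rightarrow> (int ^ 'd) set) \<Rightarrow> bool" where
  "geometric_assumption B \<longleftrightarrow>
    (\<exists>q Bbar b s.
      1 \<le> q \<and> (\<forall>n. p_convex q (Bbar n)) \<and>
      (\<forall>n. B n = lattice_points (Bbar n)) \<and>
      filterlim (\<lambda>n. measure lebesgue (Bbar n)) at_top sequentially \<and>
      (\<forall>n i. 0 < b n $ i) \<and>
      (\<forall>i. filterlim (\<lambda>n. b n $ i) at_top sequentially) \<and>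
      (\<lambda>n. \<Prod>i\<in>UNIV. b n $ i) \<sim>[sequentially] (\<lambda>n. measure lebesgue (Bbar n)) \<and>
      0 < s \<and> (\<forall>n. Bbar n \<subseteq> (*) (b n) ` sym_cube s))"


section \<open>The boxes $I_z$, $J_z$ and the derived index sets\<close>

text \<open>In the definitions below, \<open>c\<close> and \<open>k\<close> stand for $\mathbf{c}_n$ and $k_n$ with $n$ fixed.\<close>

definition tvec :: "real ^ 'd \<Rightarrow> nat \<Rightarrow> int ^ 'd" where
  "tvec c k = (\<chi> i. \<lfloor>c $ i / root CARD('d) (real k)\<rfloor>)"

definition I_box :: "real ^ 'd \<Rightarrow> nat \<Rightarrow> int ^ 'd \<Rightarrow> (real ^ 'd) set" where
  "I_box c k z = (\<lambda>x. rvec (tvec c k) * (rvec z + x)) ` {x. \<forall>i. 0 \<le> x $ i \<and> x $ i < 1}"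

definition J_box :: "real ^ 'd \<Rightarrow> nat \<Rightarrow> int ^ 'd \<Rightarrow> (int ^ 'd) set" where
  "J_box c k z = lattice_points (I_box c k z)"

definition D_set :: "(real ^ 'd) set \<Rightarrow> real ^ 'd \<Rightarrow> (int ^ 'd) set" where
  "D_set C c = lattice_points ((*) c ` C)"

definition D_plus :: "(real ^ 'd) set \<Rightarrow> real ^ 'd \<Rightarrow> nat \<Rightarrow> (int ^ 'd) set" where
  "D_plus C c k = (\<Union>z\<in>{z. I_box c k z \<inter> (*) c ` C \<noteq> {}}. J_box c k z)"

definition K_set :: "real \<Rightarrow> real ^ 'd \<Rightarrow> (int ^ 'd) set" where
  "K_set s c = lattice_points ((*) c ` sym_cube s)"

definition Q_minus :: "(real ^ 'd) set \<Rightarrow> real ^ 'd \<Rightarrow> nat \<Rightarrow> (int ^ 'd) set" where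
  "Q_minus C c k = {z. vquot (rvec (z * tvec c k)) c \<in> C}"

definition D_tilde :: "(real ^ 'd) set \<Rightarrow> real ^ 'd \<Rightarrow> nat \<Rightarrow> (int ^ 'd) set" where
  "D_tilde C c k = (\<Union>z\<in>Q_minus C c k. J_box c k z)"


section \<open>Random fields, mixing and anti-clustering conditions\<close>

text \<open>
  The maximum over \<open>A\<close>.  It is extended-real valued, so the value at the empty set is
  \<open>- \<infinity>\<close>; for the finite sets occurring here, the supremum is a maximum.
\<close>

definition field_max :: "(int ^ 'd \<Rightarrow> 'a \<Rightarrow> real) \<Rightarrow> (int ^ 'd) set \<Rightarrow> 'a \<Rightarrow> ereal" where
  "field_max \<xi> A \<omega> = (SUP v\<in>A. ereal (\<xi> v \<omega>))"

text \<open>Strict stationarity: every shift of the field has the same law on the product space.\<close>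

definition stationary_field :: "'a measure \<Rightarrow> (int ^ 'd \<Rightarrow> 'a \<Rightarrow> real) \<Rightarrow> bool" where
  "stationary_field M \<xi> \<longleftrightarrow>
    (\<forall>h. distr M (Pi\<^sub>M UNIV (\<lambda>_. borel)) (\<lambda>\<omega> v. \<xi> (v + h) \<omega>) =
         distr M (Pi\<^sub>M UNIV (\<lambda>_. borel)) (\<lambda>\<omega> v. \<xi> v \<omega>))"

definition separated :: "real ^ 'd \<Rightarrow> (int ^ 'd) set \<Rightarrow> (int ^ 'd) set \<Rightarrow> bool" where
  "separated \<gamma> A B \<longleftrightarrow>
    rvec ` B \<subseteq> - {a + e | a e. a \<in> rvec ` A \<and> e \<in> (*) \<gamma> ` cball 0 1}"

text \<open>A box in the lattice is an order interval \<open>{a..b}\<close> for the coordinatewise order.\<close>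

definition is_lattice_box :: "(int ^ 'd) set \<Rightarrow> bool" where
  "is_lattice_box A \<longleftrightarrow> (\<exists>a b. A = {a..b})"

definition cond_D ::
  "'a measure \<Rightarrow> (int ^ 'd \<Rightarrow> 'a \<Rightarrow> real) \<Rightarrow> (nat \<Rightarrow> real ^ 'd) \<Rightarrow> (nat \<Rightarrow> real) \<Rightarrow>
   (nat \<Rightarrow> (int ^ 'd) set) \<Rightarrow> (nat \<Rightarrow> real ^ 'd) \<Rightarrow> (nat \<Rightarrow> real) \<Rightarrow> bool" where
  "cond_D M \<xi> c x K \<gamma> \<alpha> \<longleftrightarrow>
    incseq \<gamma> \<and> vec_smallo \<gamma> c \<and> \<alpha> \<longlonglongrightarrow> 0 \<and>
    (\<forall>n A B. A \<subseteq> K n \<and> B \<subseteq> K n \<and> separated (\<gamma> n) A B \<and>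
        (is_lattice_box A \<or> is_lattice_box B) \<longrightarrow>
      \<bar>\<P>(\<omega> in M. field_max \<xi> (A \<union> B) \<omega> \<le> ereal (x n))
        - \<P>(\<omega> in M. field_max \<xi> A \<omega> \<le> ereal (x n))
          * \<P>(\<omega> in M. field_max \<xi> B \<omega> \<le> ereal (x n))\<bar> \<le> \<alpha> n)"

definition translation_invariant :: "(int ^ 'd) rel \<Rightarrow> bool" where
  "translation_invariant r \<longleftrightarrow> (\<forall>u v w. (u, v) \<in> r \<longrightarrow> (u + w, v + w) \<in> r)"

text \<open>A pair \<open>(u, v) \<in> r\<close> means $u \preceq v$.\<close>

definition A_set :: "(int ^ 'd) rel \<Rightarrow> real ^ 'd \<Rightarrow> nat \<Rightarrow> int ^ 'd \<Rightarrow> (int ^ 'd) set" where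
  "A_set r c k v =
    {z \<in> lattice_points ((+) (rvec v) ` (*) (rvec (tvec c k)) ` sym_cube 1).
      (v, z) \<in> r \<and> v \<noteq> z}"

definition cond_Dl ::
  "'a measure \<Rightarrow> (int ^ 'd \<Rightarrow> 'a \<Rightarrow> real) \<Rightarrow> (int ^ 'd) rel \<Rightarrow> (nat \<Rightarrow> real ^ 'd) \<Rightarrow>
   (nat \<Rightarrow> real) \<Rightarrow> (nat \<Rightarrow> nat) \<Rightarrow> real \<Rightarrow> bool" where
  "cond_Dl M \<xi> r c x k \<theta> \<longleftrightarrow>
    (\<lambda>n. \<P>(\<omega> in M. field_max \<xi> (A_set r (c n) (k n) 0) \<omega> \<le> ereal (x n) \<bar> \<xi> 0 \<omega> > x n))
      \<longlonglongrightarrow> \<theta>"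


section \<open>Cluster counting measures\<close>

text \<open>
  The sum below has finitely many terms as soon as \<open>tvec c k\<close> has positive coordinates,
  which holds for all large \<open>n\<close> when $k_n^{1/d} = o(\mathbf{c}_n)$.  For the finitely many
  other \<open>n\<close> the library convention for sums over infinite sets applies.
\<close>

definition L_count ::
  "(int ^ 'd \<Rightarrow> 'a \<Rightarrow> real) \<Rightarrow> (real ^ 'd) set \<Rightarrow> real ^ 'd \<Rightarrow> nat \<Rightarrow> real \<Rightarrow>
   (int ^ 'd) set \<Rightarrow> 'a \<Rightarrow> nat" where
  "L_count \<xi> C c k x A \<omega> =
    (\<Sum>z | tvec c k * z \<in> A \<inter> D_set C c. of_bool (field_max \<xi> (J_box c k z) \<omega> > ereal x))"

definition Phi ::
  "(int ^ 'd \<Rightarrow> 'a \<Rightarrow> real) \<Rightarrow> (real ^ 'd) set \<Rightarrow> real ^ 'd \<Rightarrow> nat \<Rightarrow> real \<Rightarrow> 'a \<Rightarrow>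
   (real ^ 'd) set" where
  "Phi \<xi> C c k x \<omega> = {vquot (rvec v) c | v. v \<in> D_tilde C c k \<and> \<xi> v \<omega> > x}"

definition same_cluster :: "(real ^ 'd) set \<Rightarrow> real \<Rightarrow> real ^ 'd \<Rightarrow> real ^ 'd \<Rightarrow> bool" where
  "same_cluster S \<delta> u u' \<longleftrightarrow>
    (\<exists>us. us \<noteq> [] \<and> distinct us \<and> set us \<subseteq> S \<and> hd us = u \<and> last us = u' \<and>
      successively (\<lambda>a b. norm (b - a) \<le> \<delta>) us)"

definition clusters :: "(real ^ 'd) set \<Rightarrow> real \<Rightarrow> (real ^ 'd) set set" where
  "clusters S \<delta> = S // {(u, u'). u \<in> S \<and> u' \<in> S \<and> same_cluster S \<delta> u u'}"

text \<open>Ties between minimizers are broken by the (unspecified) choice made by \<open>arg_min_on\<close>.\<close>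

definition cluster_point :: "(real ^ 'd) set \<Rightarrow> real ^ 'd" where
  "cluster_point S = arg_min_on (\<lambda>y. \<Sum>y'\<in>S. (norm (y - y'))\<^sup>2) S"

definition Ltilde_count ::
  "(int ^ 'd \<Rightarrow> 'a \<Rightarrow> real) \<Rightarrow> (real ^ 'd) set \<Rightarrow> real ^ 'd \<Rightarrow> nat \<Rightarrow> real \<Rightarrow>
   (int ^ 'd) set \<Rightarrow> 'a \<Rightarrow> nat" where
  "Ltilde_count \<xi> C c k x A \<omega> =
    (\<Sum>S \<in> clusters (Phi \<xi> C c k x \<omega>) (sqrt (real CARD('d)) / root CARD('d) (real k)).
      of_bool (c * cluster_point S \<in> rvec ` (A \<inter> D_set C c)))"


section \<open>Limit laws\<close>

text \<open>The library's \<open>poisson_pmf\<close> requires a positive rate.\<close>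

definition poisson_law :: "real \<Rightarrow> nat pmf" where
  "poisson_law \<mu> = (if \<mu> = 0 then return_pmf 0 else poisson_pmf \<mu>)"

definition converges_in_distribution ::
  "'a measure \<Rightarrow> (nat \<Rightarrow> 'a \<Rightarrow> 'c::topological_space) \<Rightarrow> 'b measure \<Rightarrow> ('b \<Rightarrow> 'c) \<Rightarrow> bool" where
  "converges_in_distribution M X N Y \<longleftrightarrow>
    (\<forall>n. X n \<in> borel_measurable M) \<and> Y \<in> borel_measurable N \<and>
    (\<forall>f :: 'c \<Rightarrow> real. continuous_on UNIV f \<and> bounded (range f) \<longrightarrow>
      (\<lambda>n. \<integral>\<omega>. f (X n \<omega>) \<partial>M) \<longlonglongrightarrow> (\<integral>\<omega>. f (Y \<omega>) \<partial>N))"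

end

theory Submission
  imports Defs
begin

text \<open>
  Call a cell \<open>J_z\<close> hit if it contains an exceedance, and let \<open>p\<close> be the probability of this.
  Since a single cell is a box, the mixing condition lets one peel off the cells of any finite set
  \<open>S\<close> of cells one by one, each at cost \<open>o(1/k)\<close>, so that the probability that no cell of \<open>S\<close>
  is hit is \<open>(1 - p)^|S| + o(|S|/k)\<close>, uniformly in \<open>S\<close>.  Independent thinning turns these void
  probabilities into the joint generating function: \<open>E (\<Prod> u\<^sub>g ^ L\<^sub>g)\<close> is
  the probability that no hit survives when hits in \<open>B\<^sup>g\<close> are kept with probability \<open>1 - u\<^sub>g\<close>,
  hence it is \<open>\<Prod> (1 - (1 - u\<^sub>g) p) ^ N\<^sub>g + o(1)\<close>, where \<open>N\<^sub>g\<close> counts the cells with corner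
  in \<open>B\<^sup>g\<close>.  Decomposing a hit according to its last exceedance gives \<open>p \<sim> \<theta> |J| P(\<xi>\<^sub>0 > x)\<close>,
  whence \<open>N\<^sub>g p \<rightarrow> b\<^sub>g \<theta> \<tau>\<close>.  The two counts agree unless two nearby cells are
  both hit or there is an exceedance \<open>v\<close> such that exactly one of \<open>v\<close> and the corner of its
  cell lies in \<open>B\<^sup>g\<close>; both events are asymptotically negligible.
\<close>

section \<open>Cells\<close>

text \<open>\<open>cond_D\<close> decouples a box from a set only across a gap of size \<gamma>,
  while neighbouring cells touch. A cell that is peeled off is therefore first shrunk to its core by
  the integer margin floor |\<gamma>|. The core is still a box, and its partner may have any shape,
  so a union of other cells is allowed. The margin makes up a fraction of order k^(1/d) \<gamma> / c
  of a cell, and a cell contains O(1/k) exceedances on average; the two rate conditions on k and the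
  mixing data thus make the cost of one peeling o(1/k). At most O(k) cells have their corner in D,
  so all costs add up to o(1). Thinning is a convex combination of void probabilities, so passing to
  generating functions averages errors and does not enlarge them. The limit generating function is a
  product over g, which already contains the independence of the limits. Convexity enters by
  counting: the points that a set B separates from the corner of their cell number O(vol / k^(1/d)),
  where vol is the product of the c_i. This one estimate serves both for the number of cells per B
  and for the comparison of the two counts.\<close>

lemma finite_vec_box:
  fixes R :: "'d::finite \<Rightarrow> 'a set"
  assumes "\<And>i. finite (R i)"
  shows "finite {v :: 'a ^ 'd. \<forall>i. v $ i \<in> R i}"
    and "card {v :: 'a ^ 'd. \<forall>i. v $ i \<in> R i} = (\<Prod>i\<in>UNIV. card (R i))"
proof -
  have eq: "{v :: 'a ^ 'd. \<forall>i. v $ i \<in> R i} = vec_lambda ` (PiE UNIV R)"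
  proof (intro set_eqI iffI)
    fix v :: "'a ^ 'd" assume "v \<in> {v. \<forall>i. v $ i \<in> R i}"
    then have "vec_nth v \<in> PiE UNIV R" "v = vec_lambda (vec_nth v)" by auto
    then show "v \<in> vec_lambda ` (PiE UNIV R)" by (metis imageI)
  qed auto
  show "finite {v :: 'a ^ 'd. \<forall>i. v $ i \<in> R i}"
    unfolding eq using assms by (intro finite_imageI finite_PiE) auto
  have "card (vec_lambda ` (PiE UNIV R) :: ('a ^ 'd) set) = card (PiE UNIV R)"
    by (intro card_image inj_onI) (metis vec_lambda_inverse UNIV_I)
  then show "card {v :: 'a ^ 'd. \<forall>i. v $ i \<in> R i} = (\<Prod>i\<in>UNIV. card (R i))"
    unfolding eq by (simp add: card_PiE)
qed

text \<open>Integer form of \<open>J_box\<close>, valid once all \<open>t $ i\<close> are positive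
  (\<open>J_box_eq_cell\<close>); counting and shifting then need no real arithmetic.\<close>

definition cell :: "int ^ 'd \<Rightarrow> int ^ 'd \<Rightarrow> (int ^ 'd) set" where
  "cell t z = {v. \<forall>i. t $ i * z $ i \<le> v $ i \<and> v $ i < t $ i * z $ i + t $ i}"

definition cell_index :: "int ^ 'd \<Rightarrow> int ^ 'd \<Rightarrow> int ^ 'd" where
  "cell_index t v = (\<chi> i. v $ i div t $ i)"

text \<open>Coordinatewise floor division assigns every lattice point to exactly one cell;
  disjointness and covering both follow from this equivalence.\<close>

lemma mem_cell_iff:
  assumes "\<And>i. 0 < t $ i"
  shows "v \<in> cell t z \<longleftrightarrow> z = cell_index t v"
proof -
  have "t $ i * z $ i \<le> v $ i \<and> v $ i < t $ i * z $ i + t $ i \<longleftrightarrow> z $ i = v $ i div t $ i" for i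
  proof
    assume "t $ i * z $ i \<le> v $ i \<and> v $ i < t $ i * z $ i + t $ i"
    then show "z $ i = v $ i div t $ i"
      using int_div_pos_eq[of "v $ i" "t $ i" "z $ i" "v $ i - t $ i * z $ i"] assms[of i] by simp
  next
    assume *: "z $ i = v $ i div t $ i"
    show "t $ i * z $ i \<le> v $ i \<and> v $ i < t $ i * z $ i + t $ i"
      unfolding * using assms[of i] pos_mod_bound[of "t $ i" "v $ i"] pos_mod_sign[of "t $ i" "v $ i"]
        mult_div_mod_eq[of "t $ i" "v $ i"] by linarith
  qed
  then show ?thesis by (simp add: cell_def cell_index_def vec_eq_iff)
qed

lemma cell_box: "cell t z = {v. \<forall>i. v $ i \<in> {t $ i * z $ i ..< t $ i * z $ i + t $ i}}"
  by (auto simp: cell_def)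

lemma finite_cell [simp]: "finite (cell t z)"
  unfolding cell_box by (rule finite_vec_box) simp

lemma card_cell: "card (cell t z) = (\<Prod>i\<in>UNIV. nat (t $ i))"
  unfolding cell_box by (subst finite_vec_box) simp_all

lemma cell_disjoint: "(\<And>i. 0 < t $ i) \<Longrightarrow> z \<noteq> z' \<Longrightarrow> cell t z \<inter> cell t z' = {}"
  by (auto simp: mem_cell_iff)

lemma corner_mem_cell: "(\<And>i. 0 < t $ i) \<Longrightarrow> t * z \<in> cell t z"
  by (simp add: cell_def)

lemma cell_shift: "cell t z = (\<lambda>v. v + t * z) ` cell t 0"
proof (intro set_eqI iffI)
  fix v assume "v \<in> cell t z"
  then have "v - t * z \<in> cell t 0" by (auto simp: cell_def algebra_simps)
  then show "v \<in> (\<lambda>v. v + t * z) ` cell t 0" by (rule rev_image_eqI) simp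
qed (auto simp: cell_def algebra_simps)

lemma tvec_nonneg: "(\<And>i. 0 < c $ i) \<Longrightarrow> 0 \<le> tvec c k $ i"
  by (auto simp: tvec_def less_imp_le intro!: divide_nonneg_nonneg)

lemma J_box_eq_cell:
  assumes "\<And>i. 0 < tvec c k $ i"
  shows "J_box c k z = cell (tvec c k) z"
proof -
  let ?t = "tvec c k"
  have t: "0 < real_of_int (?t $ i)" for i using assms by simp
  show ?thesis
  proof (intro set_eqI iffI)
    fix v assume "v \<in> J_box c k z"
    then obtain x where x: "\<forall>i. 0 \<le> x $ i \<and> x $ i < 1" "rvec v = rvec ?t * (rvec z + x)"
      by (auto simp: J_box_def lattice_points_def I_box_def)
    have "?t $ i * z $ i \<le> v $ i \<and> v $ i < ?t $ i * z $ i + ?t $ i" for i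
    proof -
      have "real_of_int (v $ i) = ?t $ i * (z $ i + x $ i)"
        using arg_cong[OF x(2), of "\<lambda>u. u $ i"] by (simp add: rvec_def)
      moreover have "0 \<le> ?t $ i * x $ i" "?t $ i * x $ i < ?t $ i"
        using x(1) t[of i] by (auto simp: less_imp_le)
      ultimately have "real_of_int (?t $ i * z $ i) \<le> v $ i" "v $ i < real_of_int (?t $ i * z $ i + ?t $ i)"
        by (simp_all add: algebra_simps)
      then show ?thesis by linarith
    qed
    then show "v \<in> cell ?t z" by (simp add: cell_def)
  next
    fix v assume v: "v \<in> cell ?t z"
    define x :: "real ^ 'a" where "x = (\<chi> i. v $ i / ?t $ i - z $ i)"
    have "0 \<le> x $ i \<and> x $ i < 1" for i
    proof -
      have "real_of_int (?t $ i * z $ i) \<le> v $ i" "v $ i < real_of_int (?t $ i * z $ i + ?t $ i)"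
        using v unfolding cell_def by (auto simp del: of_int_mult of_int_add)
      then show ?thesis using t[of i] by (simp add: x_def field_simps)
    qed
    moreover have "rvec v = rvec ?t * (rvec z + x)"
      using t by (simp add: vec_eq_iff rvec_def x_def field_simps less_imp_neq[symmetric])
    ultimately show "v \<in> J_box c k z"
      by (auto simp: J_box_def lattice_points_def I_box_def)
  qed
qed

text \<open>Positivity of \<open>tvec\<close> is deliberately not assumed: the counts must be
  measurable for every n, also when some side length is 0. In such a coordinate the box degenerates
  to a single value, which is why the enclosing intervals are closed on the right.\<close>

lemma finite_J_box:
  assumes "\<And>i. 0 < c $ i"
  shows "finite (J_box c k z)"
proof (rule finite_subset)
  let ?t = "tvec c k"
  show "J_box c k z \<subseteq> {v. \<forall>i. v $ i \<in> {?t $ i * z $ i .. ?t $ i * z $ i + ?t $ i}}"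
  proof
    fix v assume "v \<in> J_box c k z"
    then obtain x where x: "\<forall>i. 0 \<le> x $ i \<and> x $ i < 1" "rvec v = rvec ?t * (rvec z + x)"
      by (auto simp: J_box_def lattice_points_def I_box_def)
    have "?t $ i * z $ i \<le> v $ i \<and> v $ i \<le> ?t $ i * z $ i + ?t $ i" for i
    proof -
      have "real_of_int (v $ i) = ?t $ i * (z $ i + x $ i)"
        using arg_cong[OF x(2), of "\<lambda>u. u $ i"] by (simp add: rvec_def)
      moreover have "0 \<le> ?t $ i * x $ i" "?t $ i * x $ i \<le> ?t $ i"
        using x(1) tvec_nonneg[of c k i, OF assms] by (auto simp: less_imp_le mult_left_le)
      ultimately have "real_of_int (?t $ i * z $ i) \<le> v $ i" "v $ i \<le> real_of_int (?t $ i * z $ i + ?t $ i)"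
        by (simp_all add: algebra_simps)
      then show ?thesis by linarith
    qed
    then show "v \<in> {v. \<forall>i. v $ i \<in> {?t $ i * z $ i .. ?t $ i * z $ i + ?t $ i}}" by simp
  qed
qed (rule finite_vec_box, simp)

section \<open>Lattice points near the boundary of a convex set\<close>

lemma card_window:
  fixes S :: "int set"
  assumes "\<And>y y'. y \<in> S \<Longrightarrow> y' \<in> S \<Longrightarrow> y' < y + t" "0 \<le> t"
  shows "finite S" "int (card S) \<le> t"
proof -
  have fin: "finite S"
  proof (cases "S = {}")
    case False
    then obtain y where "y \<in> S" by auto
    then have "S \<subseteq> {y - t .. y + t}" using assms(1) by force
    then show ?thesis by (rule finite_subset) simp
  qed simp
  then show "finite S" .
  show "int (card S) \<le> t"
  proof (cases "S = {}")
    case False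
    have "S \<subseteq> {Min S ..< Min S + t}"
      using assms(1)[OF Min_in[OF fin False]] fin by auto
    then have "card S \<le> card {Min S ..< Min S + t}" by (intro card_mono) auto
    then show ?thesis using assms(2) by simp
  qed (use assms in simp)
qed

text \<open>An interval has two ends. If y lies in I and its rounding does not, the left end lies
  between them; if only the rounding lies in I, the right end does. Either way all such y fit into a
  window of length t, which gives \<open>2 * t\<close>.\<close>

lemma card_line_boundary:
  fixes I :: "int set" and t :: int
  assumes t: "0 < t"
    and conv: "\<And>a y b. a \<in> I \<Longrightarrow> b \<in> I \<Longrightarrow> a \<le> y \<Longrightarrow> y \<le> b \<Longrightarrow> y \<in> I"
  shows "finite {y. (y \<in> I) \<noteq> (t * (y div t) \<in> I)}"
    and "int (card {y. (y \<in> I) \<noteq> (t * (y div t) \<in> I)}) \<le> 2 * t"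
proof -
  have pi: "t * (y div t) \<le> y" "y < t * (y div t) + t" for y
    using t pos_mod_bound[of t y] pos_mod_sign[of t y] mult_div_mod_eq[of t y] by linarith+
  define S1 where "S1 = {y. y \<in> I \<and> t * (y div t) \<notin> I}"
  define S2 where "S2 = {y. y \<notin> I \<and> t * (y div t) \<in> I}"
  have eq: "{y. (y \<in> I) \<noteq> (t * (y div t) \<in> I)} = S1 \<union> S2"
    by (auto simp: S1_def S2_def)
  have "y' < y + t" if "y \<in> S1" "y' \<in> S1" for y y'
    using that conv[of y y' "t * (y' div t)"] pi[of y'] by (force simp: S1_def)
  note 1 = card_window[of S1 t, OF this]
  have "y' < y + t" if "y \<in> S2" "y' \<in> S2" for y y'
    using that conv[of "t * (y div t)" "t * (y' div t)" y] pi[of y'] pi[of y] by (force simp: S2_def)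
  note 2 = card_window[of S2 t, OF this]
  show "finite {y. (y \<in> I) \<noteq> (t * (y div t) \<in> I)}"
    unfolding eq using 1(1) 2(1) t by simp
  show "int (card {y. (y \<in> I) \<noteq> (t * (y div t) \<in> I)}) \<le> 2 * t"
    unfolding eq using 1(2) 2(2) t card_Un_le[of S1 S2] by linarith
qed

definition vec_upd :: "'a ^ 'd \<Rightarrow> 'd \<Rightarrow> 'a \<Rightarrow> 'a ^ 'd" where
  "vec_upd u j y = (\<chi> i. if i = j then y else u $ i)"

lemma card_fibred:
  fixes A :: "(int ^ 'd::finite) set"
  assumes R: "\<And>i. finite (R i)" "\<And>v i. v \<in> A \<Longrightarrow> i \<noteq> j \<Longrightarrow> v $ i \<in> R i"
    and m: "\<And>u. finite {y. vec_upd u j y \<in> A}" "\<And>u. card {y. vec_upd u j y \<in> A} \<le> m"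
  shows "finite A" "card A \<le> m * (\<Prod>i\<in>UNIV - {j}. card (R i))"
proof -
  \<comment> \<open>\<open>W\<close> contains one representative, with coordinate j equal to 0, of
    every line in direction j that can meet \<open>A\<close>.\<close>
  define W :: "(int ^ 'd) set" where "W = {w. \<forall>i. w $ i \<in> (if i = j then {0} else R i)}"
  have W: "finite W" "card W = (\<Prod>i\<in>UNIV. card (if i = j then {0::int} else R i))"
    unfolding W_def by (rule finite_vec_box; simp add: R(1))+
  have "(\<Prod>i\<in>UNIV. card (if i = j then {0::int} else R i)) = (\<Prod>i\<in>UNIV - {j}. card (R i))"
    by (subst prod.remove[of _ j]) (auto intro!: prod.cong)
  with W have cW: "card W = (\<Prod>i\<in>UNIV - {j}. card (R i))" by simp
  define F where "F w = vec_upd w j ` {y. vec_upd w j y \<in> A}" for w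
  have sub: "A \<subseteq> (\<Union>w\<in>W. F w)"
  proof
    fix v assume v: "v \<in> A"
    have "vec_upd v j 0 \<in> W" using R(2)[OF v] by (auto simp: W_def vec_upd_def)
    moreover have "v = vec_upd (vec_upd v j 0) j (v $ j)" by (simp add: vec_upd_def vec_eq_iff)
    ultimately show "v \<in> (\<Union>w\<in>W. F w)" using v by (auto simp: F_def intro!: bexI[of _ "vec_upd v j 0"])
  qed
  have fF: "finite (F w)" "card (F w) \<le> m" for w
    using m[of w] card_image_le[OF m(1)[of w], of "vec_upd w j"] by (auto simp: F_def)
  have fin: "finite (\<Union>w\<in>W. F w)" using W(1) fF by auto
  show "finite A" using finite_subset[OF sub fin] .
  have "card A \<le> card (\<Union>w\<in>W. F w)" using card_mono[OF fin sub] .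
  also have "\<dots> \<le> (\<Sum>w\<in>W. card (F w))" by (rule card_UN_le[OF W(1)])
  also have "\<dots> \<le> (\<Sum>w\<in>W. m)" by (intro sum_mono fF)
  finally show "card A \<le> m * (\<Prod>i\<in>UNIV - {j}. card (R i))" by (simp add: cW mult.commute)
qed

definition corner :: "int ^ 'd \<Rightarrow> int ^ 'd \<Rightarrow> int ^ 'd" where
  "corner t v = t * cell_index t v"

text \<open>The points whose membership in A changes on passing to the corner of their cell. Off
  this set, A looks like a union of whole cells.\<close>

definition boundary_points :: "int ^ 'd \<Rightarrow> (int ^ 'd) set \<Rightarrow> (int ^ 'd) set" where
  "boundary_points t A = {v. (v \<in> A) \<noteq> (corner t v \<in> A)}"

text \<open>The coordinates are rounded to the corner one at a time: a line parallel to an axis meets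
  a convex set in an interval, so each rounding changes membership for at most \<open>2 * t $ j\<close> points
  of the line.\<close>

lemma card_boundary_convex:
  fixes S :: "(real ^ 'd) set" and t h :: "int ^ 'd"
  assumes t: "\<And>i. 0 < t $ i" and S: "convex S"
    and h: "\<And>v i. v \<in> lattice_points S \<Longrightarrow> \<bar>v $ i\<bar> \<le> h $ i" "\<And>i. 0 \<le> h $ i"
  shows "finite (boundary_points t (lattice_points S))" (is ?fin)
    and "int (card (boundary_points t (lattice_points S))) \<le>
      (\<Sum>j\<in>UNIV. 2 * t $ j * (\<Prod>i\<in>UNIV - {j}. 2 * (h $ i + t $ i) + 1))" (is ?card)
proof -
  define A where "A = lattice_points S"
  have pi: "t $ i * (y div t $ i) \<le> y" "y < t $ i * (y div t $ i) + t $ i" for y i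
    using t[of i] pos_mod_bound[of "t $ i" y] pos_mod_sign[of "t $ i" y] mult_div_mod_eq[of "t $ i" y]
    by linarith+
  define part where "part J v = (\<chi> i. if i \<in> J then t $ i * (v $ i div t $ i) else v $ i)"
    for J and v :: "int ^ 'd"
  define bd where "bd j = 2 * t $ j * (\<Prod>i\<in>UNIV - {j}. 2 * (h $ i + t $ i) + 1)" for j
  have *: "finite {v. (v \<in> A) \<noteq> (part J v \<in> A)} \<and>
    int (card {v. (v \<in> A) \<noteq> (part J v \<in> A)}) \<le> (\<Sum>j\<in>J. bd j)" if "finite J" for J
    using that
  proof induction
    case empty
    have "part {} v = v" for v by (simp add: part_def vec_eq_iff)
    then show ?case by simp
  next
    case (insert j J)
    let ?E = "{v. (part J v \<in> A) \<noteq> (part (insert j J) v \<in> A)}"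
    \<comment> \<open>A point of \<open>?E\<close> or one of its partial roundings lies in S, so is
      bounded by h; rounding moves coordinate i by less than \<open>t $ i\<close>, hence the window
      of radius h + t.\<close>
    define R where "R i = {- (h $ i + t $ i) .. h $ i + t $ i}" for i
    have 1: "v $ i \<in> R i" if "v \<in> ?E" "i \<noteq> j" for v i
    proof -
      have "\<bar>part J v $ i\<bar> \<le> h $ i \<or> \<bar>part (insert j J) v $ i\<bar> \<le> h $ i"
        using that h(1) by (auto simp: A_def)
      then have "\<bar>v $ i\<bar> \<le> h $ i \<or> \<bar>t $ i * (v $ i div t $ i)\<bar> \<le> h $ i"
        by (auto simp: part_def split: if_splits)
      then show ?thesis using pi[where i = i and y = "v $ i"] t[of i] by (auto simp: R_def)
    qed
    have 2: "finite {y. vec_upd u j y \<in> ?E} \<and> int (card {y. vec_upd u j y \<in> ?E}) \<le> 2 * t $ j" for u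
    proof -
      \<comment> \<open>The coordinates in J are already rounded, so the line to look at is the one
        through \<open>part J u\<close>. Both memberships in \<open>?E\<close> are tests against the
        same interval I.\<close>
      define I where "I = {y. vec_upd (part J u) j y \<in> A}"
      have conv: "y \<in> I" if "a \<in> I" "b \<in> I" "a \<le> y" "y \<le> b" for a y b
      proof (cases "a = b")
        case True
        then have "y = a" using that by simp
        then show ?thesis using that by simp
      next
        case False
        define w :: real where "w = (y - a) / (b - a)"
        have w: "0 \<le> w" "w \<le> 1" using that False by (auto simp: w_def field_simps)
        have ab: "real_of_int b - a \<noteq> 0" using False by simp
        have "real_of_int y = a + w * (real_of_int b - a)" using ab by (simp add: w_def)
        then have "rvec (vec_upd (part J u) j y) =
          (1 - w) *\<^sub>R rvec (vec_upd (part J u) j a) + w *\<^sub>R rvec (vec_upd (part J u) j b)"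
          by (simp add: vec_eq_iff rvec_def vec_upd_def algebra_simps)
        moreover have "\<dots> \<in> S"
          using that w S by (intro convexD) (auto simp: I_def A_def lattice_points_def)
        ultimately show ?thesis by (simp add: I_def A_def lattice_points_def)
      qed
      have "part J (vec_upd u j y) = vec_upd (part J u) j y" for y
        using insert by (auto simp: part_def vec_upd_def vec_eq_iff)
      moreover have "part (insert j J) (vec_upd u j y) = vec_upd (part J u) j (t $ j * (y div t $ j))" for y
        using insert by (auto simp: part_def vec_upd_def vec_eq_iff)
      ultimately have "{y. vec_upd u j y \<in> ?E} = {y. (y \<in> I) \<noteq> (t $ j * (y div t $ j) \<in> I)}"
        by (simp add: I_def)
      then show ?thesis using card_line_boundary[OF t conv] by simp
    qed
    have E: "finite ?E" "card ?E \<le> nat (2 * t $ j) * (\<Prod>i\<in>UNIV - {j}. card (R i))"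
      by (rule card_fibred[of R ?E j "nat (2 * t $ j)"]; use 1 2 t[of j] in \<open>force simp: R_def le_nat_iff\<close>)+
    have cR: "int (card (R i)) = 2 * (h $ i + t $ i) + 1" for i
      using h(2)[of i] t[of i] by (simp add: R_def)
    have "int (card ?E) \<le> int (nat (2 * t $ j) * (\<Prod>i\<in>UNIV - {j}. card (R i)))"
      using E(2) by (simp only: of_nat_le_iff)
    also have "\<dots> = bd j" using t[of j] by (simp add: bd_def cR)
    finally have E': "int (card ?E) \<le> bd j" .
    have sub: "{v. (v \<in> A) \<noteq> (part (insert j J) v \<in> A)} \<subseteq> {v. (v \<in> A) \<noteq> (part J v \<in> A)} \<union> ?E"
      by auto
    have fin: "finite ({v. (v \<in> A) \<noteq> (part J v \<in> A)} \<union> ?E)" using insert E by simp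
    have "card {v. (v \<in> A) \<noteq> (part (insert j J) v \<in> A)} \<le> card {v. (v \<in> A) \<noteq> (part J v \<in> A)} + card ?E"
      using card_mono[OF fin sub] card_Un_le order_trans by blast
    then show ?case using insert E' finite_subset[OF sub fin] by simp
  qed
  have "part UNIV v = corner t v" for v by (simp add: part_def corner_def cell_index_def vec_eq_iff)
  then show ?fin ?card using *[of UNIV] by (simp_all add: boundary_points_def A_def bd_def)
qed

lemma card_boundary_p_convex:
  fixes S :: "(real ^ 'd) set" and t h :: "int ^ 'd"
  assumes t: "\<And>i. 0 < t $ i" and S: "p_convex q S"
    and h: "\<And>v i. v \<in> lattice_points S \<Longrightarrow> \<bar>v $ i\<bar> \<le> h $ i" "\<And>i. 0 \<le> h $ i"
  shows "finite (boundary_points t (lattice_points S))" (is ?fin)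
    and "int (card (boundary_points t (lattice_points S))) \<le>
      int q * (\<Sum>j\<in>UNIV. 2 * t $ j * (\<Prod>i\<in>UNIV - {j}. 2 * (h $ i + t $ i) + 1))" (is ?card)
proof -
  obtain K where K: "\<And>i. i < q \<Longrightarrow> convex (K i)" "S = (\<Union>i<q. K i)"
    using S by (auto simp: p_convex_def convex_body_def)
  let ?b = "(\<Sum>j\<in>UNIV. 2 * t $ j * (\<Prod>i\<in>UNIV - {j}. 2 * (h $ i + t $ i) + 1))"
  have one: "finite (boundary_points t (lattice_points (K i)))"
    "int (card (boundary_points t (lattice_points (K i)))) \<le> ?b" if "i < q" for i
    using card_boundary_convex[OF t K(1)[OF that] _ h(2)] h(1) K(2) that
    by (force simp: lattice_points_def)+
  have sub: "boundary_points t (lattice_points S) \<subseteq> (\<Union>i<q. boundary_points t (lattice_points (K i)))"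
    unfolding K(2) by (auto simp: boundary_points_def lattice_points_def)
  have fin: "finite (\<Union>i<q. boundary_points t (lattice_points (K i)))" using one by auto
  show ?fin using finite_subset[OF sub fin] .
  have "card (boundary_points t (lattice_points S)) \<le> card (\<Union>i<q. boundary_points t (lattice_points (K i)))"
    using card_mono[OF fin sub] .
  also have "\<dots> \<le> (\<Sum>i<q. card (boundary_points t (lattice_points (K i))))" by (rule card_UN_le) simp
  finally have "int (card (boundary_points t (lattice_points S))) \<le>
    (\<Sum>i<q. int (card (boundary_points t (lattice_points (K i)))))"
    by (metis of_nat_le_iff of_nat_sum)
  also have "\<dots> \<le> (\<Sum>i<q. ?b)" by (intro sum_mono one) simp
  finally show ?card by simp
qed

lemma card_corner_preimage:
  assumes t: "\<And>i. 0 < t $ i" and fin: "finite {z. t * z \<in> A}"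
  shows "finite {v. corner t v \<in> A}" 
    and "card {v. corner t v \<in> A} = card {z. t * z \<in> A} * (\<Prod>i\<in>UNIV. nat (t $ i))"
proof -
  have eq: "{v. corner t v \<in> A} = (\<Union>z\<in>{z. t * z \<in> A}. cell t z)"
    using mem_cell_iff[OF t] by (auto simp: corner_def)
  show "finite {v. corner t v \<in> A}" unfolding eq using fin by simp
  show "card {v. corner t v \<in> A} = card {z. t * z \<in> A} * (\<Prod>i\<in>UNIV. nat (t $ i))"
    unfolding eq using fin cell_disjoint[OF t]
    by (subst card_UN_disjoint) (auto simp: card_cell)
qed

text \<open>The cells with corner in A have total size (number of cells) times (cell volume), and
  their union differs from A exactly in the boundary points.\<close>

lemma card_corner_diff:
  assumes t: "\<And>i. 0 < t $ i" and fin: "finite {z. t * z \<in> A}" "finite A" "finite (boundary_points t A)"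
  shows "\<bar>real (card {z. t * z \<in> A}) * (\<Prod>i\<in>UNIV. real_of_int (t $ i)) - real (card A)\<bar>
    \<le> real (card (boundary_points t A))"
proof -
  have eq: "real (card {v. corner t v \<in> A}) = real (card {z. t * z \<in> A}) * (\<Prod>i\<in>UNIV. real_of_int (t $ i))"
    unfolding card_corner_preimage(2)[OF t fin(1)] using t by (simp add: less_imp_le)
  have "card {v. corner t v \<in> A} \<le> card (A \<union> boundary_points t A)"
    using fin by (intro card_mono) (auto simp: boundary_points_def)
  moreover have "card A \<le> card ({v. corner t v \<in> A} \<union> boundary_points t A)"
    using fin card_corner_preimage(1)[OF t fin(1)] by (intro card_mono) (auto simp: boundary_points_def)
  ultimately show ?thesis
    using card_Un_le[of A "boundary_points t A"] card_Un_le[of "{v. corner t v \<in> A}" "boundary_points t A"]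
    unfolding eq[symmetric] by linarith
qed

section \<open>Hits of cells by a stationary mixing field\<close>

text \<open>One fixed n: \<open>X v\<close> says that v is an exceedance, K is the window in which
  mixing is available, g is the margin. Mixing is assumed only for cores, since A may be adjacent to
  the full cell. \<epsilon> bounds the expected number of exceedances in a margin; the core is
  allowed to be empty.\<close>

locale exceedance_field = prob_space M for M :: "'a measure" +
  fixes X :: "int ^ 'd \<Rightarrow> 'a \<Rightarrow> bool" and t g :: "int ^ 'd" and K :: "(int ^ 'd) set" and \<alpha> \<epsilon> :: real
  assumes t_pos: "\<And>i. 0 < t $ i"
    and X_meas [measurable]: "\<And>v. Measurable.pred M (X v)"
    and void_shift: "\<And>A h. finite A \<Longrightarrow>
      \<P>(\<omega> in M. \<forall>v\<in>A. \<not> X (v + h) \<omega>) = \<P>(\<omega> in M. \<forall>v\<in>A. \<not> X v \<omega>)"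
    and core_mixing: "\<And>A z. A \<subseteq> K \<Longrightarrow> finite A \<Longrightarrow> cell t z \<subseteq> K \<Longrightarrow> A \<inter> cell t z = {} \<Longrightarrow>
      \<bar>\<P>(\<omega> in M. \<forall>v\<in>A \<union> {t * z + g .. t * z + t - 1 - g}. \<not> X v \<omega>)
        - \<P>(\<omega> in M. \<forall>v\<in>A. \<not> X v \<omega>)
          * \<P>(\<omega> in M. \<forall>v\<in>{t * z + g .. t * z + t - 1 - g}. \<not> X v \<omega>)\<bar> \<le> \<alpha>"
    and g_nonneg: "0 \<le> g"
    and core_error: "\<And>z. real (card (cell t z - {t * z + g .. t * z + t - 1 - g})) * \<P>(\<omega> in M. X 0 \<omega>) \<le> \<epsilon>"
begin

definition void :: "(int ^ 'd) set \<Rightarrow> real" where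
  "void A = \<P>(\<omega> in M. \<forall>v\<in>A. \<not> X v \<omega>)"

definition p0 :: real where "p0 = \<P>(\<omega> in M. X 0 \<omega>)"

definition pcell :: real where "pcell = 1 - void (cell t 0)"

definition hit :: "int ^ 'd \<Rightarrow> 'a \<Rightarrow> bool" where
  "hit z \<omega> \<longleftrightarrow> (\<exists>v\<in>cell t z. X v \<omega>)"

definition core :: "int ^ 'd \<Rightarrow> (int ^ 'd) set" where
  "core z = {t * z + g .. t * z + t - 1 - g}"

section \<open>Void probabilities and decoupling of cells\<close>

lemma hit_meas [measurable]: "Measurable.pred M (hit z)"
  unfolding hit_def by (intro pred_intros_finite) simp_all

lemma void_meas: "finite A \<Longrightarrow> Measurable.pred M (\<lambda>\<omega>. \<forall>v\<in>A. \<not> X v \<omega>)"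
  by (intro pred_intros_finite) simp_all

lemma void_sets: "finite A \<Longrightarrow> {\<omega> \<in> space M. \<forall>v\<in>A. \<not> X v \<omega>} \<in> events"
  using void_meas[of A] by (simp add: pred_def)

lemma void_nonneg: "0 \<le> void A" and void_le_1: "void A \<le> 1"
  by (simp_all add: void_def)

lemma void_translate: "finite A \<Longrightarrow> void ((\<lambda>v. v + h) ` A) = void A"
  using void_shift[of A h] by (simp add: void_def)

lemma prob_X: "\<P>(\<omega> in M. X v \<omega>) = p0"
proof -
  have "\<P>(\<omega> in M. X v \<omega>) = 1 - void {v}" for v
    using prob_neg[of "X v"] X_meas[of v] by (simp add: void_def pred_def)
  moreover have "void {v} = void {0}" using void_translate[of "{0}" v] by simp
  ultimately show ?thesis by (simp add: p0_def)
qed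

lemma void_antimono: "finite B \<Longrightarrow> A \<subseteq> B \<Longrightarrow> void B \<le> void A"
  unfolding void_def
  by (intro finite_measure_mono) (auto intro!: void_sets intro: finite_subset)

lemma prob_exists_le:
  assumes "finite R"
  shows "\<P>(\<omega> in M. \<exists>v\<in>R. X v \<omega>) \<le> real (card R) * p0"
proof -
  have "\<P>(\<omega> in M. \<exists>v\<in>R. X v \<omega>) = prob (\<Union>v\<in>R. {\<omega> \<in> space M. X v \<omega>})"
    by (intro arg_cong[where f = prob]) auto
  also have "\<dots> \<le> (\<Sum>v\<in>R. \<P>(\<omega> in M. X v \<omega>))"
    using assms by (intro finite_measure_subadditive_finite) auto
  finally show ?thesis by (simp add: prob_X)
qed

lemma void_Un_ge:
  assumes "finite A" "finite R"
  shows "void A \<le> void (A \<union> R) + real (card R) * p0"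
proof -
  have m: "{\<omega> \<in> space M. \<forall>v\<in>A \<union> R. \<not> X v \<omega>} \<in> events" "{\<omega> \<in> space M. \<exists>v\<in>R. X v \<omega>} \<in> events"
    using void_sets[of "A \<union> R"] sets.Diff[OF sets.top void_sets[of R]] assms
    by (auto simp: set_diff_eq cong: conj_cong)
  have "void A \<le> prob ({\<omega> \<in> space M. \<forall>v\<in>A \<union> R. \<not> X v \<omega>} \<union> {\<omega> \<in> space M. \<exists>v\<in>R. X v \<omega>})"
    unfolding void_def using m by (intro finite_measure_mono) auto
  also have "\<dots> \<le> void (A \<union> R) + \<P>(\<omega> in M. \<exists>v\<in>R. X v \<omega>)"
    unfolding void_def using m by (intro measure_Un_le) auto
  finally show ?thesis using prob_exists_le[OF assms(2)] by linarith
qed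

lemma void_cell: "void (cell t z) = 1 - pcell"
  unfolding pcell_def by (subst cell_shift) (simp add: void_translate)

lemma pcell_nonneg: "0 \<le> pcell" and pcell_le_1: "pcell \<le> 1"
  using void_le_1[of "cell t 0"] void_nonneg[of "cell t 0"] by (simp_all add: pcell_def)

lemma prob_hit: "\<P>(\<omega> in M. hit z \<omega>) = pcell"
  using void_cell[of z] prob_neg[of "hit z"] hit_meas[of z] by (simp add: void_def hit_def pred_def)

lemma core_subset: "core z \<subseteq> cell t z"
proof
  fix v assume v: "v \<in> core z"
  show "v \<in> cell t z" unfolding cell_def
  proof (intro CollectI allI)
    fix i
    have "0 \<le> g $ i" using g_nonneg by (auto simp: less_eq_vec_def)
    moreover have "t $ i * z $ i + g $ i \<le> v $ i" "v $ i \<le> t $ i * z $ i + t $ i - 1 - g $ i"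
      using v by (auto simp: core_def less_eq_vec_def)
    ultimately show "t $ i * z $ i \<le> v $ i \<and> v $ i < t $ i * z $ i + t $ i" by linarith
  qed
qed

lemma finite_core: "finite (core z)"
  using finite_subset[OF core_subset finite_cell] .

text \<open>Removing the margin of a cell before decoupling costs \<open>\<epsilon>\<close> twice.\<close>

lemma void_insert_cell:
  assumes A: "A \<subseteq> K" "finite A" and z: "cell t z \<subseteq> K" "A \<inter> cell t z = {}"
  shows "\<bar>void (A \<union> cell t z) - void A * (1 - pcell)\<bar> \<le> \<alpha> + 2 * \<epsilon>"
proof -
  let ?R = "cell t z - core z"
  have R: "real (card ?R) * p0 \<le> \<epsilon>" using core_error[of z] by (simp add: core_def p0_def)
  have eq: "core z \<union> ?R = cell t z" "A \<union> core z \<union> ?R = A \<union> cell t z" using core_subset[of z] by auto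
  have fin: "finite ?R" "finite (core z)" "finite (A \<union> core z)" "finite (A \<union> cell t z)"
    using A finite_core by auto
  have 1: "void (core z) \<le> void (cell t z) + \<epsilon>" "void (cell t z) \<le> void (core z)"
    using void_Un_ge[OF fin(2,1)] R eq void_antimono[OF finite_cell core_subset, of z] by simp_all
  have 2: "void (A \<union> core z) \<le> void (A \<union> cell t z) + \<epsilon>" "void (A \<union> cell t z) \<le> void (A \<union> core z)"
    using void_Un_ge[OF fin(3,1)] R void_antimono[OF fin(4), of "A \<union> core z"] core_subset[of z]
    unfolding eq by auto
  have 3: "\<bar>void (A \<union> core z) - void A * void (core z)\<bar> \<le> \<alpha>"
    using core_mixing[OF A z] by (simp add: void_def core_def)
  have 4: "void A * void (cell t z) \<le> void A * void (core z)"
    using 1 void_nonneg by (intro mult_left_mono) auto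
  have "void A * (void (core z) - void (cell t z)) \<le> 1 * \<epsilon>"
    using 1 void_nonneg void_le_1 by (intro mult_mono) auto
  then have 5: "void A * void (core z) \<le> void A * void (cell t z) + \<epsilon>" by (simp add: algebra_simps)
  show ?thesis using 2 3 4 5 unfolding void_cell[of z, symmetric] abs_le_iff by linarith
qed

definition err :: real where "err = \<alpha> + 2 * \<epsilon>"

text \<open>By inclusion-exclusion the joint probability is \<open>2 * pcell - 1\<close> plus the
  void probability of both cells, and decoupling replaces the latter by (1 - pcell)^2, leaving
  \<open>pcell\<^sup>2\<close>.\<close>

lemma prob_two_hits:
  assumes "z \<noteq> z'" "cell t z \<subseteq> K" "cell t z' \<subseteq> K"
  shows "\<P>(\<omega> in M. hit z \<omega> \<and> hit z' \<omega>) \<le> pcell\<^sup>2 + err"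
proof -
  have "\<bar>void (cell t z \<union> cell t z') - (1 - pcell) * (1 - pcell)\<bar> \<le> err"
    using void_insert_cell[OF assms(2) finite_cell assms(3) cell_disjoint[OF t_pos assms(1)]]
    by (simp add: void_cell err_def)
  moreover have "\<P>(\<omega> in M. hit z \<omega> \<or> hit z' \<omega>) = 1 - void (cell t z \<union> cell t z')"
  proof -
    have "void (cell t z \<union> cell t z') = \<P>(\<omega> in M. \<not> (hit z \<omega> \<or> hit z' \<omega>))"
      unfolding void_def by (intro arg_cong[where f = prob]) (auto simp: hit_def)
    also have "\<dots> = 1 - \<P>(\<omega> in M. hit z \<omega> \<or> hit z' \<omega>)" by (rule prob_neg) simp
    finally show ?thesis by simp
  qed
  moreover have "\<P>(\<omega> in M. hit z \<omega> \<or> hit z' \<omega>) + \<P>(\<omega> in M. hit z \<omega> \<and> hit z' \<omega>) = 2 * pcell"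
  proof -
    have "\<P>(\<omega> in M. hit z \<omega>) + \<P>(\<omega> in M. hit z' \<omega>) =
      prob ({\<omega> \<in> space M. hit z \<omega>} \<union> {\<omega> \<in> space M. hit z' \<omega>}) + prob ({\<omega> \<in> space M. hit z \<omega>} \<inter> {\<omega> \<in> space M. hit z' \<omega>})"
      by (subst measure_Un3) (auto simp: fmeasurable_eq_sets)
    moreover have "{\<omega> \<in> space M. hit z \<omega>} \<union> {\<omega> \<in> space M. hit z' \<omega>} = {\<omega> \<in> space M. hit z \<omega> \<or> hit z' \<omega>}"
      "{\<omega> \<in> space M. hit z \<omega>} \<inter> {\<omega> \<in> space M. hit z' \<omega>} = {\<omega> \<in> space M. hit z \<omega> \<and> hit z' \<omega>}"
      by auto
    ultimately show ?thesis by (simp add: prob_hit)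
  qed
  ultimately show ?thesis unfolding power2_eq_square abs_le_iff by (simp add: algebra_simps)
qed

text \<open>Peeling one cell multiplies the error made so far by \<open>1 - pcell\<close>, which is
  at most 1, so the errors only add.\<close>

lemma void_cells:
  assumes "finite S" "\<And>z. z \<in> S \<Longrightarrow> cell t z \<subseteq> K"
  shows "\<bar>void (\<Union>z\<in>S. cell t z) - (1 - pcell) ^ card S\<bar> \<le> real (card S) * err"
  using assms
proof induction
  case empty
  then show ?case by (simp add: void_def prob_space)
next
  case (insert z S)
  let ?A = "\<Union>z\<in>S. cell t z"
  have dis: "?A \<inter> cell t z = {}"
    using insert.hyps by (auto simp: mem_cell_iff[OF t_pos])
  have 1: "\<bar>void (?A \<union> cell t z) - void ?A * (1 - pcell)\<bar> \<le> err"
    unfolding err_def using insert dis by (intro void_insert_cell) auto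
  have "\<bar>void ?A * (1 - pcell) - (1 - pcell) ^ card S * (1 - pcell)\<bar> = \<bar>void ?A - (1 - pcell) ^ card S\<bar> * (1 - pcell)"
    using pcell_le_1 by (simp add: left_diff_distrib[symmetric] abs_mult)
  also have "\<dots> \<le> \<bar>void ?A - (1 - pcell) ^ card S\<bar> * 1"
    using pcell_nonneg by (intro mult_left_mono) auto
  also have "\<dots> \<le> real (card S) * err" using insert by simp
  finally have 2: "\<bar>void ?A * (1 - pcell) - (1 - pcell) ^ card (insert z S)\<bar> \<le> real (card S) * err"
    using insert by (simp add: mult.commute)
  have "real (card (insert z S)) * err = err + real (card S) * err"
    using insert by (simp add: algebra_simps)
  moreover have "(\<Union>z\<in>insert z S. cell t z) = ?A \<union> cell t z" by auto
  ultimately show ?case using 1 2 by (simp only:)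
qed

text \<open>The factor \<open>1 - u\<close> thins the hits, so the left expectation averages void probabilities
  over random sets of cells.\<close>

lemma expectation_prod_hits:
  assumes "finite Z" "finite S" "S \<inter> Z = {}" "\<And>z. z \<in> S \<union> Z \<Longrightarrow> cell t z \<subseteq> K"
    and "\<And>z. z \<in> Z \<Longrightarrow> 0 \<le> u z \<and> u z \<le> 1"
  shows "\<bar>expectation (\<lambda>\<omega>. (\<Prod>z\<in>S. 1 - of_bool (hit z \<omega>)) * (\<Prod>z\<in>Z. 1 - u z * of_bool (hit z \<omega>)))
      - (1 - pcell) ^ card S * (\<Prod>z\<in>Z. 1 - u z * pcell)\<bar> \<le> real (card S + card Z) * err"
  using assms
proof (induction arbitrary: S)
  case empty
  have "expectation (\<lambda>\<omega>. (\<Prod>z\<in>S. 1 - of_bool (hit z \<omega>)) :: real) =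
    expectation (indicator {\<omega> \<in> space M. \<forall>v\<in>(\<Union>z\<in>S. cell t z). \<not> X v \<omega>})"
  proof (intro Bochner_Integration.integral_cong refl)
    fix \<omega> assume \<omega>: "\<omega> \<in> space M"
    show "(\<Prod>z\<in>S. 1 - of_bool (hit z \<omega>)) = (indicator {\<omega> \<in> space M. \<forall>v\<in>(\<Union>z\<in>S. cell t z). \<not> X v \<omega>} \<omega> :: real)"
    proof (cases "\<exists>z\<in>S. hit z \<omega>")
      case True
      then have "(\<Prod>z\<in>S. 1 - of_bool (hit z \<omega>)) = (0::real)"
        using empty by (auto intro!: prod_zero)
      then show ?thesis using True \<omega> by (auto simp: indicator_def hit_def)
    next
      case False
      then have "(\<Prod>z\<in>S. 1 - of_bool (hit z \<omega>)) = (1::real)" by (intro prod.neutral) auto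
      then show ?thesis using False \<omega> by (auto simp: indicator_def hit_def)
    qed
  qed
  also have "\<dots> = void (\<Union>z\<in>S. cell t z)"
    unfolding void_def using empty void_sets[of "\<Union>z\<in>S. cell t z"] by simp
  finally show ?case using void_cells[of S] empty by simp
next
  case (insert y Z)
  \<comment> \<open>With h the indicator of a hit in y, 1 - u h = (1 - u) + u (1 - h): with weight u
    the cell y joins S (giving G), with weight 1 - u it is dropped (giving F). Both terms fall under
    the induction hypothesis, and their errors are averaged.\<close>
  define F where "F \<omega> = (\<Prod>z\<in>S. 1 - of_bool (hit z \<omega>)) * (\<Prod>z\<in>Z. 1 - u z * of_bool (hit z \<omega>))" for \<omega>
  define G where "G \<omega> = (\<Prod>z\<in>insert y S. 1 - of_bool (hit z \<omega>)) * (\<Prod>z\<in>Z. 1 - u z * of_bool (hit z \<omega>))" for \<omega>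
  define a where "a = (1 - pcell) ^ card S * (\<Prod>z\<in>Z. 1 - u z * pcell)"
  define b where "b = (1 - pcell) ^ card (insert y S) * (\<Prod>z\<in>Z. 1 - u z * pcell)"
  have yS: "y \<notin> S" "finite S" using insert by auto
  have u: "0 \<le> u y" "u y \<le> 1" using insert by auto
  have F: "\<bar>expectation F - a\<bar> \<le> real (card S + card Z) * err"
    unfolding F_def a_def using insert by (intro insert.IH) auto
  have G: "\<bar>expectation G - b\<bar> \<le> real (card S + 1 + card Z) * err"
    unfolding G_def b_def using insert insert.IH[of "insert y S"] by auto
  have bound: "\<bar>1 - w * of_bool P\<bar> \<le> 1" if "0 \<le> w" "w \<le> 1" for w :: real and P
    using that by (cases P) auto
  have "\<bar>F \<omega>\<bar> \<le> 1" for \<omega>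
    unfolding F_def abs_mult abs_prod using bound[of 1] bound insert.prems
    by (intro mult_le_one prod_le_1 prod_nonneg) auto
  then have iF: "integrable M F"
    by (intro integrable_const_bound[where B = 1]) (auto simp: F_def[abs_def])
  have "\<bar>G \<omega>\<bar> \<le> 1" for \<omega>
    unfolding G_def abs_mult abs_prod using bound[of 1] bound insert.prems
    by (intro mult_le_one prod_le_1 prod_nonneg) auto
  then have iG: "integrable M G"
    by (intro integrable_const_bound[where B = 1]) (auto simp: G_def[abs_def])
  have "(\<lambda>\<omega>. (\<Prod>z\<in>S. 1 - of_bool (hit z \<omega>)) * (\<Prod>z\<in>insert y Z. 1 - u z * of_bool (hit z \<omega>))) =
    (\<lambda>\<omega>. (1 - u y) * F \<omega> + u y * G \<omega>)"
    using insert yS by (simp add: F_def G_def fun_eq_iff algebra_simps)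
  then have "expectation (\<lambda>\<omega>. (\<Prod>z\<in>S. 1 - of_bool (hit z \<omega>)) * (\<Prod>z\<in>insert y Z. 1 - u z * of_bool (hit z \<omega>))) =
    (1 - u y) * expectation F + u y * expectation G"
    using iF iG by simp
  moreover have "(1 - pcell) ^ card S * (\<Prod>z\<in>insert y Z. 1 - u z * pcell) = (1 - u y) * a + u y * b"
    using insert yS by (simp add: a_def b_def algebra_simps)
  moreover have "\<bar>((1 - u y) * expectation F + u y * expectation G) - ((1 - u y) * a + u y * b)\<bar>
    \<le> (1 - u y) * \<bar>expectation F - a\<bar> + u y * \<bar>expectation G - b\<bar>"
  proof -
    have "((1 - u y) * expectation F + u y * expectation G) - ((1 - u y) * a + u y * b) =
      (1 - u y) * (expectation F - a) + u y * (expectation G - b)" by (simp add: algebra_simps)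
    then show ?thesis using u abs_triangle_ineq[of "(1 - u y) * (expectation F - a)" "u y * (expectation G - b)"]
      by (simp add: abs_mult)
  qed
  moreover have "(1 - u y) * \<bar>expectation F - a\<bar> + u y * \<bar>expectation G - b\<bar> \<le>
     real (card S + card (insert y Z)) * err"
  proof -
    \<comment> \<open>The sign of \<open>err\<close> is no assumption of the locale; it follows
      because \<open>err\<close> bounds an absolute value.\<close>
    have "0 \<le> err" using order_trans[OF abs_ge_zero void_insert_cell[of "{}" y]] insert.prems
      by (simp add: err_def)
    then have F': "\<bar>expectation F - a\<bar> \<le> real (card S + card (insert y Z)) * err"
      using F insert by (simp add: algebra_simps)
    have G': "\<bar>expectation G - b\<bar> \<le> real (card S + card (insert y Z)) * err"
      using G insert by (simp add: algebra_simps)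
    show ?thesis
      using convex_bound_le[OF F' G', of "1 - u y" "u y"] u by simp
  qed
  ultimately show ?case by linarith
qed

section \<open>The hit probability of one cell\<close>

lemma pcell_le: "pcell \<le> (\<Prod>i\<in>UNIV. real_of_int (t $ i)) * p0"
proof -
  have "pcell \<le> real (card (cell t 0)) * p0"
    using prob_exists_le[OF finite_cell, of t 0] prob_hit[of 0] by (simp add: hit_def)
  also have "real (card (cell t 0)) = (\<Prod>i\<in>UNIV. real_of_int (t $ i))"
    using t_pos by (simp add: card_cell less_imp_le)
  finally show ?thesis .
qed

text \<open>Counterpart of \<open>A_set\<close> at the origin (see \<open>A_set_eq\<close>);
  \<open>p_last\<close> is then the numerator of the conditional probability in
  \<open>cond_Dl\<close>.\<close>

definition last_set :: "(int ^ 'd) rel \<Rightarrow> (int ^ 'd) set" where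
  "last_set r = {z. (\<forall>i. \<bar>z $ i\<bar> \<le> t $ i) \<and> (0, z) \<in> r \<and> z \<noteq> 0}"

definition p_last :: "(int ^ 'd) rel \<Rightarrow> real" where
  "p_last r = \<P>(\<omega> in M. X 0 \<omega> \<and> (\<forall>v\<in>last_set r. \<not> X v \<omega>))"

lemma finite_last_set: "finite (last_set r)"
  by (rule finite_subset[OF _ finite_vec_box(1)[of "\<lambda>i. {- t $ i .. t $ i}"]])
    (auto simp: last_set_def abs_le_iff minus_le_iff)

text \<open>The event is a difference of two nested void events, so it inherits the shift invariance
  that the locale assumes for void probabilities.\<close>

lemma prob_X_void_shift:
  assumes "finite A"
  shows "\<P>(\<omega> in M. X h \<omega> \<and> (\<forall>v\<in>A. \<not> X (v + h) \<omega>)) = \<P>(\<omega> in M. X 0 \<omega> \<and> (\<forall>v\<in>A. \<not> X v \<omega>))"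
proof -
  have *: "\<P>(\<omega> in M. X h \<omega> \<and> (\<forall>v\<in>A. \<not> X (v + h) \<omega>)) = void ((\<lambda>v. v + h) ` A) - void ((\<lambda>v. v + h) ` insert 0 A)" for h
  proof -
    have "{\<omega> \<in> space M. X h \<omega> \<and> (\<forall>v\<in>A. \<not> X (v + h) \<omega>)} =
      {\<omega> \<in> space M. \<forall>v\<in>(\<lambda>v. v + h) ` A. \<not> X v \<omega>} - {\<omega> \<in> space M. \<forall>v\<in>(\<lambda>v. v + h) ` insert 0 A. \<not> X v \<omega>}"
      by auto
    then show ?thesis unfolding void_def using assms
      by (simp only:, subst finite_measure_Diff) (auto intro!: void_sets)
  qed
  show ?thesis using *[of h] *[of 0] void_translate[of A h] void_translate[of "insert 0 A" h] assms by simp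
qed

text \<open>The cell is hit iff it contains an exceedance that is last in the order \<open>r\<close>.  If this one
  is not last in the larger neighbourhood \<open>last_set\<close>, then an adjacent cell is hit as well.\<close>

lemma pcell_bounds:
  assumes r: "linear_order r" "translation_invariant r"
    and K: "\<And>z. (\<forall>i. \<bar>z $ i\<bar> \<le> 1) \<Longrightarrow> cell t z \<subseteq> K"
  shows "(\<Prod>i\<in>UNIV. real_of_int (t $ i)) * p_last r \<le> pcell"
    and "pcell \<le> (\<Prod>i\<in>UNIV. real_of_int (t $ i)) * p_last r + 3 ^ CARD('d) * (pcell\<^sup>2 + err)"
proof -
  have r_total: "(u, v) \<in> r \<or> (v, u) \<in> r" if "u \<noteq> v" for u v
    using r(1) that by (auto simp: linear_order_on_def total_on_def)
  have r_trans: "(u, w) \<in> r" if "(u, v) \<in> r" "(v, w) \<in> r" for u v w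
    using r(1) that by (auto simp: linear_order_on_def partial_order_on_def preorder_on_def trans_def)
  have r_antisym: "u = v" if "(u, v) \<in> r" "(v, u) \<in> r" for u v
    using r(1) that by (auto simp: linear_order_on_def partial_order_on_def antisym_def)
  have r_shift: "(u, v) \<in> r \<longleftrightarrow> (u + w, v + w) \<in> r" for u v w
    using r(2) unfolding translation_invariant_def by (metis add_diff_cancel_right' diff_conv_add_uminus)
  \<comment> \<open>\<open>E v\<close>: v is the last exceedance in its cell. \<open>G v\<close>: v
    is last in the translate of \<open>last_set\<close>. The events \<open>E v\<close> partition the
    hit event, while every \<open>G v\<close> has the same probability
    \<open>p_last r\<close>.\<close>
  define E where "E v = {\<omega> \<in> space M. X v \<omega> \<and> (\<forall>w\<in>{w\<in>cell t 0. (v, w) \<in> r \<and> v \<noteq> w}. \<not> X w \<omega>)}" for v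
  define G where "G v = {\<omega> \<in> space M. X v \<omega> \<and> (\<forall>w\<in>last_set r. \<not> X (w + v) \<omega>)}" for v
  have Em: "E v \<in> events" for v
  proof -
    have "E v = {\<omega> \<in> space M. X v \<omega>} \<inter> {\<omega> \<in> space M. \<forall>w\<in>{w\<in>cell t 0. (v, w) \<in> r \<and> v \<noteq> w}. \<not> X w \<omega>}"
      by (auto simp: E_def)
    then show ?thesis using void_sets[of "{w\<in>cell t 0. (v, w) \<in> r \<and> v \<noteq> w}"] by simp
  qed
  have Gm: "G v \<in> events" for v
  proof -
    have "G v = {\<omega> \<in> space M. X v \<omega>} \<inter> {\<omega> \<in> space M. \<forall>w\<in>(\<lambda>w. w + v) ` last_set r. \<not> X w \<omega>}"
      by (auto simp: G_def[abs_def])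
    then show ?thesis using void_sets[of "(\<lambda>w. w + v) ` last_set r"] finite_last_set by simp
  qed
  have GE: "G v \<subseteq> E v" if v: "v \<in> cell t 0" for v
  proof
    fix \<omega> assume \<omega>: "\<omega> \<in> G v"
    have "\<not> X w \<omega>" if w: "w \<in> cell t 0" "(v, w) \<in> r" "v \<noteq> w" for w
    proof -
      have "\<bar>(w - v) $ i\<bar> \<le> t $ i" for i
        using v w(1) unfolding cell_def by (simp add: abs_le_iff) (smt (verit))
      moreover have "(0, w - v) \<in> r" using r_shift[of 0 "w - v" v] w by simp
      ultimately have "w - v \<in> last_set r" using w by (simp add: last_set_def)
      then have "\<not> X (w - v + v) \<omega>" using \<omega> unfolding G_def by blast
      then show ?thesis by simp
    qed
    then show "\<omega> \<in> E v" using \<omega> by (auto simp: E_def G_def)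
  qed
  have dis: "disjoint_family_on E (cell t 0)"
    unfolding disjoint_family_on_def E_def using r_total by blast
  have hit: "{\<omega> \<in> space M. hit 0 \<omega>} = (\<Union>v\<in>cell t 0. E v)"
  proof (intro set_eqI iffI)
    fix \<omega> assume "\<omega> \<in> {\<omega> \<in> space M. hit 0 \<omega>}"
    then have \<omega>: "\<omega> \<in> space M" "{v \<in> cell t 0. X v \<omega>} \<noteq> {}" by (auto simp: hit_def)
    \<comment> \<open>A finite nonempty set has an \<open>r\<close>-maximal element: a new element
      replaces the old maximum when it lies above it.\<close>
    have "\<exists>m\<in>S. \<forall>w\<in>S. (m, w) \<in> r \<longrightarrow> m = w" if "finite S" "S \<noteq> {}" for S
      using that
    proof (induction rule: finite_ne_induct)
      case (insert a S)
      then obtain m where m: "m \<in> S" "\<forall>w\<in>S. (m, w) \<in> r \<longrightarrow> m = w" by auto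
      show ?case
      proof (cases "(m, a) \<in> r")
        case True
        then show ?thesis using m r_trans r_antisym by (intro bexI[of _ a]) blast+
      qed (use m in blast)
    qed simp
    from this[OF _ \<omega>(2)] show "\<omega> \<in> (\<Union>v\<in>cell t 0. E v)" using \<omega>(1) by (auto simp: E_def)
  qed (auto simp: E_def hit_def)
  have pE: "pcell = (\<Sum>v\<in>cell t 0. prob (E v))"
    using prob_hit[of 0] Em dis unfolding hit by (subst (asm) finite_measure_finite_Union) auto
  have "prob (G v) = p_last r" for v
    using prob_X_void_shift[OF finite_last_set, of v r] by (simp add: G_def p_last_def)
  then have pG: "(\<Sum>v\<in>cell t 0. prob (G v)) = (\<Prod>i\<in>UNIV. real_of_int (t $ i)) * p_last r"
    using t_pos by (simp add: card_cell less_imp_le)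
  show "(\<Prod>i\<in>UNIV. real_of_int (t $ i)) * p_last r \<le> pcell"
    unfolding pE pG[symmetric] using GE Em by (intro sum_mono finite_measure_mono) auto
  \<comment> \<open>A later exceedance outside the cell is at most \<open>t $ i\<close> away in each
    coordinate, so its cell index has entries in {-1, 0, 1}; this is the source of the factor
    3^d.\<close>
  define Nb :: "(int ^ 'd) set" where "Nb = {z. \<forall>i. z $ i \<in> {-1..1}}"
  have Nb: "finite Nb" "card Nb = 3 ^ CARD('d)"
    unfolding Nb_def by (subst finite_vec_box | simp)+
  have "pcell - (\<Prod>i\<in>UNIV. real_of_int (t $ i)) * p_last r = (\<Sum>v\<in>cell t 0. prob (E v - G v))"
    unfolding pE pG[symmetric] sum_subtractf[symmetric] using GE Em Gm
    by (intro sum.cong refl finite_measure_Diff[symmetric]) auto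
  also have "\<dots> = prob (\<Union>v\<in>cell t 0. E v - G v)"
    using dis Em Gm by (intro finite_measure_finite_Union[symmetric]) (auto simp: disjoint_family_on_def)
  also have "\<dots> \<le> prob (\<Union>z\<in>Nb - {0}. {\<omega> \<in> space M. hit 0 \<omega> \<and> hit z \<omega>})"
  proof (intro finite_measure_mono subsetI)
    fix \<omega> assume "\<omega> \<in> (\<Union>v\<in>cell t 0. E v - G v)"
    then obtain v w where v: "v \<in> cell t 0" "\<omega> \<in> E v" and w: "w \<in> last_set r" "X (w + v) \<omega>"
      by (auto simp: E_def G_def)
    define z where "z = cell_index t (w + v)"
    have z: "w + v \<in> cell t z" using mem_cell_iff[OF t_pos] by (simp add: z_def)
    have wr: "(v, w + v) \<in> r" "v \<noteq> w + v" using w r_shift[of 0 w v] by (auto simp: last_set_def)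
    have "w + v \<notin> cell t 0" using v(2) w(2) wr by (auto simp: E_def)
    then have "z \<noteq> 0" using z by auto
    moreover have "z \<in> Nb" unfolding Nb_def
    proof (intro CollectI allI)
      fix i
      have "\<bar>w $ i\<bar> \<le> t $ i" "0 \<le> v $ i" "v $ i < t $ i"
        using w(1) v(1) by (auto simp: last_set_def cell_def)
      then have "t $ i * (-1) \<le> (w + v) $ i" "(w + v) $ i < t $ i * 2" by auto
      moreover have "t $ i * z $ i \<le> (w + v) $ i" "(w + v) $ i < t $ i * (z $ i + 1)"
        using z by (auto simp: cell_def algebra_simps)
      ultimately have "t $ i * (-1) < t $ i * (z $ i + 1)" "t $ i * z $ i < t $ i * 2" by linarith+
      then have "-1 < z $ i + 1" "z $ i < 2" using t_pos[of i] by (simp_all only: mult_less_cancel_left_pos)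
      then show "z $ i \<in> {-1..1}" by auto
    qed
    moreover have "hit 0 \<omega>" "hit z \<omega>" "\<omega> \<in> space M" using v w z by (auto simp: hit_def E_def)
    ultimately show "\<omega> \<in> (\<Union>z\<in>Nb - {0}. {\<omega> \<in> space M. hit 0 \<omega> \<and> hit z \<omega>})" by auto
  qed (use Nb in auto)
  also have "\<dots> \<le> (\<Sum>z\<in>Nb - {0}. \<P>(\<omega> in M. hit 0 \<omega> \<and> hit z \<omega>))"
    using Nb by (intro finite_measure_subadditive_finite) auto
  also have "\<dots> \<le> (\<Sum>z\<in>Nb - {0}. pcell\<^sup>2 + err)"
    using K by (intro sum_mono prob_two_hits) (auto simp: Nb_def abs_le_iff)
  also have "\<dots> \<le> (\<Sum>z\<in>Nb. pcell\<^sup>2 + err)"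
  proof (rule sum_mono2)
    have "0 \<le> err"
      using order_trans[OF abs_ge_zero void_insert_cell[of "{}" 0]] K[of 0] by (simp add: err_def)
    then show "0 \<le> pcell\<^sup>2 + err" by simp
  qed (use Nb in auto)
  finally show "pcell \<le> (\<Prod>i\<in>UNIV. real_of_int (t $ i)) * p_last r + 3 ^ CARD('d) * (pcell\<^sup>2 + err)"
    using Nb by simp
qed

end

section \<open>Convergence of generating functions\<close>

definition exp_vec :: "('g \<Rightarrow> nat) \<Rightarrow> real ^ 'g" where
  "exp_vec l = (\<chi> i. exp (- real (l i)))"

lemma exp_vec_cube: "exp_vec l \<in> cbox 0 1"
  by (auto simp: exp_vec_def mem_box_cart)

lemma measurable_vec_lambda:
  fixes f :: "'a \<Rightarrow> 'b::finite \<Rightarrow> real"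
  assumes "\<And>i. (\<lambda>\<omega>. f \<omega> i) \<in> borel_measurable M"
  shows "(\<lambda>\<omega>. \<chi> i. f \<omega> i) \<in> borel_measurable M"
proof (rule borel_measurable_euclidean_space[THEN iffD2], intro ballI)
  fix b :: "real ^ 'b" assume "b \<in> Basis"
  then obtain i where "b = axis i 1" by (auto simp: Basis_vec_def)
  then show "(\<lambda>\<omega>. (\<chi> i. f \<omega> i) \<bullet> b) \<in> borel_measurable M"
    using assms[of i] by (simp add: inner_axis)
qed

text \<open>The values of the generating functions at \<open>(exp (- e\<^sub>i))\<^sub>i\<close> are the moments of \<open>exp (- X)\<close>,
  which lives in the unit cube, so Stone-Weierstrass applies; the cutoff \<open>\<kappa>\<close> supplies tightness.\<close>

lemma converges_in_distribution_pgf: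
  fixes X :: "nat \<Rightarrow> 'g::finite \<Rightarrow> 'a \<Rightarrow> nat" and Y :: "'g \<Rightarrow> 'b \<Rightarrow> nat"
  assumes M: "prob_space M" and N: "prob_space N"
    and X: "\<And>n i. (\<lambda>\<omega>. real (X n i \<omega>)) \<in> borel_measurable M"
    and Y: "\<And>i. (\<lambda>\<omega>. real (Y i \<omega>)) \<in> borel_measurable N"
    and pgf: "\<And>s :: 'g \<Rightarrow> real. (\<And>i. 0 \<le> s i \<and> s i \<le> 1) \<Longrightarrow>
      (\<lambda>n. \<integral>\<omega>. (\<Prod>i\<in>UNIV. s i ^ X n i \<omega>) \<partial>M) \<longlonglongrightarrow> (\<integral>\<omega>. (\<Prod>i\<in>UNIV. s i ^ Y i \<omega>) \<partial>N)"
  shows "converges_in_distribution M (\<lambda>n \<omega>. (\<chi> i. real (X n i \<omega>)) :: real ^ 'g) N (\<lambda>\<omega>. \<chi> i. real (Y i \<omega>))"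
proof -
  interpret M: prob_space M by fact
  interpret N: prob_space N by fact
  define W where "W n \<omega> = exp_vec (\<lambda>i. X n i \<omega>)" for n \<omega>
  define V where "V \<omega> = exp_vec (\<lambda>i. Y i \<omega>)" for \<omega>
  have Wm [measurable]: "W n \<in> borel_measurable M" for n
    unfolding W_def exp_vec_def
    by (intro measurable_vec_lambda measurable_compose[OF X, of "\<lambda>x. exp (- x)" borel]) simp
  have Vm [measurable]: "V \<in> borel_measurable N"
    unfolding V_def exp_vec_def
    by (intro measurable_vec_lambda measurable_compose[OF Y, of "\<lambda>x. exp (- x)" borel]) simp
  have cube: "W n \<omega> \<in> cbox 0 1" "V \<omega>' \<in> cbox 0 1" for n \<omega> \<omega>'
    by (simp_all add: W_def V_def exp_vec_cube)
  have bounded_h: "\<exists>B. \<forall>x\<in>cbox 0 1. \<bar>h x\<bar> \<le> B" if "continuous_on UNIV h" for h :: "real ^ 'g \<Rightarrow> real"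
    using compact_imp_bounded[OF compact_continuous_image[OF continuous_on_subset[OF that subset_UNIV] compact_cbox, of 0 1]]
    by (auto simp: bounded_iff)
  have int: "integrable M (\<lambda>\<omega>. h (W n \<omega>))" "integrable N (\<lambda>\<omega>. h (V \<omega>))"
    if h: "continuous_on UNIV h" for h :: "real ^ 'g \<Rightarrow> real" and n
  proof -
    obtain B where B: "\<forall>x\<in>cbox 0 1. \<bar>h x\<bar> \<le> B" using bounded_h[OF h] by auto
    have [measurable]: "h \<in> borel_measurable borel" using h by (rule borel_measurable_continuous_onI)
    show "integrable M (\<lambda>\<omega>. h (W n \<omega>))"
      using B cube by (intro M.integrable_const_bound[where B = B]) auto
    show "integrable N (\<lambda>\<omega>. h (V \<omega>))"
      using B cube by (intro N.integrable_const_bound[where B = B]) auto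
  qed
  define conv where "conv h \<longleftrightarrow> (\<lambda>n. \<integral>\<omega>. h (W n \<omega>) \<partial>M) \<longlonglongrightarrow> (\<integral>\<omega>. h (V \<omega>) \<partial>N)"
    for h :: "real ^ 'g \<Rightarrow> real"
  define mono :: "('g \<Rightarrow> nat) \<Rightarrow> real ^ 'g \<Rightarrow> real" where "mono e x = (\<Prod>i\<in>UNIV. x $ i ^ e i)" for e x
  \<comment> \<open>Convergence is required for all monomial multiples of h, since only this
    stronger property is preserved by multiplication with a linear function; the induction over
    polynomials needs that.\<close>
  define good where "good h \<longleftrightarrow> continuous_on UNIV h \<and> (\<forall>e. conv (\<lambda>x. h x * mono e x))" for h
  have mono_cont: "continuous_on UNIV (mono e)" for e
    unfolding mono_def by (intro continuous_intros)
  have good1: "good (\<lambda>x. 1)"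
  proof -
    have "conv (mono e)" for e
    proof -
      have "(\<Prod>i\<in>UNIV. exp (- real (l i)) ^ e i) = (\<Prod>i\<in>UNIV. exp (- real (e i)) ^ l i)" for l :: "'g \<Rightarrow> nat"
        by (simp add: exp_of_nat_mult[symmetric] mult.commute)
      then show ?thesis
        using pgf[of "\<lambda>i. exp (- real (e i))"] by (simp add: conv_def mono_def W_def V_def exp_vec_def)
    qed
    then show ?thesis by (simp add: good_def)
  qed
  have conv_add: "conv (\<lambda>x. f x + h x)" if "conv f" "conv h" "continuous_on UNIV f" "continuous_on UNIV h" for f h
    using that tendsto_add[of "\<lambda>n. \<integral>\<omega>. f (W n \<omega>) \<partial>M" _ _ "\<lambda>n. \<integral>\<omega>. h (W n \<omega>) \<partial>M"] int[of f] int[of h]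
    by (simp add: conv_def)
  have conv_cmult: "conv (\<lambda>x. a * f x)" if "conv f" for f a
    using that tendsto_mult_left[of "\<lambda>n. \<integral>\<omega>. f (W n \<omega>) \<partial>M"] by (simp add: conv_def)
  have conv_sum: "conv (\<lambda>x. \<Sum>i\<in>I. f i x)" if "finite I" "\<And>i. conv (f i)" "\<And>i. continuous_on UNIV (f i)"
    for I :: "'g set" and f
    using that(1)
  proof induction
    case empty
    show ?case by (simp add: conv_def)
  next
    case (insert i I)
    then show ?case using that by (simp add: conv_add continuous_on_sum)
  qed
  have poly: "\<forall>h. good h \<longrightarrow> good (\<lambda>x. f x * h x)" if "real_polynomial_function f" for f
    using that
  proof induction
    case (linear f)
    have f: "f x = (\<Sum>i\<in>UNIV. f (axis i 1) * x $ i)" for x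
    proof -
      interpret bounded_linear f by fact
      have "f x = f (\<Sum>i\<in>UNIV. x $ i *\<^sub>R axis i 1)"
        by (intro arg_cong[where f = f]) (simp add: vec_eq_iff axis_def if_distrib sum.delta' cong: if_cong)
      then show ?thesis by (simp add: sum scaleR mult.commute)
    qed
    show ?case
    proof (intro allI impI)
      fix h assume h: "good h"
      have "conv (\<lambda>x. f x * h x * mono e x)" for e
      proof -
        have step: "x $ i * mono e x = mono (e(i := Suc (e i))) x" for i x
        proof -
          have "mono e x = x $ i ^ e i * (\<Prod>j\<in>UNIV - {i}. x $ j ^ e j)" for e
            unfolding mono_def by (rule prod.remove) auto
          note this[of e] this[of "e(i := Suc (e i))"]
          moreover have "(\<Prod>j\<in>UNIV - {i}. x $ j ^ (e(i := Suc (e i))) j) = (\<Prod>j\<in>UNIV - {i}. x $ j ^ e j)"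
            by (intro prod.cong) auto
          ultimately show ?thesis by simp
        qed
        have "f x * h x * mono e x = (\<Sum>i\<in>UNIV. f (axis i 1) * (h x * mono (e(i := Suc (e i))) x))" for x
          by (subst f) (simp add: sum_distrib_left sum_distrib_right step[symmetric] ac_simps)
        moreover have "conv (\<lambda>x. \<Sum>i\<in>UNIV. f (axis i 1) * (h x * mono (e(i := Suc (e i))) x))"
          using h mono_cont by (intro conv_sum conv_cmult) (auto simp: good_def intro!: continuous_intros)
        ultimately show ?thesis by simp
      qed
      then show "good (\<lambda>x. f x * h x)"
        using h linear_continuous_on[OF linear, of UNIV]
        by (auto simp: good_def intro!: continuous_on_mult)
    qed
  next
    case (const c)
    then show ?case
      using conv_cmult by (auto simp: good_def mult.assoc intro!: continuous_intros)
  next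
    case (add f1 f2)
    then show ?case
    proof (intro allI impI)
      fix h assume "good h"
      then have "good (\<lambda>x. f1 x * h x)" "good (\<lambda>x. f2 x * h x)" using add by auto
      then show "good (\<lambda>x. (f1 x + f2 x) * h x)"
        using mono_cont by (auto simp: good_def distrib_right intro!: conv_add continuous_on_add continuous_on_mult)
    qed
  next
    case (mult f1 f2)
    then show ?case by (auto simp: mult.assoc)
  qed
  have conv_poly: "conv f" if "real_polynomial_function f" for f
  proof -
    have "good (\<lambda>x. f x * 1)" using poly[OF that] good1 by blast
    then have "conv (\<lambda>x. f x * mono (\<lambda>_. 0) x)" by (simp add: good_def)
    then show ?thesis by (simp add: mono_def)
  qed
  have conv_cont: "conv h" if h: "continuous_on UNIV h" for h
    unfolding conv_def
  proof (rule LIMSEQ_I)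
    fix e :: real assume e: "0 < e"
    obtain f where f: "real_polynomial_function f" "\<And>x. x \<in> cbox 0 1 \<Longrightarrow> \<bar>h x - f x\<bar> < e / 3"
      using Stone_Weierstrass_real_polynomial_function[OF compact_cbox continuous_on_subset[OF h subset_UNIV], of "e / 3" 0 1] e
      by auto
    have fc: "continuous_on UNIV f"
      using f(1) by (simp add: continuous_on_polymonial_function real_polynomial_function_eq)
    have dM: "\<bar>(\<integral>\<omega>. h (W n \<omega>) \<partial>M) - (\<integral>\<omega>. f (W n \<omega>) \<partial>M)\<bar> \<le> e / 3" for n
    proof -
      have "\<bar>\<integral>\<omega>. h (W n \<omega>) - f (W n \<omega>) \<partial>M\<bar> \<le> (\<integral>\<omega>. \<bar>h (W n \<omega>) - f (W n \<omega>)\<bar> \<partial>M)"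
        by (rule integral_abs_bound)
      also have "\<dots> \<le> (\<integral>\<omega>. e / 3 \<partial>M)"
        using f(2)[OF cube(1)] integrable_abs[OF Bochner_Integration.integrable_diff[OF int(1)[OF h] int(1)[OF fc]]]
        by (intro integral_mono) (auto intro: less_imp_le)
      finally show ?thesis using int[OF h] int[OF fc] by (simp add: M.prob_space)
    qed
    have dN: "\<bar>(\<integral>\<omega>. h (V \<omega>) \<partial>N) - (\<integral>\<omega>. f (V \<omega>) \<partial>N)\<bar> \<le> e / 3"
    proof -
      have "\<bar>\<integral>\<omega>. h (V \<omega>) - f (V \<omega>) \<partial>N\<bar> \<le> (\<integral>\<omega>. \<bar>h (V \<omega>) - f (V \<omega>)\<bar> \<partial>N)"
        by (rule integral_abs_bound)
      also have "\<dots> \<le> (\<integral>\<omega>. e / 3 \<partial>N)"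
        using f(2)[OF cube(2)] integrable_abs[OF Bochner_Integration.integrable_diff[OF int(2)[OF h] int(2)[OF fc]]]
        by (intro integral_mono) (auto intro: less_imp_le)
      finally show ?thesis using int[OF h] int[OF fc] by (simp add: N.prob_space)
    qed
    obtain n0 where n0: "\<And>n. n \<ge> n0 \<Longrightarrow> \<bar>(\<integral>\<omega>. f (W n \<omega>) \<partial>M) - (\<integral>\<omega>. f (V \<omega>) \<partial>N)\<bar> < e / 3"
      using LIMSEQ_D[OF conv_poly[OF f(1), unfolded conv_def], of "e / 3"] e by auto
    have "\<bar>(\<integral>\<omega>. h (W n \<omega>) \<partial>M) - (\<integral>\<omega>. h (V \<omega>) \<partial>N)\<bar> < e" if "n \<ge> n0" for n
      using dM[of n] dN n0[OF that] by linarith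
    then show "\<exists>n0. \<forall>n\<ge>n0. norm ((\<integral>\<omega>. h (W n \<omega>) \<partial>M) - (\<integral>\<omega>. h (V \<omega>) \<partial>N)) < e"
      by auto
  qed
  \<comment> \<open>The summand is 1 for x_i at most exp(-m) and 0 for x_i at least 2 exp(-m). At
    \<open>exp_vec l\<close> it is thus a continuous majorant of the indicator that
    \<open>l i\<close> exceeds m.\<close>
  define \<kappa> :: "nat \<Rightarrow> real ^ 'g \<Rightarrow> real" where
    "\<kappa> m x = (\<Sum>i\<in>UNIV. max 0 (min 1 (2 - exp (real m) * x $ i)))" for m x
  have \<kappa>_cont: "continuous_on UNIV (\<kappa> m)" for m
    unfolding \<kappa>_def by (intro continuous_intros)
  have \<kappa>_nonneg: "0 \<le> \<kappa> m x" for m x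
    unfolding \<kappa>_def by (intro sum_nonneg) auto
  have \<kappa>_big: "1 \<le> \<kappa> m (exp_vec l)" if "m < l i" for m l and i :: 'g
  proof -
    have "exp (real m) * exp (- real (l i)) \<le> 1" using that by (simp add: exp_add[symmetric])
    then have "1 \<le> max 0 (min 1 (2 - exp (real m) * exp_vec l $ i))" by (simp add: exp_vec_def)
    also have "\<dots> \<le> \<kappa> m (exp_vec l)"
      unfolding \<kappa>_def by (rule member_le_sum) auto
    finally show ?thesis .
  qed
  have \<kappa>_le: "\<kappa> m x \<le> CARD('g)" for m x
    unfolding \<kappa>_def using sum_bounded_above[of UNIV "\<lambda>i. max 0 (min 1 (2 - exp (real m) * x $ i))" 1] by simp
  have \<kappa>_lim: "(\<lambda>m. \<integral>\<omega>. \<kappa> m (V \<omega>) \<partial>N) \<longlonglongrightarrow> 0"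
  proof -
    have "(\<lambda>m. \<kappa> m (V \<omega>)) \<longlonglongrightarrow> 0" for \<omega>
    proof (rule tendsto_eventually, rule eventually_mono)
      show "\<forall>\<^sub>F m in sequentially. (\<Sum>i\<in>UNIV. Y i \<omega>) + 1 \<le> m" by (rule eventually_ge_at_top)
      fix m assume m: "(\<Sum>i\<in>UNIV. Y i \<omega>) + 1 \<le> m"
      have "max 0 (min 1 (2 - exp (real m) * V \<omega> $ i)) = 0" for i
      proof -
        have "Y i \<omega> \<le> (\<Sum>i\<in>UNIV. Y i \<omega>)" by (rule member_le_sum) auto
        then have "1 \<le> real m - real (Y i \<omega>)" using m by simp
        then have "2 \<le> exp (real m - real (Y i \<omega>))"
          using exp_ge_add_one_self[of "real m - real (Y i \<omega>)"] by linarith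
        also have "\<dots> = exp (real m) * V \<omega> $ i" by (simp add: V_def exp_vec_def exp_diff exp_minus field_simps)
        finally show ?thesis by simp
      qed
      then show "\<kappa> m (V \<omega>) = 0" by (simp add: \<kappa>_def)
    qed
    then have "(\<lambda>m. \<integral>\<omega>. \<kappa> m (V \<omega>) \<partial>N) \<longlonglongrightarrow> (\<integral>\<omega>. 0 \<partial>N)"
      using \<kappa>_le \<kappa>_nonneg int(2)[OF \<kappa>_cont]
      by (intro integral_dominated_convergence[where w = "\<lambda>_. real CARD('g)"]) (auto simp: borel_measurable_integrable)
    then show ?thesis by simp
  qed
  have main: "(\<lambda>n. \<integral>\<omega>. f (\<chi> i. real (X n i \<omega>)) \<partial>M) \<longlonglongrightarrow> (\<integral>\<omega>. f (\<chi> i. real (Y i \<omega>)) \<partial>N)"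
    if f: "continuous_on UNIV f" "bounded (range f)" for f :: "real ^ 'g \<Rightarrow> real"
  proof (rule LIMSEQ_I)
    fix e :: real assume e: "0 < e"
    obtain B where B: "0 < B" "\<And>x. \<bar>f x\<bar> \<le> B" using f(2) by (auto simp: bounded_pos)
    \<comment> \<open>2 B times e / (8 B) is e / 4. The replacement of f by F on either side and the
      convergence for F cost less than e / 4 each.\<close>
    obtain m where m: "(\<integral>\<omega>. \<kappa> m (V \<omega>) \<partial>N) < e / (8 * B)"
      using order_tendstoD(2)[OF \<kappa>_lim, of "e / (8 * B)"] e B(1)
      by (auto simp: eventually_sequentially)
    \<comment> \<open>f written in the variable exp(-l). Truncating at exp(-m) makes it continuous
      on the whole space and changes nothing unless some count exceeds m; then the error is at most
      2 B, which \<kappa> pays for.\<close>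
    define F :: "real ^ 'g \<Rightarrow> real" where "F x = f (\<chi> i. - ln (max (x $ i) (exp (- real m))))" for x
    have Fc: "continuous_on UNIV F"
    proof -
      have "continuous_on UNIV (\<lambda>x :: real ^ 'g. (\<chi> i. - ln (max (x $ i) (exp (- real m)))) :: real ^ 'g)"
        by (intro continuous_intros ballI) (auto simp: max_def less_le_trans[OF exp_gt_zero])
      from continuous_on_compose2[OF f(1) this] show ?thesis by (simp add: F_def)
    qed
    have fF: "\<bar>f (\<chi> i. real (l i)) - F (exp_vec l)\<bar> \<le> 2 * B * \<kappa> m (exp_vec l)" for l
    proof (cases "\<exists>i. m < l i")
      case True
      then have "1 \<le> \<kappa> m (exp_vec l)" using \<kappa>_big by auto
      then have "2 * B * 1 \<le> 2 * B * \<kappa> m (exp_vec l)" using B(1) by (intro mult_left_mono) auto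
      moreover have "\<bar>f (\<chi> i. real (l i)) - F (exp_vec l)\<bar> \<le> B + B"
        using B(2)[of "\<chi> i. real (l i)"] B(2)[of "\<chi> i. - ln (max (exp_vec l $ i) (exp (- real m)))"] unfolding F_def by linarith
      ultimately show ?thesis by linarith
    next
      case False
      then have "max (exp_vec l $ i) (exp (- real m)) = exp (- real (l i))" for i
        by (intro max_absorb1[THEN trans]) (auto simp: exp_vec_def not_less)
      then have "F (exp_vec l) = f (\<chi> i. real (l i))" by (simp add: F_def)
      then show ?thesis using B(1) \<kappa>_nonneg by simp
    qed
    have fb: "f \<in> borel_measurable borel" using f(1) by (rule borel_measurable_continuous_onI)
    have Xm: "(\<lambda>\<omega>. \<chi> i. real (X n i \<omega>)) \<in> borel_measurable M" for n
      using X by (rule measurable_vec_lambda)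
    have Ym: "(\<lambda>\<omega>. \<chi> i. real (Y i \<omega>)) \<in> borel_measurable N"
      using Y by (rule measurable_vec_lambda)
    have fi: "integrable M (\<lambda>\<omega>. f (\<chi> i. real (X n i \<omega>)))" "integrable N (\<lambda>\<omega>. f (\<chi> i. real (Y i \<omega>)))" for n
      using B(2) measurable_compose[OF Xm fb] measurable_compose[OF Ym fb]
      by (auto intro!: M.integrable_const_bound[where B = B] N.integrable_const_bound[where B = B])
    have dM: "\<bar>(\<integral>\<omega>. f (\<chi> i. real (X n i \<omega>)) \<partial>M) - (\<integral>\<omega>. F (W n \<omega>) \<partial>M)\<bar> \<le> 2 * B * (\<integral>\<omega>. \<kappa> m (W n \<omega>) \<partial>M)" for n
    proof -
      have "\<bar>\<integral>\<omega>. f (\<chi> i. real (X n i \<omega>)) - F (W n \<omega>) \<partial>M\<bar> \<le> (\<integral>\<omega>. \<bar>f (\<chi> i. real (X n i \<omega>)) - F (W n \<omega>)\<bar> \<partial>M)"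
        by (rule integral_abs_bound)
      also have "\<dots> \<le> (\<integral>\<omega>. 2 * B * \<kappa> m (W n \<omega>) \<partial>M)"
        using fF integrable_abs[OF Bochner_Integration.integrable_diff[OF fi(1) int(1)[OF Fc]]]
          integrable_mult_right[OF int(1)[OF \<kappa>_cont]]
        by (intro integral_mono) (auto simp: W_def)
      finally show ?thesis using fi int(1)[OF Fc] by simp
    qed
    have dN: "\<bar>(\<integral>\<omega>. f (\<chi> i. real (Y i \<omega>)) \<partial>N) - (\<integral>\<omega>. F (V \<omega>) \<partial>N)\<bar> \<le> 2 * B * (\<integral>\<omega>. \<kappa> m (V \<omega>) \<partial>N)"
    proof -
      have "\<bar>\<integral>\<omega>. f (\<chi> i. real (Y i \<omega>)) - F (V \<omega>) \<partial>N\<bar> \<le> (\<integral>\<omega>. \<bar>f (\<chi> i. real (Y i \<omega>)) - F (V \<omega>)\<bar> \<partial>N)"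
        by (rule integral_abs_bound)
      also have "\<dots> \<le> (\<integral>\<omega>. 2 * B * \<kappa> m (V \<omega>) \<partial>N)"
        using fF integrable_abs[OF Bochner_Integration.integrable_diff[OF fi(2) int(2)[OF Fc]]]
          integrable_mult_right[OF int(2)[OF \<kappa>_cont]]
        by (intro integral_mono) (auto simp: V_def)
      finally show ?thesis using fi int(2)[OF Fc] by simp
    qed
    have d: "0 < e / (8 * B)" "0 < e / 4" using e B(1) by auto
    obtain n1 where n1: "\<And>n. n \<ge> n1 \<Longrightarrow> \<bar>(\<integral>\<omega>. F (W n \<omega>) \<partial>M) - (\<integral>\<omega>. F (V \<omega>) \<partial>N)\<bar> < e / 4"
      using LIMSEQ_D[OF conv_cont[OF Fc, unfolded conv_def] d(2)] by auto
    have "eventually (\<lambda>n. (\<integral>\<omega>. \<kappa> m (W n \<omega>) \<partial>M) < e / (8 * B)) sequentially"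
      using order_tendstoD(2)[OF conv_cont[OF \<kappa>_cont, unfolded conv_def] m] .
    then obtain n2 where n2: "\<And>n. n \<ge> n2 \<Longrightarrow> (\<integral>\<omega>. \<kappa> m (W n \<omega>) \<partial>M) < e / (8 * B)"
      by (auto simp: eventually_sequentially)
    have "\<bar>(\<integral>\<omega>. f (\<chi> i. real (X n i \<omega>)) \<partial>M) - (\<integral>\<omega>. f (\<chi> i. real (Y i \<omega>)) \<partial>N)\<bar> < e" if n: "n \<ge> max n1 n2" for n
    proof -
      have "2 * B * (\<integral>\<omega>. \<kappa> m (W n \<omega>) \<partial>M) < e / 4" "2 * B * (\<integral>\<omega>. \<kappa> m (V \<omega>) \<partial>N) < e / 4"
        using m n2[of n] n B(1) by (simp_all add: field_simps)
      moreover have "n1 \<le> n" using n by simp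
      ultimately show ?thesis using dM[of n] dN n1[of n] by linarith
    qed
    then show "\<exists>n0. \<forall>n\<ge>n0. norm ((\<integral>\<omega>. f (\<chi> i. real (X n i \<omega>)) \<partial>M) - (\<integral>\<omega>. f (\<chi> i. real (Y i \<omega>)) \<partial>N)) < e"
      unfolding real_norm_def by blast
  qed
  show ?thesis
    unfolding converges_in_distribution_def
    using main by (auto intro!: measurable_vec_lambda X Y)
qed

section \<open>Clusters and cells\<close>

lemma field_max_gt_iff: "ereal x < field_max \<xi> A \<omega> \<longleftrightarrow> (\<exists>v\<in>A. x < \<xi> v \<omega>)"
  by (simp add: field_max_def less_SUP_iff)

lemma field_max_le_iff: "field_max \<xi> A \<omega> \<le> ereal x \<longleftrightarrow> (\<forall>v\<in>A. \<not> x < \<xi> v \<omega>)"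
  by (simp add: field_max_def SUP_le_iff not_less)

lemma inj_rvec: "inj (rvec :: int ^ 'd \<Rightarrow> real ^ 'd)"
  by (auto simp: inj_def rvec_def vec_eq_iff)

lemma times_vquot:
  assumes "\<And>i. 0 < c $ i"
  shows "c * vquot x c = x"
  using assms by (simp add: vec_eq_iff vquot_def less_imp_neq[symmetric])

lemma mem_D_set_iff:
  assumes "\<And>i. 0 < c $ i"
  shows "v \<in> D_set C c \<longleftrightarrow> vquot (rvec v) c \<in> C"
proof
  assume "v \<in> D_set C c"
  then obtain y where y: "y \<in> C" "rvec v = c * y" by (auto simp: D_set_def lattice_points_def)
  then have "vquot (rvec v) c = y"
    using assms by (simp add: vec_eq_iff vquot_def less_imp_neq[symmetric])
  with y show "vquot (rvec v) c \<in> C" by simp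
next
  assume "vquot (rvec v) c \<in> C"
  then show "v \<in> D_set C c"
    using times_vquot[OF assms, of "rvec v"] unfolding D_set_def lattice_points_def by (metis CollectI imageI)
qed

text \<open>\<open>D_tilde\<close> consists of the cells whose corner lies in D, so both counts look
  at cells selected by the same rule.\<close>

lemma Q_minus_eq:
  assumes "\<And>i. 0 < c $ i"
  shows "Q_minus C c k = {z. tvec c k * z \<in> D_set C c}"
  by (simp add: Q_minus_def mem_D_set_iff[OF assms] mult.commute)

lemma norm_vec_le:
  fixes x :: "real ^ 'd"
  assumes "\<And>i. \<bar>x $ i\<bar> \<le> b"
  shows "norm x \<le> sqrt (real CARD('d)) * b"
proof -
  have b: "0 \<le> b" using order_trans[OF abs_ge_zero assms] .
  have "(x $ i)\<^sup>2 \<le> b\<^sup>2" for i using power_mono[OF assms, of i 2] by simp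
  then have "(\<Sum>i\<in>UNIV. (x $ i)\<^sup>2) \<le> real CARD('d) * b\<^sup>2"
    using sum_bounded_above[of UNIV "\<lambda>i. (x $ i)\<^sup>2" "b\<^sup>2"] by simp
  then have "norm x \<le> sqrt (real CARD('d) * b\<^sup>2)" by (simp add: norm_vec_def L2_set_def)
  then show ?thesis using b by (simp add: real_sqrt_mult)
qed

lemma successively_const:
  assumes "\<And>a b. a \<in> S \<Longrightarrow> b \<in> S \<Longrightarrow> P a b \<Longrightarrow> f a = f b"
    and "us \<noteq> []" "set us \<subseteq> S" "successively P us"
  shows "f (hd us) = f (last us)"
  using assms(2-)
proof (induction us rule: induct_list012)
  case (3 a b us)
  then show ?case using assms(1)[of a b] by simp
qed simp_all

text \<open>Undoing the scaling, each coordinate differs by at most sqrt d c_i / k^(1/d) < d (t_i +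
  1) \<le> 2 d t_i, as t_i \<ge> 1. The positions inside the two cells account for the additional
  1.\<close>

lemma near_scaled_points:
  fixes c :: "real ^ 'd" and v v' :: "int ^ 'd"
  assumes c: "\<And>i. 0 < c $ i" and k: "0 < k" and t: "\<And>i. 0 < tvec c k $ i"
    and near: "norm (vquot (rvec v') c - vquot (rvec v) c) \<le> sqrt (real CARD('d)) / root CARD('d) (real k)"
  shows "\<bar>cell_index (tvec c k) v $ i - cell_index (tvec c k) v' $ i\<bar> \<le> 2 * int CARD('d) + 1"
proof -
  let ?r = "root CARD('d) (real k)" and ?d = "real CARD('d)"
  let ?t = "tvec c k"
  have r: "0 < ?r" using k by (simp add: real_root_gt_zero)
  have d1: "1 \<le> ?d" by (simp add: Suc_leI)
  have "sqrt ?d \<le> ?d" using d1 by (intro real_le_lsqrt) (auto simp: power2_eq_square mult_le_cancel_left1)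
  have "\<bar>(vquot (rvec v') c - vquot (rvec v) c) $ i\<bar> \<le> sqrt ?d / ?r"
    using component_le_norm_cart near order_trans by blast
  then have "\<bar>real_of_int (v' $ i) - v $ i\<bar> / c $ i \<le> sqrt ?d / ?r"
    using c[of i] by (simp add: vquot_def rvec_def diff_divide_distrib[symmetric] abs_divide)
  then have "\<bar>real_of_int (v' $ i) - v $ i\<bar> \<le> sqrt ?d * (c $ i / ?r)"
    using c[of i] by (simp add: field_simps)
  also have "\<dots> \<le> ?d * (c $ i / ?r)"
    using \<open>sqrt ?d \<le> ?d\<close> c[of i] r by (intro mult_right_mono) auto
  also have "\<dots> < ?d * (real_of_int (?t $ i) + 1)"
  proof -
    have "c $ i / ?r < real_of_int (?t $ i) + 1" by (simp add: tvec_def)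
    then show ?thesis using d1 by (intro mult_strict_left_mono) auto
  qed
  also have "\<dots> \<le> ?d * (2 * real_of_int (?t $ i))"
    using t[of i] by (intro mult_left_mono) auto
  finally have "real_of_int \<bar>v' $ i - v $ i\<bar> < real_of_int (2 * int CARD('d) * ?t $ i)" by simp
  then have *: "\<bar>v' $ i - v $ i\<bar> < 2 * int CARD('d) * ?t $ i" by (simp only: of_int_less_iff)
  have b: "?t $ i * cell_index ?t v $ i \<le> v $ i" "v $ i < ?t $ i * cell_index ?t v $ i + ?t $ i" for v
    using mem_cell_iff[OF t, of v "cell_index ?t v"] by (auto simp: cell_def)
  let ?e = "cell_index ?t v $ i - cell_index ?t v' $ i"
  have "?t $ i * ?e < ?t $ i * (2 * int CARD('d) + 1)" "?t $ i * (- ?e) < ?t $ i * (2 * int CARD('d) + 1)"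
    using * b[of v] b[of v'] by (simp_all add: algebra_simps abs_less_iff)
  then show ?thesis using t[of i] by (simp only: mult_less_cancel_left_pos)
qed

text \<open>The linking radius bounds the diameter of a scaled cell, so exceedances in one cell are
  linked directly. A link between different cells would join two hit cells that are close to each
  other, which \<open>apart\<close> forbids; hence the cell index is constant along every
  chain.\<close>

lemma clusters_eq_cells:
  fixes c :: "real ^ 'd" and X :: "int ^ 'd \<Rightarrow> bool"
  assumes c: "\<And>i. 0 < c $ i" and k: "0 < k" and t: "\<And>i. 0 < tvec c k $ i"
    and apart: "\<And>z z'. z \<in> Q \<Longrightarrow> z' \<in> Q \<Longrightarrow> \<exists>v\<in>cell (tvec c k) z. X v \<Longrightarrow> \<exists>v\<in>cell (tvec c k) z'. X v \<Longrightarrow>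
      \<forall>i. \<bar>z $ i - z' $ i\<bar> \<le> 2 * int CARD('d) + 1 \<Longrightarrow> z = z'"
  shows "clusters {vquot (rvec v) c | v. v \<in> (\<Union>z\<in>Q. cell (tvec c k) z) \<and> X v}
      (sqrt (real CARD('d)) / root CARD('d) (real k)) =
    (\<lambda>z. (\<lambda>v. vquot (rvec v) c) ` {v \<in> cell (tvec c k) z. X v}) ` {z \<in> Q. \<exists>v\<in>cell (tvec c k) z. X v}"
proof -
  let ?t = "tvec c k" and ?r = "root CARD('d) (real k)"
  let ?\<delta> = "sqrt (real CARD('d)) / ?r"
  define \<phi> where "\<phi> v = vquot (rvec v) c" for v
  define V where "V = {v. v \<in> (\<Union>z\<in>Q. cell ?t z) \<and> X v}"
  have r: "0 < ?r" using k by (simp add: real_root_gt_zero)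
  have inj: "inj \<phi>"
    unfolding \<phi>_def inj_def using times_vquot[OF c] by (metis inj_rvec injD)
  have close: "norm (\<phi> v' - \<phi> v) \<le> ?\<delta>" if "v \<in> cell ?t z" "v' \<in> cell ?t z" for v v' z
  proof -
    have "\<bar>(\<phi> v' - \<phi> v) $ i\<bar> \<le> 1 / ?r" for i
    proof -
      have "\<bar>v' $ i - v $ i\<bar> \<le> ?t $ i" using that by (simp add: cell_def abs_le_iff) (smt (verit))
      then have "real_of_int \<bar>v' $ i - v $ i\<bar> \<le> real_of_int (?t $ i)" by (simp only: of_int_le_iff)
      also have "\<dots> \<le> c $ i / ?r" by (simp add: tvec_def)
      finally have "\<bar>real_of_int (v' $ i) - v $ i\<bar> / c $ i \<le> 1 / ?r"
        using c[of i] r by (simp add: field_simps)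
      then show ?thesis
        using c[of i] by (simp add: \<phi>_def vquot_def rvec_def diff_divide_distrib[symmetric] abs_divide)
    qed
    from norm_vec_le[OF this] show ?thesis by simp
  qed
  have idx: "v \<in> cell ?t z \<longleftrightarrow> z = cell_index ?t v" for v z using mem_cell_iff[OF t] .
  have far: "cell_index ?t v = cell_index ?t v'"
    if "v \<in> V" "v' \<in> V" "norm (\<phi> v' - \<phi> v) \<le> ?\<delta>" for v v'
  proof (rule apart)
    show "\<forall>i. \<bar>cell_index ?t v $ i - cell_index ?t v' $ i\<bar> \<le> 2 * int CARD('d) + 1"
      using near_scaled_points[OF c k t] that(3) unfolding \<phi>_def by blast
  qed (use that(1,2) in \<open>auto simp: V_def idx\<close>)
  have same: "same_cluster (\<phi> ` V) ?\<delta> (\<phi> v) (\<phi> v') \<longleftrightarrow> cell_index ?t v = cell_index ?t v'"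
    if v: "v \<in> V" "v' \<in> V" for v v'
  proof
    assume "cell_index ?t v = cell_index ?t v'"
    then have cl: "norm (\<phi> v' - \<phi> v) \<le> ?\<delta>" by (intro close[of _ "cell_index ?t v"]) (simp_all add: idx)
    show "same_cluster (\<phi> ` V) ?\<delta> (\<phi> v) (\<phi> v')"
    proof (cases "v = v'")
      case True
      then show ?thesis unfolding same_cluster_def using v by (intro exI[of _ "[\<phi> v]"]) auto
    next
      case False
      then have "\<phi> v \<noteq> \<phi> v'" using inj by (auto dest: injD)
      then show ?thesis unfolding same_cluster_def using v cl by (intro exI[of _ "[\<phi> v, \<phi> v']"]) auto
    qed
  next
    assume "same_cluster (\<phi> ` V) ?\<delta> (\<phi> v) (\<phi> v')"
    then obtain us where us: "us \<noteq> []" "set us \<subseteq> \<phi> ` V" "hd us = \<phi> v" "last us = \<phi> v'"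
      "successively (\<lambda>a b. norm (b - a) \<le> ?\<delta>) us"
      by (auto simp: same_cluster_def)
    have "cell_index ?t (inv \<phi> a) = cell_index ?t (inv \<phi> b)"
      if ab: "a \<in> \<phi> ` V" "b \<in> \<phi> ` V" "norm (b - a) \<le> ?\<delta>" for a b
    proof -
      obtain w w' where w: "w \<in> V" "w' \<in> V" "a = \<phi> w" "b = \<phi> w'" using ab(1,2) by blast
      show ?thesis using far[OF w(1,2)] ab(3) by (simp add: w(3,4) inv_f_f[OF inj])
    qed
    from successively_const[of "\<phi> ` V" _ "\<lambda>u. cell_index ?t (inv \<phi> u)", OF this us(1,2,5)]
    show "cell_index ?t v = cell_index ?t v'" by (simp add: us inv_f_f[OF inj])
  qed
  define R where "R = {(u, u'). u \<in> \<phi> ` V \<and> u' \<in> \<phi> ` V \<and> same_cluster (\<phi> ` V) ?\<delta> u u'}"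
  have cl: "R `` {\<phi> v} = \<phi> ` {v' \<in> cell ?t (cell_index ?t v). X v'}" if v: "v \<in> V" for v
  proof -
    have "R `` {\<phi> v} = \<phi> ` {v' \<in> V. cell_index ?t v = cell_index ?t v'}"
      using v same[OF v] by (auto simp: R_def)
    also have "{v' \<in> V. cell_index ?t v = cell_index ?t v'} = {v' \<in> cell ?t (cell_index ?t v). X v'}"
      using v by (auto simp: V_def idx)
    finally show ?thesis .
  qed
  have hitQ: "{z \<in> Q. \<exists>v\<in>cell ?t z. X v} = cell_index ?t ` V"
    by (auto simp: V_def idx)
  have "clusters (\<phi> ` V) ?\<delta> = (\<lambda>u. R `` {u}) ` \<phi> ` V"
    by (auto simp: clusters_def R_def quotient_def)
  also have "\<dots> = (\<lambda>v. \<phi> ` {v' \<in> cell ?t (cell_index ?t v). X v'}) ` V"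
    unfolding image_image by (rule image_cong[OF refl cl])
  also have "\<dots> = (\<lambda>z. \<phi> ` {v \<in> cell ?t z. X v}) ` {z \<in> Q. \<exists>v\<in>cell ?t z. X v}"
    unfolding hitQ image_image ..
  finally show ?thesis unfolding \<phi>_def V_def by (simp add: setcompr_eq_image)
qed

lemma L_count_eq:
  assumes t: "\<And>i. 0 < tvec c k $ i" and A: "A \<subseteq> D_set C c"
  shows "L_count \<xi> C c k x A \<omega> =
    (\<Sum>z | tvec c k * z \<in> A. of_bool (\<exists>v\<in>cell (tvec c k) z. x < \<xi> v \<omega>))"
  using A by (simp add: L_count_def J_box_eq_cell[OF t] field_max_gt_iff Int_absorb2)

text \<open>Clusters correspond to hit cells with corner in D. Whichever minimizer is chosen, the
  cluster point is an exceedance in its cell, and since no exceedance is a boundary point it lies in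
  A exactly when the corner of the cell does.\<close>

lemma Ltilde_count_eq_L_count:
  fixes c :: "real ^ 'd"
  assumes c: "\<And>i. 0 < c $ i" and k: "0 < k" and t: "\<And>i. 0 < tvec c k $ i"
    and A: "A \<subseteq> D_set C c" and fin: "finite (Q_minus C c k)"
    and apart: "\<And>z z'. z \<in> Q_minus C c k \<Longrightarrow> z' \<in> Q_minus C c k \<Longrightarrow>
      \<exists>v\<in>cell (tvec c k) z. x < \<xi> v \<omega> \<Longrightarrow> \<exists>v\<in>cell (tvec c k) z'. x < \<xi> v \<omega> \<Longrightarrow>
      \<forall>i. \<bar>z $ i - z' $ i\<bar> \<le> 2 * int CARD('d) + 1 \<Longrightarrow> z = z'"
    and interior: "\<And>v. v \<in> boundary_points (tvec c k) A \<Longrightarrow> \<not> x < \<xi> v \<omega>"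
  shows "Ltilde_count \<xi> C c k x A \<omega> = L_count \<xi> C c k x A \<omega>"
proof -
  let ?t = "tvec c k" and ?Q = "Q_minus C c k"
  define \<phi> where "\<phi> v = vquot (rvec v) c" for v
  define hit where "hit z \<longleftrightarrow> (\<exists>v\<in>cell ?t z. x < \<xi> v \<omega>)" for z
  define cl where "cl z = \<phi> ` {v \<in> cell ?t z. x < \<xi> v \<omega>}" for z
  have idx: "v \<in> cell ?t z \<longleftrightarrow> z = cell_index ?t v" for v z using mem_cell_iff[OF t] .
  have \<phi>: "c * \<phi> v = rvec v" for v using times_vquot[OF c] by (simp add: \<phi>_def)
  have inj: "inj \<phi>" using \<phi> by (metis inj_def inj_rvec injD)
  have "clusters (Phi \<xi> C c k x \<omega>) (sqrt (real CARD('d)) / root CARD('d) (real k)) = cl ` {z \<in> ?Q. hit z}"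
    unfolding Phi_def D_tilde_def J_box_eq_cell[OF t] hit_def cl_def \<phi>_def
    by (rule clusters_eq_cells[where X = "\<lambda>v. x < \<xi> v \<omega>", OF c k t apart])
  then have "Ltilde_count \<xi> C c k x A \<omega> =
    (\<Sum>S\<in>cl ` {z \<in> ?Q. hit z}. of_bool (c * cluster_point S \<in> rvec ` A))"
    using A by (simp add: Ltilde_count_def Int_absorb2)
  also have "\<dots> = (\<Sum>z\<in>{z \<in> ?Q. hit z}. of_bool (c * cluster_point (cl z) \<in> rvec ` A))"
  proof (rule sum.reindex[unfolded comp_def], rule inj_onI)
    fix z z' assume "z \<in> {z \<in> ?Q. hit z}" and eq: "cl z = cl z'"
    then obtain v where "v \<in> cell ?t z" "x < \<xi> v \<omega>" by (auto simp: hit_def)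
    then have v: "v \<in> cell ?t z" "\<phi> v \<in> cl z" by (auto simp: cl_def)
    have "\<phi> v \<in> cl z'" using v(2) eq by simp
    then have "v \<in> cell ?t z'" using inj by (auto simp: cl_def dest: injD)
    with v(1) show "z = z'" by (simp add: idx)
  qed
  also have "\<dots> = (\<Sum>z\<in>{z \<in> ?Q. hit z}. of_bool (?t * z \<in> A))"
  proof (intro sum.cong refl arg_cong[where f = of_bool])
    fix z assume z: "z \<in> {z \<in> ?Q. hit z}"
    have "finite (cl z)" "cl z \<noteq> {}" using z by (auto simp: cl_def hit_def)
    then have "cluster_point (cl z) \<in> cl z" unfolding cluster_point_def by (rule arg_min_if_finite(1))
    then obtain v where v: "v \<in> cell ?t z" "x < \<xi> v \<omega>" "cluster_point (cl z) = \<phi> v"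
      by (auto simp: cl_def)
    have "corner ?t v = ?t * z" using v(1) by (simp add: corner_def idx)
    then have "v \<in> A \<longleftrightarrow> ?t * z \<in> A" using interior[of v] v(2) by (auto simp: boundary_points_def)
    then show "(c * cluster_point (cl z) \<in> rvec ` A) = (?t * z \<in> A)"
      by (simp add: v(3) \<phi> inj_image_mem_iff[OF inj_rvec])
  qed
  also have "\<dots> = (\<Sum>z | ?t * z \<in> A. of_bool (hit z))"
  proof -
    have sub: "{z. ?t * z \<in> A} \<subseteq> ?Q" using A by (auto simp: Q_minus_eq[OF c])
    have "(\<Sum>z\<in>{z \<in> ?Q. hit z}. of_bool (?t * z \<in> A)) = (\<Sum>z\<in>{z \<in> ?Q. hit z \<and> ?t * z \<in> A}. 1 :: nat)"
      using fin by (intro sum.mono_neutral_cong_right) auto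
    also have "\<dots> = (\<Sum>z\<in>{z. ?t * z \<in> A}. of_bool (hit z))"
      using finite_subset[OF sub fin] sub by (intro sum.mono_neutral_cong_left) auto
    finally show ?thesis .
  qed
  finally show ?thesis unfolding L_count_eq[OF t A] hit_def .
qed

section \<open>Poisson limits\<close>

lemma poisson_law_pgf:
  assumes "0 \<le> \<mu>" "0 \<le> s" "s \<le> 1"
  shows "measure_pmf.expectation (poisson_law \<mu>) (\<lambda>k. s ^ k) = exp (- (1 - s) * \<mu>)"
proof (cases "\<mu> = 0")
  case True
  then show ?thesis by (simp add: poisson_law_def)
next
  case False
  then have \<mu>: "0 < \<mu>" using assms by simp
  let ?p = "poisson_pmf \<mu>"
  have *: "pmf ?p k *\<^sub>R s ^ k = exp (- \<mu>) * ((\<mu> * s) ^ k /\<^sub>R fact k)" for k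
    using \<mu> by (simp add: power_mult_distrib divide_inverse)
  have sums: "(\<lambda>k. pmf ?p k *\<^sub>R s ^ k) sums (exp (- \<mu>) * exp (\<mu> * s))"
    unfolding * by (intro sums_mult exp_converges)
  have "integrable (count_space UNIV) (\<lambda>k. pmf ?p k *\<^sub>R s ^ k)"
    using assms sums_summable[OF sums] by (simp add: integrable_count_space_nat_iff)
  then have "(\<integral>k. pmf ?p k *\<^sub>R s ^ k \<partial>count_space UNIV) = exp (- \<mu>) * exp (\<mu> * s)"
    using sums_unique[OF sums] by (simp only: integral_count_space_nat)
  moreover have "measure_pmf.expectation ?p (\<lambda>k. s ^ k) = (\<integral>k. pmf ?p k *\<^sub>R s ^ k \<partial>count_space UNIV)"
    unfolding measure_pmf_eq_density by (subst integral_density) auto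
  ultimately show ?thesis
    using False by (simp add: poisson_law_def exp_add[symmetric] algebra_simps)
qed

lemma independent_poisson_pgf:
  fixes L :: "'g::finite \<Rightarrow> 'b \<Rightarrow> nat"
  assumes N: "prob_space N" "prob_space.indep_vars N (\<lambda>_. count_space UNIV) L UNIV"
    and L: "\<And>g. distr N (count_space UNIV) (L g) = measure_pmf (poisson_law (\<mu> g))"
    and \<mu>: "\<And>g. 0 \<le> \<mu> g" and s: "\<And>g. 0 \<le> s g \<and> s g \<le> 1"
  shows "(\<integral>\<omega>. (\<Prod>g\<in>UNIV. s g ^ L g \<omega>) \<partial>N) = (\<Prod>g\<in>UNIV. exp (- (1 - s g) * \<mu> g))"
proof -
  interpret N: prob_space N by fact
  have Lm [measurable]: "L g \<in> measurable N (count_space UNIV)" for g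
    using N(2) by (auto simp: N.indep_vars_def)
  have "N.indep_vars (\<lambda>_. borel) (\<lambda>g \<omega>. s g ^ L g \<omega>) UNIV"
    using N.indep_vars_compose2[OF N(2), of "\<lambda>g k. s g ^ k" "\<lambda>_. borel"] by simp
  moreover have "integrable N (\<lambda>\<omega>. s g ^ L g \<omega>)" for g
    using s[of g] by (intro N.integrable_const_bound[where B = 1]) (auto intro: power_le_one)
  ultimately have "(\<integral>\<omega>. (\<Prod>g\<in>UNIV. s g ^ L g \<omega>) \<partial>N) = (\<Prod>g\<in>UNIV. \<integral>\<omega>. s g ^ L g \<omega> \<partial>N)"
    by (intro N.indep_vars_lebesgue_integral) auto
  also have "\<dots> = (\<Prod>g\<in>UNIV. exp (- (1 - s g) * \<mu> g))"
  proof (intro prod.cong refl)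
    fix g
    have "(\<integral>\<omega>. s g ^ L g \<omega> \<partial>N) = (\<integral>k. s g ^ k \<partial>distr N (count_space UNIV) (L g))"
      by (subst integral_distr) auto
    then show "(\<integral>\<omega>. s g ^ L g \<omega> \<partial>N) = exp (- (1 - s g) * \<mu> g)"
      using poisson_law_pgf[OF \<mu>, of "s g"] s[of g] by (simp add: L)
  qed
  finally show ?thesis .
qed

text \<open>Sandwich exp(-a / (1 - a)) \<le> 1 - a \<le> exp(-a), both from 1 + y \<le> exp y; the
  left bound uses 1 / (1 - a) = 1 + a / (1 - a).\<close>

lemma tendsto_one_minus_power:
  fixes a :: "nat \<Rightarrow> real" and m :: "nat \<Rightarrow> nat"
  assumes a: "a \<longlonglongrightarrow> 0" "\<And>n. 0 \<le> a n" and m: "(\<lambda>n. real (m n) * a n) \<longlonglongrightarrow> l"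
  shows "(\<lambda>n. (1 - a n) ^ m n) \<longlonglongrightarrow> exp (- l)"
proof (rule tendsto_sandwich)
  have ev: "\<forall>\<^sub>F n in sequentially. a n < 1" using order_tendstoD(2)[OF a(1), of 1] by simp
  show "\<forall>\<^sub>F n in sequentially. exp (- (real (m n) * a n / (1 - a n))) \<le> (1 - a n) ^ m n"
    using ev
  proof eventually_elim
    case (elim n)
    have "1 / (1 - a n) = 1 + a n / (1 - a n)" using elim by (simp add: field_simps)
    also have "\<dots> \<le> exp (a n / (1 - a n))" by (rule exp_ge_add_one_self)
    finally have "exp (- (a n / (1 - a n))) \<le> 1 - a n"
      using elim by (simp add: exp_minus field_simps)
    then have "exp (- (a n / (1 - a n))) ^ m n \<le> (1 - a n) ^ m n" by (intro power_mono) auto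
    then show ?case by (simp add: exp_of_nat_mult[symmetric])
  qed
  show "\<forall>\<^sub>F n in sequentially. (1 - a n) ^ m n \<le> exp (- (real (m n) * a n))"
    using ev
  proof eventually_elim
    case (elim n)
    have "1 - a n \<le> exp (- a n)" using exp_ge_add_one_self[of "- a n"] by simp
    then have "(1 - a n) ^ m n \<le> exp (- a n) ^ m n" using elim by (intro power_mono) auto
    then show ?case by (simp add: exp_of_nat_mult[symmetric])
  qed
  have "(\<lambda>n. real (m n) * a n / (1 - a n)) \<longlonglongrightarrow> l / (1 - 0)"
    by (intro tendsto_intros a m) auto
  then show "(\<lambda>n. exp (- (real (m n) * a n / (1 - a n)))) \<longlonglongrightarrow> exp (- l)"
    by (intro tendsto_intros) simp
  show "(\<lambda>n. exp (- (real (m n) * a n))) \<longlonglongrightarrow> exp (- l)" by (intro tendsto_intros m)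
qed

section \<open>Measurability and counting estimates\<close>

lemma measurable_L_count:
  fixes \<xi> :: "int ^ 'd \<Rightarrow> 'a \<Rightarrow> real" and c :: "real ^ 'd"
  assumes [measurable]: "\<And>v. \<xi> v \<in> borel_measurable M" and c: "\<And>i. 0 < c $ i"
  shows "(\<lambda>\<omega>. real (L_count \<xi> C c k x A \<omega>)) \<in> borel_measurable M"
proof -
  have [measurable]: "Measurable.pred M (\<lambda>\<omega>. \<exists>v\<in>J_box c k z. x < \<xi> v \<omega>)" for z
    using finite_J_box[of c k z, OF c] by (intro pred_intros_finite) auto
  show ?thesis unfolding L_count_def field_max_gt_iff by measurable
qed

text \<open>When a coordinate of \<open>tvec\<close> is 0, infinitely many indices z may qualify;
  the points stay bounded because only the products of z with \<open>tvec\<close> enter, and C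
  bounds these.\<close>

lemma finite_D_tilde:
  fixes c :: "real ^ 'd"
  assumes c: "\<And>i. 0 < c $ i" and C: "bounded C"
  shows "finite (D_tilde C c k)"
proof -
  let ?t = "tvec c k"
  obtain b where b: "\<And>y. y \<in> C \<Longrightarrow> norm y \<le> b" using C by (auto simp: bounded_iff)
  define R where "R i = {- \<lceil>b * c $ i\<rceil> .. \<lceil>b * c $ i\<rceil> + ?t $ i}" for i
  have "D_tilde C c k \<subseteq> {v. \<forall>i. v $ i \<in> R i}"
  proof (intro subsetI CollectI allI)
    fix v i assume "v \<in> D_tilde C c k"
    then obtain z y where z: "vquot (rvec (z * ?t)) c \<in> C" and
      y: "\<forall>i. 0 \<le> y $ i \<and> y $ i < 1" "rvec v = rvec ?t * (rvec z + y)"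
      by (auto simp: D_tilde_def Q_minus_def J_box_def lattice_points_def I_box_def)
    have "\<bar>vquot (rvec (z * ?t)) c $ i\<bar> \<le> b"
      using component_le_norm_cart b[OF z] order_trans by blast
    then have "\<bar>real_of_int (z $ i * ?t $ i)\<bar> \<le> b * c $ i"
      using c[of i] by (simp add: vquot_def rvec_def abs_divide field_simps)
    moreover have "real_of_int (v $ i) = ?t $ i * (z $ i + y $ i)"
      using arg_cong[OF y(2), of "\<lambda>u. u $ i"] by (simp add: rvec_def)
    moreover have "0 \<le> ?t $ i * y $ i" "?t $ i * y $ i \<le> ?t $ i"
      using y(1) tvec_nonneg[of c k i, OF c] by (auto simp: less_imp_le mult_left_le)
    ultimately have "- (b * c $ i) \<le> v $ i" "v $ i \<le> b * c $ i + ?t $ i"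
      by (simp_all add: algebra_simps abs_le_iff)
    then show "v $ i \<in> R i" unfolding R_def by simp linarith
  qed
  then show ?thesis by (rule finite_subset) (rule finite_vec_box, simp add: R_def)
qed

text \<open>The count depends on \<omega> only through the finite set of exceedances in
  \<open>D_tilde\<close>. Summing over all possible sets U reduces the claim to finitely many
  events, so neither the clustering nor the choice of minimizers needs to be measurable by
  itself.\<close>

lemma measurable_Ltilde_count:
  fixes \<xi> :: "int ^ 'd \<Rightarrow> 'a \<Rightarrow> real" and c :: "real ^ 'd"
  assumes [measurable]: "\<And>v. \<xi> v \<in> borel_measurable M" and c: "\<And>i. 0 < c $ i" and C: "bounded C"
  shows "(\<lambda>\<omega>. real (Ltilde_count \<xi> C c k x A \<omega>)) \<in> borel_measurable M"
proof -
  let ?D = "D_tilde C c k"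
  have fin: "finite ?D" using finite_D_tilde[OF c C] .
  define F where "F U = real (\<Sum>S \<in> clusters ((\<lambda>v. vquot (rvec v) c) ` U) (sqrt (real CARD('d)) / root CARD('d) (real k)).
      of_bool (c * cluster_point S \<in> rvec ` (A \<inter> D_set C c)))" for U
  have eq: "real (Ltilde_count \<xi> C c k x A \<omega>) = (\<Sum>U\<in>Pow ?D. F U * of_bool (\<forall>v\<in>?D. v \<in> U \<longleftrightarrow> x < \<xi> v \<omega>))" for \<omega>
  proof -
    define V where "V = {v \<in> ?D. x < \<xi> v \<omega>}"
    have "Phi \<xi> C c k x \<omega> = (\<lambda>v. vquot (rvec v) c) ` V"
      by (simp add: Phi_def V_def setcompr_eq_image)
    then have "real (Ltilde_count \<xi> C c k x A \<omega>) = F V" by (simp add: Ltilde_count_def F_def)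
    also have "\<dots> = (\<Sum>U\<in>Pow ?D. if U = V then F U else 0)" using fin by (simp add: V_def)
    also have "\<dots> = (\<Sum>U\<in>Pow ?D. F U * of_bool (\<forall>v\<in>?D. v \<in> U \<longleftrightarrow> x < \<xi> v \<omega>))"
    proof (intro sum.cong refl)
      fix U assume "U \<in> Pow ?D"
      then have "U = V \<longleftrightarrow> (\<forall>v\<in>?D. v \<in> U \<longleftrightarrow> x < \<xi> v \<omega>)" by (auto simp: V_def)
      then show "(if U = V then F U else 0) = F U * of_bool (\<forall>v\<in>?D. v \<in> U \<longleftrightarrow> x < \<xi> v \<omega>)" by simp
    qed
    finally show ?thesis .
  qed
  have [measurable]: "Measurable.pred M (\<lambda>\<omega>. \<forall>v\<in>?D. v \<in> U \<longleftrightarrow> x < \<xi> v \<omega>)" for U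
    using fin by (intro pred_intros_finite) auto
  show ?thesis unfolding eq by measurable
qed

lemma stationary_field_void:
  fixes \<xi> :: "int ^ 'd \<Rightarrow> 'a \<Rightarrow> real"
  assumes \<xi> [measurable]: "\<And>v. \<xi> v \<in> borel_measurable M" and st: "stationary_field M \<xi>" and A: "finite A"
  shows "\<P>(\<omega> in M. \<forall>v\<in>A. \<not> x < \<xi> (v + h) \<omega>) = \<P>(\<omega> in M. \<forall>v\<in>A. \<not> x < \<xi> v \<omega>)"
proof -
  let ?P = "Pi\<^sub>M UNIV (\<lambda>_ :: int ^ 'd. borel :: real measure)"
  define E where "E = {f \<in> space ?P. \<forall>v\<in>A. \<not> x < f v}"
  have comp [measurable]: "(\<lambda>f. f v) \<in> borel_measurable ?P" for v
    by (rule measurable_component_singleton) simp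
  have "Measurable.pred ?P (\<lambda>f. \<forall>v\<in>A. \<not> x < f v)"
    using A by (intro pred_intros_finite) auto
  then have E: "E \<in> sets ?P" by (simp add: E_def pred_def)
  have m: "(\<lambda>\<omega> v. \<xi> (v + h) \<omega>) \<in> measurable M ?P" for h
    by (rule measurable_PiM_single') auto
  have "\<P>(\<omega> in M. \<forall>v\<in>A. \<not> x < \<xi> (v + h) \<omega>) = measure (distr M ?P (\<lambda>\<omega> v. \<xi> (v + h) \<omega>)) E" for h
    by (subst measure_distr[OF m E]) (auto intro!: arg_cong[where f = "measure M"] simp: E_def space_PiM)
  from this[of h] this[of 0] show ?thesis
    using st by (simp add: stationary_field_def)
qed

text \<open>A point outside the cell misses it in some coordinate i and so differs there from every
  core point by at least g_i + 1 > |\<gamma>_i|, whereas a vector of the scaled ball has i-th entry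
  at most |\<gamma>_i|. The absolute value allows entries of \<gamma> of either sign.\<close>

lemma separated_core:
  assumes g: "g = (\<chi> i. \<lfloor>\<bar>\<gamma> $ i\<bar>\<rfloor>)" and A: "A \<inter> cell t z = {}"
  shows "separated \<gamma> A {t * z + g .. t * z + t - 1 - g}"
  unfolding separated_def
proof (intro subsetI ComplI)
  fix y assume "y \<in> rvec ` {t * z + g .. t * z + t - 1 - g}"
    and "y \<in> {a + e | a e. a \<in> rvec ` A \<and> e \<in> (*) \<gamma> ` cball 0 1}"
  then obtain b a e where b: "b \<in> {t * z + g .. t * z + t - 1 - g}" and a: "a \<in> A"
    and e: "e \<in> cball 0 1" and eq: "rvec b = rvec a + \<gamma> * e" by auto
  have "a \<notin> cell t z" using A a by auto
  then obtain i where i: "a $ i < t $ i * z $ i \<or> t $ i * z $ i + t $ i \<le> a $ i"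
    by (auto simp: cell_def not_le not_less)
  have "t $ i * z $ i + g $ i \<le> b $ i" "b $ i \<le> t $ i * z $ i + t $ i - 1 - g $ i"
    using b by (auto simp: less_eq_vec_def)
  with i have "g $ i + 1 \<le> \<bar>b $ i - a $ i\<bar>" by linarith
  then have "real_of_int (g $ i + 1) \<le> real_of_int \<bar>b $ i - a $ i\<bar>" by (simp only: of_int_le_iff)
  then have "\<bar>\<gamma> $ i\<bar> < \<bar>real_of_int (b $ i) - a $ i\<bar>" unfolding g by simp linarith
  also have "\<dots> = \<bar>\<gamma> $ i\<bar> * \<bar>e $ i\<bar>"
    using arg_cong[OF eq, of "\<lambda>u. u $ i"] by (simp add: rvec_def abs_mult)
  also have "\<dots> \<le> \<bar>\<gamma> $ i\<bar> * 1"
    using e component_le_norm_cart[of e i] by (intro mult_left_mono) auto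
  finally show False by simp
qed

text \<open>The margin is covered by two slabs per axis, \<open>lo i\<close> and
  \<open>hi i\<close>, each of thickness g_i and otherwise as wide as the cell. Overlaps, and
  margins wider than the cell, only weaken the bound.\<close>

lemma card_margin:
  assumes t: "\<And>i. 0 < t $ i" and g: "\<And>i. 0 \<le> g $ i"
  shows "real (card (cell t z - {t * z + g .. t * z + t - 1 - g})) \<le>
    2 * (\<Prod>i\<in>UNIV. real_of_int (t $ i)) * (\<Sum>i\<in>UNIV. real_of_int (g $ i) / real_of_int (t $ i))"
proof -
  define lo where "lo i = {v. \<forall>j. v $ j \<in> (if j = i then {t $ i * z $ i ..< t $ i * z $ i + g $ i}
    else {t $ j * z $ j ..< t $ j * z $ j + t $ j})}" for i
  define hi where "hi i = {v. \<forall>j. v $ j \<in> (if j = i then {t $ i * z $ i + t $ i - g $ i ..< t $ i * z $ i + t $ i}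
    else {t $ j * z $ j ..< t $ j * z $ j + t $ j})}" for i
  have fin: "finite (lo i)" "finite (hi i)" for i
    unfolding lo_def hi_def by (rule finite_vec_box; simp)+
  have tp: "(\<Prod>j\<in>UNIV. real (if j = i then nat (g $ i) else nat (t $ j))) =
    (\<Prod>j\<in>UNIV. real_of_int (t $ j)) * (real_of_int (g $ i) / real_of_int (t $ i))" for i
  proof -
    have "(\<Prod>j\<in>UNIV. real (if j = i then nat (g $ i) else nat (t $ j))) =
      real_of_int (g $ i) * (\<Prod>j\<in>UNIV - {i}. real_of_int (t $ j))"
      using t g[of i] by (subst prod.remove[of _ i]) (auto intro!: prod.cong simp: less_imp_le)
    moreover have "(\<Prod>j\<in>UNIV. real_of_int (t $ j)) = t $ i * (\<Prod>j\<in>UNIV - {i}. real_of_int (t $ j))"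
      by (rule prod.remove) auto
    ultimately show ?thesis using t[of i] by simp
  qed
  have "card (lo i) = (\<Prod>j\<in>UNIV. if j = i then nat (g $ i) else nat (t $ j))" for i
    unfolding lo_def by (subst finite_vec_box; (rule prod.cong)?; simp)
  then have clo: "real (card (lo i)) = (\<Prod>j\<in>UNIV. real_of_int (t $ j)) * (real_of_int (g $ i) / real_of_int (t $ i))" for i
    using tp[of i] by (simp add: of_nat_prod)
  have "card (hi i) = (\<Prod>j\<in>UNIV. if j = i then nat (g $ i) else nat (t $ j))" for i
    unfolding hi_def by (subst finite_vec_box; (rule prod.cong)?; simp)
  then have chi: "real (card (hi i)) = (\<Prod>j\<in>UNIV. real_of_int (t $ j)) * (real_of_int (g $ i) / real_of_int (t $ i))" for i
    using tp[of i] by (simp add: of_nat_prod)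
  have "cell t z - {t * z + g .. t * z + t - 1 - g} \<subseteq> (\<Union>i. lo i \<union> hi i)"
  proof
    fix v assume v: "v \<in> cell t z - {t * z + g .. t * z + t - 1 - g}"
    then obtain i where "v $ i < t $ i * z $ i + g $ i \<or> t $ i * z $ i + t $ i - 1 - g $ i < v $ i"
      by (auto simp: less_eq_vec_def not_le)
    then have "v \<in> lo i \<or> v \<in> hi i" using v by (auto simp: lo_def hi_def cell_def)
    then show "v \<in> (\<Union>i. lo i \<union> hi i)" by auto
  qed
  then have "card (cell t z - {t * z + g .. t * z + t - 1 - g}) \<le> card (\<Union>i. lo i \<union> hi i)"
    using fin by (intro card_mono) auto
  also have "\<dots> \<le> (\<Sum>i\<in>UNIV. card (lo i \<union> hi i))" by (rule card_UN_le) simp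
  also have "\<dots> \<le> (\<Sum>i\<in>UNIV. card (lo i) + card (hi i))" by (intro sum_mono card_Un_le)
  finally have "real (card (cell t z - {t * z + g .. t * z + t - 1 - g})) \<le> real (\<Sum>i\<in>UNIV. card (lo i) + card (hi i))"
    by (simp only: of_nat_le_iff)
  then show ?thesis by (simp add: clo chi sum_distrib_left ac_simps)
qed

section \<open>Lattice points of scaled sets\<close>

lemma mem_K_set_iff:
  assumes "\<And>i. 0 < c $ i"
  shows "v \<in> K_set s c \<longleftrightarrow> (\<forall>i. \<bar>real_of_int (v $ i)\<bar> \<le> s * c $ i)"
proof -
  have "K_set s c = D_set (sym_cube s) c" by (simp add: K_set_def D_set_def)
  then show ?thesis using assms
    by (auto simp: mem_D_set_iff[OF assms] sym_cube_def vquot_def rvec_def abs_le_iff field_simps minus_le_iff)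
qed

lemma finite_K_set:
  assumes "\<And>i. 0 < c $ i"
  shows "finite (K_set s c)"
proof (rule finite_subset)
  show "K_set s c \<subseteq> {v. \<forall>i. v $ i \<in> {- \<lceil>s * c $ i\<rceil> .. \<lceil>s * c $ i\<rceil>}}"
    by (auto simp: mem_K_set_iff[OF assms] abs_le_iff) (smt (verit) le_of_int_ceiling of_int_le_iff of_int_minus ceiling_mono ceiling_of_int)+
qed (rule finite_vec_box, simp)

lemma D_set_subset_D_plus:
  assumes t: "\<And>i. 0 < tvec c k $ i"
  shows "D_set C c \<subseteq> D_plus C c k"
proof
  fix v assume v: "v \<in> D_set C c"
  let ?z = "cell_index (tvec c k) v"
  have "v \<in> J_box c k ?z" by (simp add: J_box_eq_cell[OF t] mem_cell_iff[OF t])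
  moreover from this v have "rvec v \<in> I_box c k ?z \<inter> (*) c ` C"
    by (simp add: J_box_def D_set_def lattice_points_def)
  ultimately show "v \<in> D_plus C c k" by (auto simp: D_plus_def)
qed

lemma cell_subset_D_plus:
  assumes t: "\<And>i. 0 < tvec c k $ i" and z: "tvec c k * z \<in> D_set C c"
  shows "cell (tvec c k) z \<subseteq> D_plus C c k"
proof -
  have "tvec c k * z \<in> J_box c k z"
    using corner_mem_cell[of "tvec c k" z] t by (simp add: J_box_eq_cell[OF t])
  then have "rvec (tvec c k * z) \<in> I_box c k z \<inter> (*) c ` C"
    using z by (simp add: J_box_def D_set_def lattice_points_def)
  then show ?thesis by (auto simp: D_plus_def J_box_eq_cell[OF t])
qed

text \<open>A ball of radius e' in C contains a cube of half-width e = e' / d, by comparison with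
  the l1 norm. An interval of length 2 e c_i contains at least 2 e c_i - 1 integers, which is at
  least e c_i once e c_i \<ge> 1.\<close>

lemma card_D_set_lower:
  fixes C :: "(real ^ 'd) set"
  assumes "interior C \<noteq> {}"
  obtains e where "0 < e" and "\<And>c. (\<And>i. 0 < c $ i) \<Longrightarrow> (\<And>i. 1 \<le> e * c $ i) \<Longrightarrow> finite (D_set C c) \<Longrightarrow>
    (\<Prod>i\<in>UNIV. e * c $ i) \<le> real (card (D_set C c))"
proof -
  obtain a e' where a: "0 < e'" "cball a e' \<subseteq> C"
    using assms by (auto simp: mem_interior_cball)
  define e where "e = e' / real CARD('d)"
  have e: "0 < e" using a(1) by (simp add: e_def)
  show ?thesis
  proof (rule that[OF e])
    fix c :: "real ^ 'd" assume c: "\<And>i. 0 < c $ i" "\<And>i. 1 \<le> e * c $ i" and fin: "finite (D_set C c)"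
    define R where "R i = {\<lceil>a $ i * c $ i - e * c $ i\<rceil> .. \<lfloor>a $ i * c $ i + e * c $ i\<rfloor>}" for i
    have sub: "{v. \<forall>i. v $ i \<in> R i} \<subseteq> D_set C c"
    proof
      fix v assume v: "v \<in> {v. \<forall>i. v $ i \<in> R i}"
      let ?y = "vquot (rvec v) c"
      have "\<bar>(?y - a) $ i\<bar> \<le> e" for i
      proof -
        have "v $ i \<in> R i" using v by blast
        then have "a $ i * c $ i - e * c $ i \<le> v $ i" "v $ i \<le> a $ i * c $ i + e * c $ i"
          by (auto simp: R_def ceiling_le_iff le_floor_iff)
        then show ?thesis using c(1)[of i] by (simp add: vquot_def rvec_def abs_le_iff field_simps)
      qed
      then have "(\<Sum>i\<in>UNIV. \<bar>(?y - a) $ i\<bar>) \<le> (\<Sum>i\<in>(UNIV::'d set). e)" by (intro sum_mono)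
      then have "norm (?y - a) \<le> e'" using norm_le_l1_cart[of "?y - a"] by (simp add: e_def)
      then have "?y \<in> cball a e'" by (simp add: dist_norm norm_minus_commute)
      then show "v \<in> D_set C c" using a(2) by (auto simp: mem_D_set_iff[OF c(1)])
    qed
    have "(\<Prod>i\<in>UNIV. e * c $ i) \<le> (\<Prod>i\<in>UNIV. real (card (R i)))"
    proof (intro prod_mono conjI)
      fix i
      show "0 \<le> e * c $ i" using c(2)[of i] by linarith
      show "e * c $ i \<le> real (card (R i))" using c(2)[of i] by (simp add: R_def) linarith
    qed
    also have "\<dots> = real (card {v. \<forall>i. v $ i \<in> R i})"
      by (subst finite_vec_box) (simp_all add: R_def)
    also have "\<dots> \<le> real (card (D_set C c))" using card_mono[OF fin sub] by simp
    finally show "(\<Prod>i\<in>UNIV. e * c $ i) \<le> real (card (D_set C c))" .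
  qed
qed

section \<open>Asymptotics\<close>

locale cluster_setting = prob_space M for M :: "'a measure" +
  fixes \<xi> :: "int ^ 'd \<Rightarrow> 'a \<Rightarrow> real"
    and C :: "(real ^ 'd) set" and p :: nat
    and c :: "nat \<Rightarrow> real ^ 'd" and s :: real and x :: "nat \<Rightarrow> real"
    and \<gamma> :: "nat \<Rightarrow> real ^ 'd" and \<alpha> :: "nat \<Rightarrow> real" and k :: "nat \<Rightarrow> nat"
    and r :: "(int ^ 'd) rel" and \<theta> \<tau> :: real
    and B :: "'g::finite \<Rightarrow> nat \<Rightarrow> (int ^ 'd) set" and b :: "'g \<Rightarrow> real"
  assumes p_pos: "1 \<le> p" and C: "p_convex p C"
    and c_pos: "\<And>n i. 0 < c n $ i" and c_top: "\<And>i. filterlim (\<lambda>n. c n $ i) at_top sequentially"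
    and \<xi>_meas [measurable]: "\<And>v. \<xi> v \<in> borel_measurable M" and stationary: "stationary_field M \<xi>"
    and k_pos: "\<And>n. 0 < k n" and k_top: "filterlim k at_top sequentially"
    and k_c: "\<And>i. (\<lambda>n. root CARD('d) (real (k n)) / c n $ i) \<longlonglongrightarrow> 0"
    and s_pos: "0 < s" and D_plus_K: "\<And>n. D_plus C (c n) (k n) \<subseteq> K_set s (c n)"
    and D: "cond_D M \<xi> c x (\<lambda>n. K_set s (c n)) \<gamma> \<alpha>"
    and k_\<alpha>: "(\<lambda>n. real (k n) * \<alpha> n) \<longlonglongrightarrow> 0"
    and k_\<gamma>: "vec_smallo (\<lambda>n. root CARD('d) (real (k n)) *\<^sub>R \<gamma> n) c"
    and order: "linear_order r" "translation_invariant r"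
    and Dl: "cond_Dl M \<xi> r c x k \<theta>"
    and B_geometric: "\<And>g. geometric_assumption (B g)"
    and B_D: "\<And>g n. B g n \<subseteq> D_set C (c n)"
    and B_disjoint: "\<And>n. disjoint_family (\<lambda>g. B g n)"
    and B_lim: "\<And>g. (\<lambda>n. real (card (B g n)) / real (card (D_set C (c n)))) \<longlonglongrightarrow> b g"
    and \<tau>_pos: "0 < \<tau>"
    and \<tau>_lim: "(\<lambda>n. real (card (D_set C (c n))) * \<P>(\<omega> in M. \<xi> 0 \<omega> > x n)) \<longlonglongrightarrow> \<tau>"
begin

definition t :: "nat \<Rightarrow> int ^ 'd" where "t n = tvec (c n) (k n)"
definition R :: "nat \<Rightarrow> real" where "R n = root CARD('d) (real (k n))"
definition T :: "nat \<Rightarrow> real" where "T n = (\<Prod>i\<in>UNIV. real_of_int (t n $ i))"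
definition vol :: "nat \<Rightarrow> real" where "vol n = (\<Prod>i\<in>UNIV. c n $ i)"
definition P :: "nat \<Rightarrow> real" where "P n = \<P>(\<omega> in M. \<xi> 0 \<omega> > x n)"
definition Q :: "nat \<Rightarrow> (int ^ 'd) set" where "Q n = {z. t n * z \<in> D_set C (c n)}"
definition margin :: "nat \<Rightarrow> int ^ 'd" where "margin n = (\<chi> i. \<lfloor>\<bar>\<gamma> n $ i\<bar>\<rfloor>)"
definition eps :: "nat \<Rightarrow> real" where
  "eps n = 2 * T n * (\<Sum>i\<in>UNIV. real_of_int (margin n $ i) / real_of_int (t n $ i)) * P n"
text \<open>\<open>er\<close> is the cost of decoupling one cell; it is \<open>o(1/k)\<close>.\<close>

definition pc :: "nat \<Rightarrow> real" where "pc n = exceedance_field.pcell M (\<lambda>v \<omega>. x n < \<xi> v \<omega>) (t n)"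
definition er :: "nat \<Rightarrow> real" where "er n = \<alpha> n + 2 * eps n"
text \<open>Conditions that hold eventually. 2 \<le> c_i / R makes the floor t_i at least half of
  c_i / R, hence positive; 1 \<le> c_i and 1 \<le> R absorb additive constants; 2 \<le> s R puts the
  cells around the origin inside K.\<close>

definition large :: "nat \<Rightarrow> bool" where
  "large n \<longleftrightarrow> (\<forall>i. 1 \<le> c n $ i \<and> 2 \<le> c n $ i / R n) \<and> 1 \<le> R n \<and> 2 \<le> s * R n"
definition N :: "'g \<Rightarrow> nat \<Rightarrow> nat" where "N g n = card {z. t n * z \<in> B g n}"

section \<open>Sizes of cells and windows\<close>

lemma R_pos: "0 < R n" using k_pos[of n] by (simp add: R_def real_root_gt_zero)

lemma R_pow: "R n ^ CARD('d) = real (k n)"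
  unfolding R_def by (rule real_root_pow_pos2) auto

lemma R_top: "filterlim R at_top sequentially"
  unfolding filterlim_at_top
proof
  fix Z :: real
  let ?Z = "max Z 1"
  have "\<forall>\<^sub>F n in sequentially. nat \<lceil>?Z ^ CARD('d)\<rceil> \<le> k n"
    using k_top unfolding filterlim_at_top by blast
  then show "\<forall>\<^sub>F n in sequentially. Z \<le> R n"
  proof eventually_elim
    case (elim n)
    then have "?Z ^ CARD('d) \<le> real (k n)" by linarith
    then have "root CARD('d) (?Z ^ CARD('d)) \<le> R n" unfolding R_def by (intro real_root_le_mono) auto
    then show ?case by (simp add: real_root_power_cancel)
  qed
qed

lemma eventually_large: "\<forall>\<^sub>F n in sequentially. large n"
proof -
  have "filterlim (\<lambda>n. c n $ i / R n) at_top sequentially" for i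
  proof -
    have "filterlim (\<lambda>n. inverse (R n / c n $ i)) at_top sequentially"
      using k_c[of i] c_pos R_pos by (intro filterlim_inverse_at_top) (auto simp: R_def[symmetric])
    then show ?thesis by simp
  qed
  then have "\<forall>\<^sub>F n in sequentially. \<forall>i. 1 \<le> c n $ i \<and> 2 \<le> c n $ i / R n"
    using c_top by (intro eventually_all_finite eventually_conj) (auto simp: filterlim_at_top)
  moreover have "\<forall>\<^sub>F n in sequentially. 1 \<le> R n" "\<forall>\<^sub>F n in sequentially. 2 / s \<le> R n"
    using R_top by (auto simp: filterlim_at_top)
  ultimately show ?thesis
  proof eventually_elim
    case (elim n)
    then show ?case using s_pos by (simp add: large_def field_simps)
  qed
qed

lemma t_le: "real_of_int (t n $ i) \<le> c n $ i / R n"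
  by (simp add: t_def tvec_def R_def)

lemma t_ge:
  assumes "large n" shows "c n $ i / (2 * R n) \<le> real_of_int (t n $ i)"
proof -
  have "2 \<le> c n $ i / R n" using assms by (simp add: large_def)
  moreover have "c n $ i / R n < real_of_int (t n $ i) + 1" by (simp add: t_def tvec_def R_def)
  moreover have "c n $ i / (2 * R n) = (c n $ i / R n) / 2" by simp
  ultimately show ?thesis by linarith
qed

lemma t_pos:
  assumes "large n" shows "0 < t n $ i"
proof -
  have "0 < c n $ i / (2 * R n)" using c_pos R_pos by simp
  then show ?thesis using t_ge[OF assms, of i] by linarith
qed

lemma tvec_pos: "large n \<Longrightarrow> 0 < tvec (c n) (k n) $ i" using t_pos by (simp add: t_def)

lemma T_nonneg: "large n \<Longrightarrow> 0 \<le> T n"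
  unfolding T_def by (intro prod_nonneg) (simp add: t_pos less_imp_le)

lemma P_nonneg: "0 \<le> P n" by (simp add: P_def)

lemma k_T_le:
  assumes "large n" shows "real (k n) * T n \<le> vol n"
proof -
  have "T n \<le> (\<Prod>i\<in>UNIV. c n $ i / R n)"
    unfolding T_def using t_le t_pos[OF assms] by (intro prod_mono) (auto simp: less_imp_le)
  also have "\<dots> = vol n / real (k n)" by (simp add: vol_def prod_dividef R_pow)
  finally show ?thesis using k_pos[of n] by (simp add: field_simps)
qed

lemma D_subset_K: "large n \<Longrightarrow> D_set C (c n) \<subseteq> K_set s (c n)"
  using D_set_subset_D_plus[OF tvec_pos] D_plus_K by blast

lemma finite_D: "large n \<Longrightarrow> finite (D_set C (c n))"
  using D_subset_K finite_K_set[OF c_pos] finite_subset by blast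

lemma cell_Q_subset_K: "large n \<Longrightarrow> z \<in> Q n \<Longrightarrow> cell (t n) z \<subseteq> K_set s (c n)"
  using cell_subset_D_plus[OF tvec_pos] D_plus_K unfolding t_def Q_def by blast

text \<open>\<open>pcell_bounds\<close> works around the origin, which need not be near the scaled
  set C, so \<open>D_plus_K\<close> does not help. K itself is a cube centred at 0, and coordinates
  in these cells are at most 2 t_i \<le> 2 c_i / R \<le> s c_i.\<close>

lemma cell_near_0_subset_K:
  assumes n: "large n" and z: "\<forall>i. \<bar>z $ i\<bar> \<le> 1"
  shows "cell (t n) z \<subseteq> K_set s (c n)"
proof
  fix v assume v: "v \<in> cell (t n) z"
  have "\<bar>real_of_int (v $ i)\<bar> \<le> s * c n $ i" for i
  proof -
    have "z $ i = -1 \<or> z $ i = 0 \<or> z $ i = 1" using z[rule_format, of i] by auto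
    moreover have "t n $ i * z $ i \<le> v $ i" "v $ i < t n $ i * z $ i + t n $ i"
      using v by (auto simp: cell_def)
    ultimately have "\<bar>v $ i\<bar> \<le> 2 * t n $ i" using t_pos[OF n, of i] by (elim disjE) auto
    then have "real_of_int \<bar>v $ i\<bar> \<le> real_of_int (2 * t n $ i)" by (simp only: of_int_le_iff)
    also have "\<dots> \<le> 2 * (c n $ i / R n)" using t_le[of n i] by simp
    also have "\<dots> \<le> (s * R n) * (c n $ i / R n)"
      using n c_pos[of n i] R_pos[of n] by (intro mult_right_mono) (auto simp: large_def)
    also have "\<dots> = s * c n $ i" using R_pos[of n] by simp
    finally show ?thesis by simp
  qed
  then show "v \<in> K_set s (c n)" by (simp add: mem_K_set_iff[OF c_pos])
qed

lemma exceedance_field: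
  assumes n: "large n"
  shows "exceedance_field M (\<lambda>v \<omega>. x n < \<xi> v \<omega>) (t n) (margin n) (K_set s (c n)) (\<alpha> n) (eps n)"
proof
  show "0 < t n $ i" for i using t_pos[OF n] .
  show "Measurable.pred M (\<lambda>\<omega>. x n < \<xi> v \<omega>)" for v by measurable
  show "\<P>(\<omega> in M. \<forall>v\<in>A. \<not> x n < \<xi> (v + h) \<omega>) = \<P>(\<omega> in M. \<forall>v\<in>A. \<not> x n < \<xi> v \<omega>)" if "finite A" for A h
    using stationary_field_void[OF \<xi>_meas stationary that] .
  show m: "0 \<le> margin n" by (simp add: margin_def less_eq_vec_def)
  show "real (card (cell (t n) z - {t n * z + margin n..t n * z + t n - 1 - margin n})) *
      \<P>(\<omega> in M. x n < \<xi> 0 \<omega>) \<le> eps n" for z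
    unfolding eps_def P_def T_def using m
    by (intro mult_right_mono card_margin[OF t_pos[OF n]]) (auto simp: less_eq_vec_def)
  fix A z assume A: "A \<subseteq> K_set s (c n)" "finite A" "cell (t n) z \<subseteq> K_set s (c n)" "A \<inter> cell (t n) z = {}"
  let ?core = "{t n * z + margin n..t n * z + t n - 1 - margin n}"
  have "?core \<subseteq> cell (t n) z"
  proof
    fix v assume v: "v \<in> ?core"
    show "v \<in> cell (t n) z" unfolding cell_def
    proof (intro CollectI allI)
      fix i
      have "0 \<le> margin n $ i" using m by (auto simp: less_eq_vec_def)
      moreover have "t n $ i * z $ i + margin n $ i \<le> v $ i" "v $ i \<le> t n $ i * z $ i + t n $ i - 1 - margin n $ i"
        using v by (auto simp: less_eq_vec_def)
      ultimately show "t n $ i * z $ i \<le> v $ i \<and> v $ i < t n $ i * z $ i + t n $ i" by linarith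
    qed
  qed
  moreover have "separated (\<gamma> n) A ?core"
    using separated_core[OF _ A(4)] by (simp add: margin_def)
  moreover have "is_lattice_box ?core" unfolding is_lattice_box_def by blast
  ultimately show "\<bar>\<P>(\<omega> in M. \<forall>v\<in>A \<union> ?core. \<not> x n < \<xi> v \<omega>)
        - \<P>(\<omega> in M. \<forall>v\<in>A. \<not> x n < \<xi> v \<omega>) * \<P>(\<omega> in M. \<forall>v\<in>?core. \<not> x n < \<xi> v \<omega>)\<bar> \<le> \<alpha> n"
    using D A unfolding cond_D_def field_max_le_iff by (meson order_trans)
qed

section \<open>Orders of magnitude of the error terms\<close>

lemma pc_nonneg: "large n \<Longrightarrow> 0 \<le> pc n"
  using exceedance_field.pcell_nonneg[OF exceedance_field] by (auto simp: pc_def)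

lemma pc_le: "large n \<Longrightarrow> pc n \<le> T n * P n"
  using exceedance_field.pcell_le[OF exceedance_field]
  by (auto simp: pc_def T_def P_def exceedance_field.p0_def[OF exceedance_field])

lemma er_nonneg:
  assumes "large n" shows "0 \<le> er n"
  using order_trans[OF abs_ge_zero exceedance_field.void_insert_cell[OF exceedance_field[OF assms],
    of "{}" 0]] cell_near_0_subset_K[OF assms, of 0]
  by (simp add: er_def)

text \<open>\<open>\<tau>_lim\<close> bounds the product of card D and P. A convex piece of C has
  interior, so card D is at least a constant times \<open>vol\<close>, which turns this into the
  bound used in all later estimates.\<close>

lemma bounded_vol_P: obtains A where "0 < A" "\<forall>\<^sub>F n in sequentially. vol n * P n \<le> A"
proof -
  obtain K where K: "convex_body K" "K \<subseteq> C"
    using C p_pos unfolding p_convex_def by (metis UN_upper lessThan_iff less_le_trans zero_less_one)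
  then have "interior C \<noteq> {}" using interior_mono[of K C] by (auto simp: convex_body_def)
  then obtain e where e: "0 < e" "\<And>c. (\<And>i. 0 < c $ i) \<Longrightarrow> (\<And>i. 1 \<le> e * c $ i) \<Longrightarrow> finite (D_set C c) \<Longrightarrow>
    (\<Prod>i\<in>UNIV. e * c $ i) \<le> real (card (D_set C c))"
    using card_D_set_lower[of C] by blast
  have "\<forall>\<^sub>F n in sequentially. \<forall>i. 1 / e \<le> c n $ i"
    using c_top by (intro eventually_all_finite) (auto simp: filterlim_at_top)
  moreover have "\<forall>\<^sub>F n in sequentially. real (card (D_set C (c n))) * P n < \<tau> + 1"
    using order_tendstoD(2)[OF \<tau>_lim, of "\<tau> + 1"] by (simp add: P_def)
  ultimately have "\<forall>\<^sub>F n in sequentially. vol n * P n \<le> (\<tau> + 1) / e ^ CARD('d)"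
    using eventually_large
  proof eventually_elim
    case (elim n)
    have "1 \<le> e * c n $ i" for i using elim(1)[rule_format, of i] e(1) by (simp add: field_simps)
    then have "(\<Prod>i\<in>UNIV. e * c n $ i) \<le> real (card (D_set C (c n)))"
      using e(2)[of "c n"] c_pos finite_D[OF elim(3)] by blast
    then have "e ^ CARD('d) * vol n \<le> real (card (D_set C (c n)))"
      by (simp add: prod.distrib vol_def)
    then have "e ^ CARD('d) * vol n * P n \<le> real (card (D_set C (c n))) * P n"
      using P_nonneg by (intro mult_right_mono) auto
    then have "e ^ CARD('d) * (vol n * P n) \<le> \<tau> + 1" using elim(2) by (simp add: mult.assoc)
    then show ?case using e(1) by (simp add: field_simps)
  qed
  then show thesis using e(1) \<tau>_pos by (intro that[of "(\<tau> + 1) / e ^ CARD('d)"]) auto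
qed

lemma bounded_k_T_P: obtains A where "0 < A" "\<forall>\<^sub>F n in sequentially. real (k n) * (T n * P n) \<le> A"
proof -
  obtain A where A: "0 < A" "\<forall>\<^sub>F n in sequentially. vol n * P n \<le> A" by (rule bounded_vol_P)
  have "\<forall>\<^sub>F n in sequentially. real (k n) * (T n * P n) \<le> A"
    using A(2) eventually_large
  proof eventually_elim
    case (elim n)
    have "real (k n) * T n * P n \<le> vol n * P n" using k_T_le[OF elim(2)] P_nonneg by (intro mult_right_mono)
    then show ?case using elim(1) by (simp add: mult.assoc)
  qed
  with A(1) show thesis by (rule that)
qed

text \<open>Both rate conditions on k enter here: \<open>k_\<alpha>\<close> for the mixing part,
  \<open>k_\<gamma>\<close> for the margins. The factor 4 is 2 for the two slabs per axis times 2
  from t_i \<ge> c_i / (2 R).\<close>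

lemma tendsto_k_er: "(\<lambda>n. real (k n) * er n) \<longlonglongrightarrow> 0"
proof -
  obtain A where A: "0 < A" "\<forall>\<^sub>F n in sequentially. real (k n) * (T n * P n) \<le> A" by (rule bounded_k_T_P)
  have lim: "(\<lambda>n. 4 * A * (\<Sum>i\<in>UNIV. \<bar>(R n *\<^sub>R \<gamma> n) $ i / c n $ i\<bar>)) \<longlonglongrightarrow> 4 * A * (\<Sum>i\<in>(UNIV::'d set). \<bar>0\<bar>)"
    using k_\<gamma> unfolding vec_smallo_def R_def by (intro tendsto_intros) auto
  have "(\<lambda>n. real (k n) * eps n) \<longlonglongrightarrow> 0"
  proof (rule tendsto_sandwich[OF _ _ tendsto_const])
    show "\<forall>\<^sub>F n in sequentially. 0 \<le> real (k n) * eps n"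
      using eventually_large
    proof eventually_elim
      case (elim n)
      show ?case unfolding eps_def
        using T_nonneg[OF elim] P_nonneg[of n] t_pos[OF elim]
        by (intro mult_nonneg_nonneg sum_nonneg divide_nonneg_nonneg) (auto simp: less_imp_le margin_def)
    qed
    show "\<forall>\<^sub>F n in sequentially. real (k n) * eps n \<le> 4 * A * (\<Sum>i\<in>UNIV. \<bar>(R n *\<^sub>R \<gamma> n) $ i / c n $ i\<bar>)"
      using eventually_large A(2)
    proof eventually_elim
      case (elim n)
      let ?m = "\<Sum>i\<in>UNIV. real_of_int (margin n $ i) / real_of_int (t n $ i)"
      have m0: "0 \<le> ?m"
        using t_pos[OF elim(1)] by (intro sum_nonneg divide_nonneg_nonneg) (auto simp: less_imp_le margin_def)
      have "?m \<le> (\<Sum>i\<in>UNIV. 2 * \<bar>(R n *\<^sub>R \<gamma> n) $ i / c n $ i\<bar>)"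
      proof (rule sum_mono)
        fix i
        have "real_of_int (margin n $ i) / real_of_int (t n $ i) \<le> \<bar>\<gamma> n $ i\<bar> / (c n $ i / (2 * R n))"
          using t_ge[OF elim(1), of i] t_pos[OF elim(1), of i] c_pos[of n i] R_pos[of n]
          by (intro frac_le) (auto simp: margin_def)
        also have "\<dots> = 2 * \<bar>(R n *\<^sub>R \<gamma> n) $ i / c n $ i\<bar>"
          using c_pos[of n i] R_pos[of n] by (simp add: abs_mult abs_divide)
        finally show "real_of_int (margin n $ i) / real_of_int (t n $ i) \<le> 2 * \<bar>(R n *\<^sub>R \<gamma> n) $ i / c n $ i\<bar>" .
      qed
      then have m1: "?m \<le> 2 * (\<Sum>i\<in>UNIV. \<bar>(R n *\<^sub>R \<gamma> n) $ i / c n $ i\<bar>)" by (simp only: sum_distrib_left)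
      have "real (k n) * eps n = 2 * ((real (k n) * (T n * P n)) * ?m)" by (simp add: eps_def)
      also have "\<dots> \<le> 2 * (A * (2 * (\<Sum>i\<in>UNIV. \<bar>(R n *\<^sub>R \<gamma> n) $ i / c n $ i\<bar>)))"
        using m0 m1 elim(2) A(1) by (intro mult_left_mono mult_mono) auto
      finally show ?case by simp
    qed
  qed (use lim in simp)
  from tendsto_add[OF k_\<alpha> tendsto_mult_left[OF this, of 2]] show ?thesis
    by (simp add: er_def algebra_simps)
qed

lemma bounded_k_pc: obtains A where "0 < A" "\<forall>\<^sub>F n in sequentially. real (k n) * pc n \<le> A"
proof -
  obtain A where A: "0 < A" "\<forall>\<^sub>F n in sequentially. real (k n) * (T n * P n) \<le> A" by (rule bounded_k_T_P)
  have "\<forall>\<^sub>F n in sequentially. real (k n) * pc n \<le> A"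
    using A(2) eventually_large
  proof eventually_elim
    case (elim n)
    have "real (k n) * pc n \<le> real (k n) * (T n * P n)" using pc_le[OF elim(2)] by (intro mult_left_mono) auto
    then show ?case using elim(1) by simp
  qed
  with A(1) show thesis by (rule that)
qed

lemma real_k_top: "filterlim (\<lambda>n. real (k n)) at_top sequentially"
  by (rule filterlim_compose[OF filterlim_real_sequentially k_top])

lemma tendsto_pc: "pc \<longlonglongrightarrow> 0"
proof -
  obtain A where A: "0 < A" "\<forall>\<^sub>F n in sequentially. real (k n) * pc n \<le> A" by (rule bounded_k_pc)
  show ?thesis
  proof (rule tendsto_sandwich[OF _ _ tendsto_const])
    show "\<forall>\<^sub>F n in sequentially. 0 \<le> pc n" using eventually_large by eventually_elim (rule pc_nonneg)
    show "\<forall>\<^sub>F n in sequentially. pc n \<le> A / real (k n)"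
      using A(2) by eventually_elim (use k_pos in \<open>simp add: field_simps\<close>)
    show "(\<lambda>n. A / real (k n)) \<longlonglongrightarrow> 0" by (rule tendsto_divide_0[OF tendsto_const filterlim_at_top_imp_at_infinity[OF real_k_top]])
  qed
qed

text \<open>Double hits are summed over O(k) pairs of nearby cells. Since k pc stays bounded and pc
  tends to 0, the squared term also vanishes after multiplication by k.\<close>

lemma tendsto_k_pair: "(\<lambda>n. real (k n) * ((pc n)\<^sup>2 + er n)) \<longlonglongrightarrow> 0"
proof -
  obtain A where A: "0 < A" "\<forall>\<^sub>F n in sequentially. real (k n) * pc n \<le> A" by (rule bounded_k_pc)
  have "(\<lambda>n. real (k n) * (pc n)\<^sup>2) \<longlonglongrightarrow> 0"
  proof (rule tendsto_sandwich[OF _ _ tendsto_const])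
    show "\<forall>\<^sub>F n in sequentially. real (k n) * (pc n)\<^sup>2 \<le> A * pc n"
      using A(2) eventually_large
    proof eventually_elim
      case (elim n)
      have "(real (k n) * pc n) * pc n \<le> A * pc n" using elim pc_nonneg by (intro mult_right_mono) auto
      then show ?case by (simp add: power2_eq_square mult.assoc)
    qed
    show "(\<lambda>n. A * pc n) \<longlonglongrightarrow> 0" using tendsto_mult_left[OF tendsto_pc, of A] by simp
  qed simp
  from tendsto_add[OF this tendsto_k_er] show ?thesis by (simp add: distrib_left)
qed

section \<open>Hit probabilities and numbers of cells\<close>

lemma A_set_eq:
  assumes n: "large n"
  shows "A_set r (c n) (k n) 0 = {z. (\<forall>i. \<bar>z $ i\<bar> \<le> t n $ i) \<and> (0, z) \<in> r \<and> z \<noteq> 0}"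
proof -
  have "z \<in> lattice_points ((+) (rvec 0) ` (*) (rvec (t n)) ` sym_cube 1) \<longleftrightarrow> (\<forall>i. \<bar>z $ i\<bar> \<le> t n $ i)" (is "?l \<longleftrightarrow> ?r") for z
  proof
    assume ?l
    then obtain y where y: "\<forall>i. -1 \<le> y $ i \<and> y $ i \<le> 1" "rvec z = rvec 0 + rvec (t n) * y"
      by (auto simp: lattice_points_def sym_cube_def)
    show ?r
    proof
      fix i
      have "real_of_int (z $ i) = real_of_int (t n $ i) * y $ i"
        using arg_cong[OF y(2), of "\<lambda>u. u $ i"] by (simp add: rvec_def)
      then have "\<bar>real_of_int (z $ i)\<bar> = real_of_int (t n $ i) * \<bar>y $ i\<bar>"
        using t_pos[OF n, of i] by (simp add: abs_mult)
      also have "\<dots> \<le> real_of_int (t n $ i) * 1"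
        using y(1) t_pos[OF n, of i] by (intro mult_left_mono) (auto simp: abs_le_iff minus_le_iff)
      finally show "\<bar>z $ i\<bar> \<le> t n $ i" by simp
    qed
  next
    assume r: ?r
    define y :: "real ^ 'd" where "y = (\<chi> i. z $ i / t n $ i)"
    have "y \<in> sym_cube 1"
      unfolding sym_cube_def
    proof (intro CollectI allI)
      fix i
      have "\<bar>real_of_int (z $ i)\<bar> \<le> real_of_int (t n $ i)" using r[rule_format, of i] by linarith
      then show "-1 \<le> y $ i \<and> y $ i \<le> 1" using t_pos[OF n, of i] by (simp add: y_def field_simps abs_le_iff)
    qed
    moreover have "rvec z = rvec 0 + rvec (t n) * y"
      using t_pos[OF n] by (simp add: vec_eq_iff rvec_def y_def less_imp_neq[symmetric])
    ultimately show ?l by (auto simp: lattice_points_def)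
  qed
  then show ?thesis by (auto simp: A_set_def t_def)
qed

definition \<theta>n :: "nat \<Rightarrow> real" where
  "\<theta>n n = \<P>(\<omega> in M. field_max \<xi> (A_set r (c n) (k n) 0) \<omega> \<le> ereal (x n) \<bar> \<xi> 0 \<omega> > x n)"

lemma pc_bounds:
  assumes n: "large n"
  shows "T n * P n * \<theta>n n \<le> pc n" "pc n \<le> T n * P n * \<theta>n n + 3 ^ CARD('d) * ((pc n)\<^sup>2 + er n)"
proof -
  interpret E: exceedance_field M "\<lambda>v \<omega>. x n < \<xi> v \<omega>" "t n" "margin n" "K_set s (c n)" "\<alpha> n" "eps n"
    by (rule exceedance_field[OF n])
  have "E.p_last r = \<P>(\<omega> in M. field_max \<xi> (A_set r (c n) (k n) 0) \<omega> \<le> ereal (x n) \<and> x n < \<xi> 0 \<omega>)"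
    unfolding E.p_last_def E.last_set_def A_set_eq[OF n] field_max_le_iff by (intro arg_cong[where f = prob]) auto
  also have "\<dots> = \<theta>n n * P n"
  \<comment> \<open>The conditional probability is a quotient by \<open>P n\<close>; if that is 0,
    the joint probability vanishes too and the product formula survives.\<close>
  proof (cases "P n = 0")
    case True
    have "\<P>(\<omega> in M. field_max \<xi> (A_set r (c n) (k n) 0) \<omega> \<le> ereal (x n) \<and> x n < \<xi> 0 \<omega>) \<le> P n"
      unfolding P_def by (intro finite_measure_mono) auto
    then show ?thesis using True by (simp add: measure_le_0_iff)
  next
    case False
    then show ?thesis by (simp add: \<theta>n_def cond_prob_def P_def)
  qed
  finally have pl: "E.p_last r = \<theta>n n * P n" .
  show "T n * P n * \<theta>n n \<le> pc n" "pc n \<le> T n * P n * \<theta>n n + 3 ^ CARD('d) * ((pc n)\<^sup>2 + er n)"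
    using E.pcell_bounds[OF order] cell_near_0_subset_K[OF n]
    by (simp_all add: pl pc_def T_def E.err_def er_def mult_ac)
qed

text \<open>A corner t z in K has |t_i z_i| \<le> s c_i, and c_i \<le> 2 R t_i then gives |z_i|
  \<le> 2 s R. Each coordinate thus takes at most 4 s R + 1 \<le> (4 s + 1) R values, and R^d =
  k.\<close>

lemma finite_Q: "large n \<Longrightarrow> finite (Q n)"
  and card_Q: "large n \<Longrightarrow> real (card (Q n)) \<le> (4 * s + 1) ^ CARD('d) * real (k n)"
proof -
  assume n: "large n"
  define h where "h = \<lfloor>2 * s * R n\<rfloor>"
  have sub: "Q n \<subseteq> {z. \<forall>i. z $ i \<in> {-h..h}}"
  proof (intro subsetI CollectI allI)
    fix z i assume "z \<in> Q n"
    then have "t n * z \<in> K_set s (c n)" using D_subset_K[OF n] by (auto simp: Q_def)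
    then have "\<bar>real_of_int ((t n * z) $ i)\<bar> \<le> s * c n $ i" unfolding mem_K_set_iff[OF c_pos] by blast
    then have "real_of_int (t n $ i) * \<bar>real_of_int (z $ i)\<bar> \<le> s * c n $ i"
      using t_pos[OF n, of i] by (simp add: abs_mult)
    also have "\<dots> \<le> s * (2 * R n * real_of_int (t n $ i))"
      using t_ge[OF n, of i] s_pos R_pos[of n] by (intro mult_left_mono) (auto simp: field_simps)
    finally have "real_of_int (t n $ i) * \<bar>real_of_int (z $ i)\<bar> \<le> real_of_int (t n $ i) * (2 * s * R n)"
      by (simp add: mult_ac)
    then have "\<bar>real_of_int (z $ i)\<bar> \<le> 2 * s * R n" using t_pos[OF n, of i] by simp
    then show "z $ i \<in> {-h..h}" unfolding h_def by simp linarith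
  qed
  have fin: "finite {z :: int ^ 'd. \<forall>i. z $ i \<in> {-h..h}}" by (rule finite_vec_box) simp
  show "finite (Q n)" using finite_subset[OF sub fin] .
  have h: "0 \<le> h" using s_pos R_pos[of n] by (simp add: h_def)
  have "real (card (Q n)) \<le> real (card {z :: int ^ 'd. \<forall>i. z $ i \<in> {-h..h}})"
    using card_mono[OF fin sub] by simp
  also have "\<dots> = (2 * real_of_int h + 1) ^ CARD('d)"
    using h by (subst finite_vec_box) auto
  also have "\<dots> \<le> ((4 * s + 1) * R n) ^ CARD('d)"
  proof (rule power_mono)
    have "2 * real_of_int h + 1 \<le> 4 * s * R n + 1" unfolding h_def by linarith
    then show "2 * real_of_int h + 1 \<le> (4 * s + 1) * R n" using n by (simp add: large_def algebra_simps)
  qed (use h in simp)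
  finally show "real (card (Q n)) \<le> (4 * s + 1) ^ CARD('d) * real (k n)"
    by (simp add: power_mult_distrib R_pow)
qed

lemma B_index_subset_Q: "{z. t n * z \<in> B g n} \<subseteq> Q n"
  using B_D by (auto simp: Q_def)

lemma N_le: "large n \<Longrightarrow> real (N g n) \<le> (4 * s + 1) ^ CARD('d) * real (k n)"
  using card_mono[OF finite_Q B_index_subset_Q, of n g] card_Q[of n] unfolding N_def by linarith

text \<open>Rounding along axis j affects at most 2 t_j points per line and piece, and t_j \<le> c_j
  / R, so the boundary count is at most a constant times vol / R. Multiplied by P it vanishes, as
  vol P is bounded and R tends to infinity.\<close>

lemma finite_boundary: "large n \<Longrightarrow> finite (boundary_points (t n) (B g n))"
  and tendsto_boundary: "(\<lambda>n. real (card (boundary_points (t n) (B g n))) * P n) \<longlonglongrightarrow> 0"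
proof -
  obtain q Bbar where q: "\<And>n. p_convex q (Bbar n)" "\<And>n. B g n = lattice_points (Bbar n)"
    using B_geometric[of g] unfolding geometric_assumption_def by blast
  \<comment> \<open>The bounding box comes from the inclusions of B in D and of D in K.\<close>
  define h where "h n = (\<chi> i. \<lfloor>s * c n $ i\<rfloor>)" for n
  have h: "0 \<le> h n $ i" for n i using s_pos c_pos[of n i] by (simp add: h_def)
  have B_h: "\<bar>v $ i\<bar> \<le> h n $ i" if n: "large n" and v: "v \<in> lattice_points (Bbar n)" for n v i
  proof -
    have "v \<in> K_set s (c n)" using v B_D[of g n] D_subset_K[OF n] by (auto simp: q(2))
    then have "\<bar>real_of_int (v $ i)\<bar> \<le> s * c n $ i" by (simp add: mem_K_set_iff[OF c_pos])
    then show ?thesis unfolding h_def by simp linarith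
  qed
  note bnd = card_boundary_p_convex[OF t_pos q(1) B_h h, folded q(2)]
  show "large n \<Longrightarrow> finite (boundary_points (t n) (B g n))" using bnd(1) by blast
  \<comment> \<open>h_i \<le> s c_i, t_i \<le> c_i and 1 \<le> c_i give 2 (h_i + t_i) + 1 \<le> (2 s
    + 3) c_i. One more such factor, for axis j, completes the product to \<open>vol\<close>.\<close>
  define a where "a = real q * (2 * real CARD('d) * (2 * s + 3) ^ CARD('d))"
  have a: "0 \<le> a" using s_pos by (simp add: a_def)
  have card: "real (card (boundary_points (t n) (B g n))) \<le> a * vol n / R n" if n: "large n" for n
  proof -
    have "real (card (boundary_points (t n) (B g n))) = real_of_int (int (card (boundary_points (t n) (B g n))))" by simp
    also have "\<dots> \<le> real_of_int (int q * (\<Sum>j\<in>UNIV. 2 * t n $ j * (\<Prod>i\<in>UNIV - {j}. 2 * (h n $ i + t n $ i) + 1)))"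
      using bnd(2)[OF n n] by (simp only: of_int_le_iff)
    also have "\<dots> = real q * (\<Sum>j\<in>UNIV. 2 * real_of_int (t n $ j) * (\<Prod>i\<in>UNIV - {j}. 2 * (real_of_int (h n $ i) + real_of_int (t n $ i)) + 1))"
      by simp
    also have "\<dots> \<le> real q * (\<Sum>j\<in>(UNIV :: 'd set). 2 * ((2 * s + 3) ^ CARD('d) * vol n / R n))"
    proof (intro mult_left_mono sum_mono)
      fix j :: 'd
      have "real_of_int (t n $ j) * (\<Prod>i\<in>UNIV - {j}. 2 * (real_of_int (h n $ i) + real_of_int (t n $ i)) + 1)
        \<le> (c n $ j / R n * (2 * s + 3)) * (\<Prod>i\<in>UNIV - {j}. c n $ i * (2 * s + 3))"
      proof (rule mult_mono)
        have "c n $ j / R n * 1 \<le> c n $ j / R n * (2 * s + 3)"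
          using c_pos[of n j] R_pos[of n] s_pos by (intro mult_left_mono) auto
        then show "real_of_int (t n $ j) \<le> c n $ j / R n * (2 * s + 3)" using t_le[of n j] by simp
        show "(\<Prod>i\<in>UNIV - {j}. 2 * (real_of_int (h n $ i) + real_of_int (t n $ i)) + 1) \<le> (\<Prod>i\<in>UNIV - {j}. c n $ i * (2 * s + 3))"
        proof (intro prod_mono conjI)
          fix i
          show "0 \<le> 2 * (real_of_int (h n $ i) + real_of_int (t n $ i)) + 1"
            using h[of n i] t_pos[OF n, of i] by simp
          have "real_of_int (h n $ i) \<le> s * c n $ i" by (simp add: h_def)
          moreover have "real_of_int (t n $ i) \<le> c n $ i"
          proof -
            have "c n $ i / R n \<le> c n $ i / 1"
              using n c_pos[of n i] by (intro divide_left_mono) (auto simp: large_def)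
            then show ?thesis using t_le[of n i] by simp
          qed
          moreover have "1 \<le> c n $ i" using n by (simp add: large_def)
          ultimately show "2 * (real_of_int (h n $ i) + real_of_int (t n $ i)) + 1 \<le> c n $ i * (2 * s + 3)"
            by (simp add: algebra_simps)
        qed
        show "0 \<le> (\<Prod>i\<in>UNIV - {j}. 2 * (real_of_int (h n $ i) + real_of_int (t n $ i)) + 1)"
          using h[of n] t_pos[OF n] by (intro prod_nonneg) (auto intro!: add_nonneg_nonneg simp: less_imp_le)
        show "0 \<le> c n $ j / R n * (2 * s + 3)" using c_pos[of n j] R_pos[of n] s_pos by simp
      qed
      also have "\<dots> = (c n $ j * (2 * s + 3)) * (\<Prod>i\<in>UNIV - {j}. c n $ i * (2 * s + 3)) / R n" by simp
      also have "(c n $ j * (2 * s + 3)) * (\<Prod>i\<in>UNIV - {j}. c n $ i * (2 * s + 3)) = (\<Prod>i\<in>UNIV. c n $ i * (2 * s + 3))"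
        by (rule prod.remove[symmetric]) auto
      also have "\<dots> = (2 * s + 3) ^ CARD('d) * vol n" by (simp add: prod.distrib vol_def)
      finally show "2 * real_of_int (t n $ j) * (\<Prod>i\<in>UNIV - {j}. 2 * (real_of_int (h n $ i) + real_of_int (t n $ i)) + 1)
        \<le> 2 * ((2 * s + 3) ^ CARD('d) * vol n / R n)" by (simp add: mult.assoc)
    qed simp
    also have "\<dots> = a * vol n / R n" by (simp add: a_def)
    finally show ?thesis .
  qed
  obtain A where A: "0 < A" "\<forall>\<^sub>F n in sequentially. vol n * P n \<le> A" by (rule bounded_vol_P)
  show "(\<lambda>n. real (card (boundary_points (t n) (B g n))) * P n) \<longlonglongrightarrow> 0"
  proof (rule tendsto_sandwich[OF _ _ tendsto_const])
    show "\<forall>\<^sub>F n in sequentially. 0 \<le> real (card (boundary_points (t n) (B g n))) * P n"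
      using P_nonneg by simp
    show "\<forall>\<^sub>F n in sequentially. real (card (boundary_points (t n) (B g n))) * P n \<le> a * A / R n"
      using eventually_large A(2)
    proof eventually_elim
      case (elim n)
      have "real (card (boundary_points (t n) (B g n))) * P n \<le> a * vol n / R n * P n"
        using card[OF elim(1)] P_nonneg by (intro mult_right_mono)
      also have "\<dots> = a * (vol n * P n) / R n" by simp
      also have "\<dots> \<le> a * A / R n"
        using elim(2) a R_pos[of n] by (intro divide_right_mono mult_left_mono) auto
      finally show ?case .
    qed
    show "(\<lambda>n. a * A / R n) \<longlonglongrightarrow> 0"
      by (rule tendsto_divide_0[OF tendsto_const filterlim_at_top_imp_at_infinity[OF R_top]])
  qed
qed

lemma tendsto_N_T_P: "(\<lambda>n. real (N g n) * (T n * P n)) \<longlonglongrightarrow> b g * \<tau>"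
proof -
  have "(\<lambda>n. real (card (B g n)) / real (card (D_set C (c n))) * (real (card (D_set C (c n))) * P n)) \<longlonglongrightarrow> b g * \<tau>"
    using tendsto_mult[OF B_lim \<tau>_lim] by (simp add: P_def)
  \<comment> \<open>Cancelling card D requires it to be nonzero, which holds eventually because its
    product with P has the positive limit \<tau>.\<close>
  moreover have "\<forall>\<^sub>F n in sequentially. real (card (B g n)) / real (card (D_set C (c n))) * (real (card (D_set C (c n))) * P n)
      = real (card (B g n)) * P n"
    using order_tendstoD(1)[OF \<tau>_lim \<tau>_pos] by eventually_elim auto
  ultimately have card: "(\<lambda>n. real (card (B g n)) * P n) \<longlonglongrightarrow> b g * \<tau>"
    by (rule Lim_transform_eventually)
  have "(\<lambda>n. real (N g n) * (T n * P n) - real (card (B g n)) * P n) \<longlonglongrightarrow> 0"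
  proof (rule Lim_null_comparison[OF _ tendsto_boundary[of g]])
    show "\<forall>\<^sub>F n in sequentially. norm (real (N g n) * (T n * P n) - real (card (B g n)) * P n)
      \<le> real (card (boundary_points (t n) (B g n))) * P n"
      using eventually_large
    proof eventually_elim
      case (elim n)
      have "\<bar>real (N g n) * T n - real (card (B g n))\<bar> \<le> real (card (boundary_points (t n) (B g n)))"
        unfolding N_def T_def
        using finite_subset[OF B_index_subset_Q finite_Q[OF elim]] finite_subset[OF B_D finite_D[OF elim]]
        by (intro card_corner_diff t_pos[OF elim] finite_boundary[OF elim])
      then have "\<bar>real (N g n) * T n - real (card (B g n))\<bar> * P n \<le> real (card (boundary_points (t n) (B g n))) * P n"
        using P_nonneg by (intro mult_right_mono)
      moreover have "\<bar>real (N g n) * T n - real (card (B g n))\<bar> * P n = norm (real (N g n) * (T n * P n) - real (card (B g n)) * P n)"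
        proof -
        have "real (N g n) * (T n * P n) - real (card (B g n)) * P n = (real (N g n) * T n - real (card (B g n))) * P n"
          by (simp add: algebra_simps)
        then show ?thesis using P_nonneg[of n] by (simp add: abs_mult)
      qed
      ultimately show ?case by simp
    qed
  qed
  from tendsto_add[OF this card] show ?thesis by simp
qed

lemma tendsto_N_pc: "(\<lambda>n. real (N g n) * pc n) \<longlonglongrightarrow> b g * \<theta> * \<tau>"
proof (rule tendsto_sandwich)
  have \<theta>: "\<theta>n \<longlonglongrightarrow> \<theta>" using Dl by (simp add: cond_Dl_def \<theta>n_def[abs_def])
  have main: "(\<lambda>n. real (N g n) * (T n * P n) * \<theta>n n) \<longlonglongrightarrow> b g * \<tau> * \<theta>"
    by (intro tendsto_mult tendsto_N_T_P \<theta>)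
  then show "(\<lambda>n. real (N g n) * (T n * P n) * \<theta>n n) \<longlonglongrightarrow> b g * \<theta> * \<tau>" by (simp add: mult_ac)
  define a where "a = (4 * s + 1) ^ CARD('d) * 3 ^ CARD('d)"
  have "(\<lambda>n. real (N g n) * (T n * P n) * \<theta>n n + a * (real (k n) * ((pc n)\<^sup>2 + er n))) \<longlonglongrightarrow> b g * \<tau> * \<theta> + a * 0"
    by (intro tendsto_intros main tendsto_k_pair)
  then show "(\<lambda>n. real (N g n) * (T n * P n) * \<theta>n n + a * (real (k n) * ((pc n)\<^sup>2 + er n))) \<longlonglongrightarrow> b g * \<theta> * \<tau>"
    by (simp add: mult_ac)
  show "\<forall>\<^sub>F n in sequentially. real (N g n) * (T n * P n) * \<theta>n n \<le> real (N g n) * pc n"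
    using eventually_large
  proof eventually_elim
    case (elim n)
    have "real (N g n) * (T n * P n * \<theta>n n) \<le> real (N g n) * pc n"
      using pc_bounds(1)[OF elim] by (intro mult_left_mono) auto
    then show ?case by (simp add: mult.assoc)
  qed
  show "\<forall>\<^sub>F n in sequentially. real (N g n) * pc n \<le> real (N g n) * (T n * P n) * \<theta>n n + a * (real (k n) * ((pc n)\<^sup>2 + er n))"
    using eventually_large
  proof eventually_elim
    case (elim n)
    have "real (N g n) * pc n \<le> real (N g n) * (T n * P n * \<theta>n n + 3 ^ CARD('d) * ((pc n)\<^sup>2 + er n))"
      using pc_bounds(2)[OF elim] by (intro mult_left_mono) auto
    moreover have "real (N g n) * (3 ^ CARD('d) * ((pc n)\<^sup>2 + er n)) \<le>
      ((4 * s + 1) ^ CARD('d) * real (k n)) * (3 ^ CARD('d) * ((pc n)\<^sup>2 + er n))"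
      using N_le[OF elim] er_nonneg[OF elim] by (intro mult_right_mono) auto
    ultimately show ?case by (simp add: a_def algebra_simps)
  qed
qed

end

context cluster_setting
begin

section \<open>Limits of the generating functions of both counts\<close>

abbreviation "Lc g n \<omega> \<equiv> L_count \<xi> C (c n) (k n) (x n) (B g n) \<omega>"
abbreviation "Lt g n \<omega> \<equiv> Ltilde_count \<xi> C (c n) (k n) (x n) (B g n) \<omega>"

text \<open>For an indicator h, u^h = 1 - (1 - u) h, so the generating function is the thinned
  product of \<open>expectation_prod_hits\<close> with S empty and weight 1 - u_g on the cells
  belonging to g.\<close>

lemma pgf_L_count_error:
  assumes n: "large n" and u: "\<And>g. 0 \<le> u g \<and> u g \<le> 1"
  shows "\<bar>expectation (\<lambda>\<omega>. \<Prod>g\<in>UNIV. u g ^ Lc g n \<omega>) - (\<Prod>g\<in>UNIV. (1 - (1 - u g) * pc n) ^ N g n)\<bar>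
    \<le> real (\<Sum>g\<in>UNIV. N g n) * er n"
proof -
  interpret E: exceedance_field M "\<lambda>v \<omega>. x n < \<xi> v \<omega>" "t n" "margin n" "K_set s (c n)" "\<alpha> n" "eps n"
    by (rule exceedance_field[OF n])
  define Z where "Z g = {z. t n * z \<in> B g n}" for g
  define ZZ where "ZZ = (\<Union>g. Z g)"
  \<comment> \<open>Disjointness of the sets B makes the index g of a cell unique. A cell belonging
    to no g gets an unspecified index, but its weight still lies in [0, 1] and it is not part of
    \<open>ZZ\<close>.\<close>
  define w where "w z = 1 - u (THE g. z \<in> Z g)" for z
  have fin: "finite (Z g)" for g
    using finite_subset[OF B_index_subset_Q finite_Q[OF n]] by (simp add: Z_def)
  have dis: "g = g'" if "z \<in> Z g" "z \<in> Z g'" for z g g'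
    using B_disjoint[of n] that by (auto simp: disjoint_family_on_def Z_def)
  have w: "w z = 1 - u g" if "z \<in> Z g" for z g
  proof -
    have "(THE g. z \<in> Z g) = g" using that dis by blast
    then show ?thesis by (simp add: w_def)
  qed
  have w01: "0 \<le> w z \<and> w z \<le> 1" for z using u by (simp add: w_def)
  have split: "(\<Prod>z\<in>ZZ. f z) = (\<Prod>g\<in>UNIV. \<Prod>z\<in>Z g. f z)" for f :: "int ^ 'd \<Rightarrow> real"
    unfolding ZZ_def using fin dis by (intro prod.UNION_disjoint) auto
  have "u g ^ Lc g n \<omega> = (\<Prod>z\<in>Z g. 1 - w z * of_bool (E.hit z \<omega>))" for g \<omega>
  proof -
    have "u g ^ Lc g n \<omega> = (\<Prod>z\<in>Z g. u g ^ of_bool (E.hit z \<omega>))"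
      unfolding L_count_eq[OF tvec_pos[OF n] B_D]
      by (simp add: power_sum Z_def t_def[symmetric] E.hit_def)
    also have "\<dots> = (\<Prod>z\<in>Z g. 1 - w z * of_bool (E.hit z \<omega>))"
      by (intro prod.cong refl) (simp add: w)
    finally show ?thesis .
  qed
  then have prod_eq: "(\<Prod>g\<in>UNIV. u g ^ Lc g n \<omega>) = (\<Prod>z\<in>ZZ. 1 - w z * of_bool (E.hit z \<omega>))" for \<omega>
    by (simp add: split)
  have "(\<Prod>z\<in>Z g. 1 - w z * pc n) = (1 - (1 - u g) * pc n) ^ N g n" for g
    using w by (simp add: N_def Z_def)
  then have pc_eq: "(\<Prod>z\<in>ZZ. 1 - w z * pc n) = (\<Prod>g\<in>UNIV. (1 - (1 - u g) * pc n) ^ N g n)"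
    by (simp add: split)
  have card: "card ZZ = (\<Sum>g\<in>UNIV. N g n)"
    unfolding ZZ_def N_def Z_def[symmetric] using fin dis by (intro card_UN_disjoint) auto
  have "ZZ \<subseteq> Q n" using B_index_subset_Q by (auto simp: ZZ_def Z_def)
  then have "\<bar>expectation (\<lambda>\<omega>. (\<Prod>z\<in>{}. 1 - of_bool (E.hit z \<omega>)) * (\<Prod>z\<in>ZZ. 1 - w z * of_bool (E.hit z \<omega>)))
      - (1 - E.pcell) ^ card ({} :: (int ^ 'd) set) * (\<Prod>z\<in>ZZ. 1 - w z * E.pcell)\<bar> \<le> real (card ({} :: (int ^ 'd) set) + card ZZ) * E.err"
    using fin cell_Q_subset_K[OF n] w01 by (intro E.expectation_prod_hits) (auto simp: ZZ_def)
  then show ?thesis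
    by (simp add: prod_eq pc_eq card flip: pc_def E.err_def er_def) (simp add: E.err_def er_def)
qed

lemma tendsto_pgf_L_count:
  assumes u: "\<And>g. 0 \<le> u g \<and> u g \<le> 1"
  shows "(\<lambda>n. expectation (\<lambda>\<omega>. \<Prod>g\<in>UNIV. u g ^ Lc g n \<omega>)) \<longlonglongrightarrow> (\<Prod>g\<in>UNIV. exp (- (1 - u g) * (b g * \<theta> * \<tau>)))"
proof -
  have lim: "(\<lambda>n. (1 - (1 - u g) * pc n) ^ N g n) \<longlonglongrightarrow> exp (- (1 - u g) * (b g * \<theta> * \<tau>))" for g
  proof -
    \<comment> \<open>\<open>tendsto_one_minus_power\<close> asks for nonnegativity at every n,
      which is known for \<open>pc\<close> only when n is large; the other values are set to
      0.\<close>
    define a where "a n = (if large n then (1 - u g) * pc n else 0)" for n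
    have ev: "\<forall>\<^sub>F n in sequentially. (1 - u g) * pc n = a n"
      using eventually_large by eventually_elim (simp add: a_def)
    have a0: "a \<longlonglongrightarrow> 0"
      using Lim_transform_eventually[OF tendsto_mult_left[OF tendsto_pc, of "1 - u g"] ev] by simp
    have "(\<lambda>n. (1 - u g) * (real (N g n) * pc n)) \<longlonglongrightarrow> (1 - u g) * (b g * \<theta> * \<tau>)"
      by (intro tendsto_mult_left tendsto_N_pc)
    then have Na: "(\<lambda>n. real (N g n) * a n) \<longlonglongrightarrow> (1 - u g) * (b g * \<theta> * \<tau>)"
      by (rule Lim_transform_eventually) (use ev in eventually_elim, simp add: mult_ac)
    have "0 \<le> a n" for n using u pc_nonneg by (simp add: a_def)
    from tendsto_one_minus_power[OF a0 this Na]
    have "(\<lambda>n. (1 - (1 - u g) * pc n) ^ N g n) \<longlonglongrightarrow> exp (- ((1 - u g) * (b g * \<theta> * \<tau>)))"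
      by (rule Lim_transform_eventually) (use ev in eventually_elim, simp)
    then show ?thesis by (simp only: minus_mult_left)
  qed
  then have main: "(\<lambda>n. \<Prod>g\<in>UNIV. (1 - (1 - u g) * pc n) ^ N g n) \<longlonglongrightarrow> (\<Prod>g\<in>UNIV. exp (- (1 - u g) * (b g * \<theta> * \<tau>)))"
    by (intro tendsto_prod)
  define a where "a = real CARD('g) * (4 * s + 1) ^ CARD('d)"
  have "(\<lambda>n. expectation (\<lambda>\<omega>. \<Prod>g\<in>UNIV. u g ^ Lc g n \<omega>) - (\<Prod>g\<in>UNIV. (1 - (1 - u g) * pc n) ^ N g n)) \<longlonglongrightarrow> 0"
  proof (rule Lim_null_comparison)
    show "(\<lambda>n. a * (real (k n) * er n)) \<longlonglongrightarrow> 0" using tendsto_mult_left[OF tendsto_k_er, of a] by simp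
    show "\<forall>\<^sub>F n in sequentially. norm (expectation (\<lambda>\<omega>. \<Prod>g\<in>UNIV. u g ^ Lc g n \<omega>) - (\<Prod>g\<in>UNIV. (1 - (1 - u g) * pc n) ^ N g n))
      \<le> a * (real (k n) * er n)"
      using eventually_large
    proof eventually_elim
      case (elim n)
      have "real (\<Sum>g\<in>UNIV. N g n) \<le> (\<Sum>g\<in>(UNIV :: 'g set). (4 * s + 1) ^ CARD('d) * real (k n))"
        unfolding of_nat_sum by (intro sum_mono N_le[OF elim])
      then have "real (\<Sum>g\<in>UNIV. N g n) \<le> a * real (k n)" by (simp add: a_def mult.assoc)
      then have "real (\<Sum>g\<in>UNIV. N g n) * er n \<le> a * real (k n) * er n"
        using er_nonneg[OF elim] by (rule mult_right_mono)
      then show ?case using pgf_L_count_error[of n u, OF elim u] by (simp add: mult.assoc)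
    qed
  qed
  from tendsto_add[OF this main] show ?thesis by simp
qed

lemma L_count_meas [measurable]: "(\<lambda>\<omega>. real (Lc g n \<omega>)) \<in> borel_measurable M"
  by (rule measurable_L_count[OF \<xi>_meas c_pos])

lemma bounded_C: "bounded C"
proof -
  obtain K where K: "\<And>i. i < p \<Longrightarrow> convex_body (K i)" "C = (\<Union>i<p. K i)"
    using C by (auto simp: p_convex_def)
  then show ?thesis by (auto intro!: bounded_UN simp: convex_body_def compact_imp_bounded)
qed

lemma Ltilde_count_meas [measurable]: "(\<lambda>\<omega>. real (Lt g n \<omega>)) \<in> borel_measurable M"
  by (rule measurable_Ltilde_count[OF \<xi>_meas c_pos bounded_C])

definition mismatch :: "nat \<Rightarrow> 'a set" where
  "mismatch n = {\<omega> \<in> space M. \<exists>g. Lt g n \<omega> \<noteq> Lc g n \<omega>}"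

lemma mismatch_sets [measurable]: "mismatch n \<in> events"
proof -
  have "mismatch n = {\<omega> \<in> space M. \<exists>g\<in>UNIV. real (Lt g n \<omega>) \<noteq> real (Lc g n \<omega>)}"
    by (auto simp: mismatch_def)
  moreover have "Measurable.pred M (\<lambda>\<omega>. real (Lt g n \<omega>) \<noteq> real (Lc g n \<omega>))" for g
    by measurable
  then have "Measurable.pred M (\<lambda>\<omega>. \<exists>g\<in>UNIV. real (Lt g n \<omega>) \<noteq> real (Lc g n \<omega>))"
    by (intro pred_intros_finite finite)
  ultimately show ?thesis by (simp add: pred_def)
qed

text \<open>Union bound over the two causes of disagreement. There are O(k) pairs of nearby cells,
  each doubly hit with probability at most pc^2 + er; the expected number of exceedances at boundary
  points tends to 0 by \<open>tendsto_boundary\<close>.\<close>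

lemma tendsto_mismatch: "(\<lambda>n. prob (mismatch n)) \<longlonglongrightarrow> 0"
proof -
  define m where "m = 2 * int CARD('d) + 1"
  define Nb :: "(int ^ 'd) set" where "Nb = {v. \<forall>i. v $ i \<in> {-m..m}}"
  have Nb: "finite Nb" unfolding Nb_def by (rule finite_vec_box) simp
  define a where "a = (4 * s + 1) ^ CARD('d) * real (card Nb)"
  have le: "prob (mismatch n) \<le> a * (real (k n) * ((pc n)\<^sup>2 + er n))
    + (\<Sum>g\<in>UNIV. real (card (boundary_points (t n) (B g n))) * P n)" if n: "large n" for n
  proof -
    interpret E: exceedance_field M "\<lambda>v \<omega>. x n < \<xi> v \<omega>" "t n" "margin n" "K_set s (c n)" "\<alpha> n" "eps n"
      by (rule exceedance_field[OF n])
    define W where "W = {(z, z'). z \<in> Q n \<and> z' \<in> Q n \<and> z \<noteq> z' \<and> (\<forall>i. \<bar>z $ i - z' $ i\<bar> \<le> m)}"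
    have W_sub: "W \<subseteq> (\<lambda>(z, v). (z, z + v)) ` (Q n \<times> Nb)"
    proof
      fix y assume "y \<in> W"
      then obtain z z' where y: "y = (z, z')" "z \<in> Q n" "\<forall>i. \<bar>z $ i - z' $ i\<bar> \<le> m" by (auto simp: W_def)
      have "z' - z \<in> Nb" using y(3) by (auto simp: Nb_def abs_le_iff) (smt (verit))
      then show "y \<in> (\<lambda>(z, v). (z, z + v)) ` (Q n \<times> Nb)"
        using y by (auto intro!: image_eqI[of _ _ "(z, z' - z)"])
    qed
    have finW: "finite W" using finite_subset[OF W_sub] finite_Q[OF n] Nb by simp
    have "card W \<le> card (Q n \<times> Nb)"
      using surj_card_le[OF _ W_sub] finite_Q[OF n] Nb by simp
    then have "real (card W) \<le> real (card (Q n)) * real (card Nb)"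
      by (simp add: card_cartesian_product flip: of_nat_mult)
    also have "\<dots> \<le> a * real (k n)"
      using mult_right_mono[OF card_Q[OF n], of "real (card Nb)"] by (simp add: a_def mult_ac)
    finally have cW: "real (card W) \<le> a * real (k n)" .
    let ?U1 = "\<Union>(z, z')\<in>W. {\<omega> \<in> space M. E.hit z \<omega> \<and> E.hit z' \<omega>}"
    let ?U2 = "\<Union>g. {\<omega> \<in> space M. \<exists>v\<in>boundary_points (t n) (B g n). x n < \<xi> v \<omega>}"
    have sub: "mismatch n \<subseteq> ?U1 \<union> ?U2"
    proof
      fix \<omega> assume "\<omega> \<in> mismatch n"
      then obtain g where \<omega>: "\<omega> \<in> space M" "Lt g n \<omega> \<noteq> Lc g n \<omega>" by (auto simp: mismatch_def)
      have Qm: "Q_minus C (c n) (k n) = Q n" by (simp add: Q_minus_eq[OF c_pos] Q_def t_def)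
      show "\<omega> \<in> ?U1 \<union> ?U2"
      proof (rule ccontr)
        assume neg: "\<omega> \<notin> ?U1 \<union> ?U2"
        have "Lt g n \<omega> = Lc g n \<omega>"
        proof (rule Ltilde_count_eq_L_count[OF c_pos k_pos tvec_pos[OF n] B_D])
          show "finite (Q_minus C (c n) (k n))" by (simp add: Qm finite_Q[OF n])
          show "\<not> x n < \<xi> v \<omega>" if "v \<in> boundary_points (tvec (c n) (k n)) (B g n)" for v
            using that neg \<omega>(1) by (auto simp: t_def)
          show "z = z'" if "z \<in> Q_minus C (c n) (k n)" "z' \<in> Q_minus C (c n) (k n)"
            "\<exists>v\<in>cell (tvec (c n) (k n)) z. x n < \<xi> v \<omega>" "\<exists>v\<in>cell (tvec (c n) (k n)) z'. x n < \<xi> v \<omega>"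
            "\<forall>i. \<bar>z $ i - z' $ i\<bar> \<le> 2 * int CARD('d) + 1" for z z'
          proof (rule ccontr)
            assume "z \<noteq> z'"
            then have "(z, z') \<in> W" using that by (auto simp: W_def Qm m_def)
            moreover have "E.hit z \<omega>" "E.hit z' \<omega>" using that(3,4) unfolding E.hit_def by (simp_all add: t_def)
            ultimately show False using neg \<omega>(1) by blast
          qed
        qed
        then show False using \<omega>(2) by simp
      qed
    qed
    have m2: "{\<omega> \<in> space M. \<exists>v\<in>boundary_points (t n) (B g n). x n < \<xi> v \<omega>} \<in> events" for g
    proof -
      have "Measurable.pred M (\<lambda>\<omega>. \<exists>v\<in>boundary_points (t n) (B g n). x n < \<xi> v \<omega>)"
        using finite_boundary[OF n, of g] by (intro pred_intros_finite) auto
      then show ?thesis by (simp add: pred_def)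
    qed
    have m1: "{\<omega> \<in> space M. E.hit z \<omega> \<and> E.hit z' \<omega>} \<in> events" for z z' by measurable
    have s1: "?U1 \<in> events" using finW m1 by (intro sets.finite_UN) auto
    have s2: "?U2 \<in> events" using m2 by (intro sets.finite_UN) auto
    have "prob (mismatch n) \<le> prob (?U1 \<union> ?U2)" using sub s1 s2 by (intro finite_measure_mono) auto
    also have "\<dots> \<le> prob ?U1 + prob ?U2" using s1 s2 by (intro measure_Un_le) auto
    also have "prob ?U1 \<le> (\<Sum>y\<in>W. case y of (z, z') \<Rightarrow> \<P>(\<omega> in M. E.hit z \<omega> \<and> E.hit z' \<omega>))"
      using finW m1 finite_measure_subadditive_finite[OF finW, of "\<lambda>(z, z'). {\<omega> \<in> space M. E.hit z \<omega> \<and> E.hit z' \<omega>}"]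
      by (auto simp: case_prod_beta image_subset_iff)
    also have "\<dots> \<le> (\<Sum>y\<in>W. (pc n)\<^sup>2 + er n)"
    proof (intro sum_mono)
      fix y assume "y \<in> W"
      then obtain z z' where y: "y = (z, z')" "z \<in> Q n" "z' \<in> Q n" "z \<noteq> z'" by (auto simp: W_def)
      show "(case y of (z, z') \<Rightarrow> \<P>(\<omega> in M. E.hit z \<omega> \<and> E.hit z' \<omega>)) \<le> (pc n)\<^sup>2 + er n"
        using E.prob_two_hits[OF y(4) cell_Q_subset_K[OF n y(2)] cell_Q_subset_K[OF n y(3)]]
        by (simp add: y(1) pc_def er_def E.err_def)
    qed
    also have "\<dots> = real (card W) * ((pc n)\<^sup>2 + er n)" by simp
    also have "\<dots> \<le> a * real (k n) * ((pc n)\<^sup>2 + er n)"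
      using cW er_nonneg[OF n] by (intro mult_right_mono) auto
    also have "prob ?U2 \<le> (\<Sum>g\<in>UNIV. \<P>(\<omega> in M. \<exists>v\<in>boundary_points (t n) (B g n). x n < \<xi> v \<omega>))"
      using m2 by (intro finite_measure_subadditive_finite) auto
    also have "\<dots> \<le> (\<Sum>g\<in>UNIV. real (card (boundary_points (t n) (B g n))) * P n)"
      using E.prob_exists_le[OF finite_boundary[OF n]] by (intro sum_mono) (simp add: E.p0_def P_def)
    finally show ?thesis by (simp add: mult.assoc)
  qed
  have "(\<lambda>n. a * (real (k n) * ((pc n)\<^sup>2 + er n)) + (\<Sum>g\<in>UNIV. real (card (boundary_points (t n) (B g n))) * P n))
    \<longlonglongrightarrow> a * 0 + (\<Sum>g\<in>(UNIV :: 'g set). 0)"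
    by (intro tendsto_intros tendsto_k_pair tendsto_boundary)
  then have lim: "(\<lambda>n. a * (real (k n) * ((pc n)\<^sup>2 + er n)) + (\<Sum>g\<in>UNIV. real (card (boundary_points (t n) (B g n))) * P n)) \<longlonglongrightarrow> 0"
    by simp
  show ?thesis
    by (rule tendsto_sandwich[OF _ _ tendsto_const lim])
      (use eventually_large in \<open>auto elim!: eventually_mono intro: le\<close>)
qed

text \<open>Both products lie in [0, 1] and agree off \<open>mismatch n\<close>, so their
  expectations differ by at most its probability.\<close>

lemma tendsto_pgf_Ltilde_count:
  assumes u: "\<And>g. 0 \<le> u g \<and> u g \<le> 1"
  shows "(\<lambda>n. expectation (\<lambda>\<omega>. \<Prod>g\<in>UNIV. u g ^ Lt g n \<omega>)) \<longlonglongrightarrow> (\<Prod>g\<in>UNIV. exp (- (1 - u g) * (b g * \<theta> * \<tau>)))"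
proof -
  have prod01: "0 \<le> (\<Prod>g\<in>UNIV. u g ^ l g)" "(\<Prod>g\<in>UNIV. u g ^ l g) \<le> 1" for l :: "'g \<Rightarrow> nat"
    using u by (auto intro!: prod_nonneg prod_le_1 power_le_one)
  have pm: "(\<lambda>\<omega>. \<Prod>g\<in>UNIV. u g ^ f g \<omega>) \<in> borel_measurable M"
    if "\<And>g. (\<lambda>\<omega>. real (f g \<omega>)) \<in> borel_measurable M" for f :: "'g \<Rightarrow> 'a \<Rightarrow> nat"
  proof -
    \<comment> \<open>Measurability is given for the real-valued counts; the floor recovers the
      natural number in the exponent.\<close>
    have "(\<lambda>\<omega>. u g ^ nat \<lfloor>real (f g \<omega>)\<rfloor>) \<in> borel_measurable M" for g
      using that[of g] by measurable
    then show ?thesis by (intro borel_measurable_prod) simp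
  qed
  have i: "integrable M (\<lambda>\<omega>. \<Prod>g\<in>UNIV. u g ^ Lt g n \<omega>)" "integrable M (\<lambda>\<omega>. \<Prod>g\<in>UNIV. u g ^ Lc g n \<omega>)" for n
    using prod01 by (auto intro!: integrable_const_bound[where B = 1] pm)
  have "(\<lambda>n. expectation (\<lambda>\<omega>. \<Prod>g\<in>UNIV. u g ^ Lt g n \<omega>) - expectation (\<lambda>\<omega>. \<Prod>g\<in>UNIV. u g ^ Lc g n \<omega>)) \<longlonglongrightarrow> 0"
  proof (rule Lim_null_comparison[OF always_eventually tendsto_mismatch], rule allI)
    fix n
    have "\<bar>expectation (\<lambda>\<omega>. (\<Prod>g\<in>UNIV. u g ^ Lt g n \<omega>) - (\<Prod>g\<in>UNIV. u g ^ Lc g n \<omega>))\<bar>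
      \<le> expectation (\<lambda>\<omega>. \<bar>(\<Prod>g\<in>UNIV. u g ^ Lt g n \<omega>) - (\<Prod>g\<in>UNIV. u g ^ Lc g n \<omega>)\<bar>)"
      by (rule integral_abs_bound)
    also have "\<dots> \<le> expectation (indicator (mismatch n))"
    proof (rule integral_mono)
      show "integrable M (\<lambda>\<omega>. \<bar>(\<Prod>g\<in>UNIV. u g ^ Lt g n \<omega>) - (\<Prod>g\<in>UNIV. u g ^ Lc g n \<omega>)\<bar>)"
        by (intro integrable_abs Bochner_Integration.integrable_diff i)
      show "integrable M (indicator (mismatch n) :: 'a \<Rightarrow> real)"
        by (intro integrable_const_bound[where B = 1]) (auto simp: indicator_def)
      fix \<omega> assume \<omega>: "\<omega> \<in> space M"
      show "\<bar>(\<Prod>g\<in>UNIV. u g ^ Lt g n \<omega>) - (\<Prod>g\<in>UNIV. u g ^ Lc g n \<omega>)\<bar> \<le> indicator (mismatch n) \<omega>"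
      proof (cases "\<omega> \<in> mismatch n")
        case True
        then show ?thesis
          using prod01[of "\<lambda>g. Lt g n \<omega>"] prod01[of "\<lambda>g. Lc g n \<omega>"] by (simp add: abs_le_iff)
      next
        case False
        then have "Lt g n \<omega> = Lc g n \<omega>" for g using \<omega> by (auto simp: mismatch_def)
        then show ?thesis by simp
      qed
    qed
    finally show "norm (expectation (\<lambda>\<omega>. \<Prod>g\<in>UNIV. u g ^ Lt g n \<omega>) - expectation (\<lambda>\<omega>. \<Prod>g\<in>UNIV. u g ^ Lc g n \<omega>)) \<le> prob (mismatch n)"
      using i by simp
  qed
  from tendsto_add[OF this tendsto_pgf_L_count[of u, OF u]] show ?thesis by simp
qed

end

theorem theorem6p1:
  fixes M :: "'a measure"
    and \<xi> :: "int ^ 'd \<Rightarrow> 'a \<Rightarrow> real"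
    and C :: "(real ^ 'd) set" and p :: nat
    and c :: "nat \<Rightarrow> real ^ 'd"
    and s :: real
    and x :: "nat \<Rightarrow> real"
    and \<gamma> :: "nat \<Rightarrow> real ^ 'd" and \<alpha> :: "nat \<Rightarrow> real"
    and k :: "nat \<Rightarrow> nat"
    and r :: "(int ^ 'd) rel"
    and \<theta> \<tau> :: real
    and B :: "'g::finite \<Rightarrow> nat \<Rightarrow> (int ^ 'd) set"
    and b :: "'g \<Rightarrow> real"
    and N :: "'b measure" and L :: "'g \<Rightarrow> 'b \<Rightarrow> nat"
  assumes C: "1 \<le> p" "p_convex p C" "measure lebesgue C = 1"
    and c: "\<And>n i. 0 < c n $ i" "\<And>i. filterlim (\<lambda>n. c n $ i) at_top sequentially"
    and field: "prob_space M" "\<And>v. \<xi> v \<in> borel_measurable M" "stationary_field M \<xi>"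
    and k: "\<And>n. 0 < k n" "filterlim k at_top sequentially"
      "\<And>i. (\<lambda>n. root CARD('d) (real (k n)) / c n $ i) \<longlonglongrightarrow> 0"
    and K: "0 < s" "\<And>n. D_plus C (c n) (k n) \<subseteq> K_set s (c n)"
    and D: "cond_D M \<xi> c x (\<lambda>n. K_set s (c n)) \<gamma> \<alpha>"
    and k_mixing: "(\<lambda>n. real (k n) * \<alpha> n) \<longlonglongrightarrow> 0"
      "vec_smallo (\<lambda>n. root CARD('d) (real (k n)) *\<^sub>R \<gamma> n) c"
    and order: "linear_order r" "translation_invariant r"
    and Dl: "cond_Dl M \<xi> r c x k \<theta>" "0 < \<theta>" "\<theta> \<le> 1"
    and B: "\<And>g. geometric_assumption (B g)"
      "\<And>g n. B g n \<subseteq> D_set C (c n)"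
      "\<And>n. disjoint_family (\<lambda>g. B g n)"
    and b: "\<And>g. 0 \<le> b g"
      "\<And>g. (\<lambda>n. real (card (B g n)) / real (card (D_set C (c n)))) \<longlonglongrightarrow> b g"
    and \<tau>: "0 < \<tau>"
      "(\<lambda>n. real (card (D_set C (c n))) * \<P>(\<omega> in M. \<xi> 0 \<omega> > x n)) \<longlonglongrightarrow> \<tau>"
    and L: "prob_space N" "prob_space.indep_vars N (\<lambda>_. count_space UNIV) L UNIV"
      "\<And>g. distr N (count_space UNIV) (L g) = measure_pmf (poisson_law (b g * \<theta> * \<tau>))"
  shows "converges_in_distribution M
      (\<lambda>n \<omega>. (\<chi> g. real (L_count \<xi> C (c n) (k n) (x n) (B g n) \<omega>)) :: real ^ 'g)
      N (\<lambda>\<omega>. \<chi> g. real (L g \<omega>)) \<and>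
    converges_in_distribution M
      (\<lambda>n \<omega>. (\<chi> g. real (Ltilde_count \<xi> C (c n) (k n) (x n) (B g n) \<omega>)) :: real ^ 'g)
      N (\<lambda>\<omega>. \<chi> g. real (L g \<omega>))"
proof -
  have \<mu>: "0 \<le> b g * \<theta> * \<tau>" for g using b(1) Dl(2) \<tau>(1) by simp
  interpret cluster_setting M \<xi> C p c s x \<gamma> \<alpha> k r \<theta> \<tau> B b
    by (intro cluster_setting.intro cluster_setting_axioms.intro; fact)
  note L_pgf = independent_poisson_pgf[OF L \<mu>]
  have [measurable]: "L g \<in> measurable N (count_space UNIV)" for g
    using L(2) by (auto simp: prob_space.indep_vars_def[OF L(1)])
  have Lm: "(\<lambda>\<omega>. real (L g \<omega>)) \<in> borel_measurable N" for g by measurable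
  show ?thesis
    using tendsto_pgf_L_count tendsto_pgf_Ltilde_count
    by (intro conjI converges_in_distribution_pgf[OF field(1) L(1)] L_count_meas Ltilde_count_meas Lm)
      (simp_all add: L_pgf)
qed

end
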